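(* Let $N>p>1$, $s>-p$, $0<\mu<\bar\mu:=\big(\frac{N-p}{p}\big)^p$ and $q=p^*_s-1$, so that $\gamma_*=\frac{N-p}{p}$ and $Y_*:=\bar\mu-\mu>0$. Let $v>0$ be a solution on $(R_0,+\infty)$, $R_0>0$, of $$-\big(r^{N-1}|v'|^{p-2}v'\big)'=\mu\,r^{N-1-p}v^{p-1}+r^{N-1+s}v^{q}\qquad(\ast)$$ with associated orbit $(x,Y)$, and let $\mathcal H$ be the function defined in the context. Then $\mathcal H$ is constant along the orbit, its value $\kappa$ satisfies $\mathcal H(P_* )\le\kappa\le0$, and exactly one of the following holds. (I) $\kappa=\mathcal H(P_* )$ and $v(r)=A_*\,r^{-\gamma_*}$ for every $r>R_0$, with $A_*=(\bar\mu-\mu)^{1/(q-p+1)}$. (II) $\mathcal H(P_* )<\kappa<0$ and the orbit is a periodic orbit of the planar system surrounding $P_*$. In this case $v$ extends to a positive solution of $(\ast)$ on all of $(0,+\infty)$ and $$r^{\gamma_*}v(r)=\Psi(\ln r),\qquad r>0,$$ where $\Psi$ is a positive, non-constant, $T$-periodic function for some $T=T(\kappa)>0$. In particular $\limsup_{r\to\infty}r^{\gamma_*}v(r)$ and $\liminf_{r\to\infty}r^{\gamma_*}v(r)$ are distinct positive numbers, so $v$ has no exact decay rate. (III) $\kappa=0$ and the orbit is the heteroclinic connection from $P_-$ to $P_+$ lying on the curve $Y=\frac{N+s}{N-p}\big(h(x)-\mu\big)$, $x\in(\nu_-,\nu_+)$. In this case $v$ extends to a positive solution of $(\ast)$ on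 all of $(0,+\infty)$, and the extension satisfies $$\lim_{r\to+\infty}r^{\nu_+}v(r)\in(0,+\infty),\qquad \lim_{r\to0^+}r^{\nu_-}v(r)\in(0,+\infty).$$ All three alternatives occur, and the orbits arising in (II) form a one-parameter family, indexed by the value $\kappa\in\big(\mathcal H(P_* ),0\big)$.
   Context: $N,p,s,\mu,q$ are real parameters. A solution of the ODE on an interval means a positive function $v$ of class $C^1$ there such that $r\mapsto r^{N-1}|v'|^{p-2}v'$ is of class $C^1$ and the equation holds pointwise. Notation: $h(\gamma):=\gamma^{p-1}\big(N-p-(p-1)\gamma\big)$ for $\gamma>0$; $\nu_-<\nu_+$ are the two roots of $h(\nu)=\mu$, which satisfy $0<\nu_-<\frac{N-p}{p}<\nu_+<\frac{N-p}{p-1}$; $\gamma_*:=\frac{p+s}{q-p+1}$; $p^*_s:=\frac{p(N+s)}{N-p}$. The orbit associated with $v$ is $x(t):=-\frac{r v'(r)}{v(r)}$, $Y(t):=r^{p+s}v(r)^{q-p+1}$, $t=\ln r$, where $v'<0$ (every positive solution on an exterior interval has $v'<0$ for large $r$). It solves the planar system $$\dot x=\frac{x^{2-p}}{p-1}\big[\mu+Y-h(x)\big],\qquad \dot Y=(q-p+1)\,Y\,(\gamma_*-x)$$ in $\{x>0,\ Y>0\}$, whose equilibria in $\{x>0,\ Y\ge 0\}$ are $P_*=(\gamma_*,Y_* )$ (with $Y_*=h(\gamma_* )-\mu=\bar\mu-\mu$), $P_-=(\nu_-,0)$ and $P_+=(\nu_+,0)$. With $b:=\frac{N-p}{p+s}-1$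 (so $b+1=\frac{p}{q-p+1}$ here), $$\mathcal H(x,Y):=\frac{Y^{b+1}}{p-1}\left[\frac{\mu-h(x)}{b+1}+\frac{Y}{b+2}\right].$$ *)

theory Defs
  imports "HOL-Analysis.Analysis"
begin

section \<open>The equation\<close>

text \<open>At \<open>v' = 0\<close> the convention \<open>0 powr a = 0\<close> gives the intended value \<open>0\<close> of
  \<open>|v'|^(p-2) v'\<close> also for \<open>p < 2\<close>.\<close>

definition flux :: "real \<Rightarrow> real \<Rightarrow> (real \<Rightarrow> real) \<Rightarrow> real \<Rightarrow> real" where
  "flux N p v r = r powr (N - 1) * (\<bar>deriv v r\<bar> powr (p - 2) * deriv v r)"

text \<open>Only used for open \<open>I \<subseteq> {0<..}\<close>.\<close>

definition solution ::
    "real \<Rightarrow> real \<Rightarrow> real \<Rightarrow> real \<Rightarrow> real \<Rightarrow> real set \<Rightarrow> (real \<Rightarrow> real) \<Rightarrow> bool" where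
  "solution N p s \<mu> q I v \<longleftrightarrow>
     (\<forall>r\<in>I. 0 < v r) \<and>
     v C1_differentiable_on I \<and>
     flux N p v C1_differentiable_on I \<and>
     (\<forall>r\<in>I. - deriv (flux N p v) r =
        \<mu> * r powr (N - 1 - p) * v r powr (p - 1) + r powr (N - 1 + s) * v r powr q)"

section \<open>Constants\<close>

definition hfun :: "real \<Rightarrow> real \<Rightarrow> real \<Rightarrow> real" where
  "hfun N p \<gamma> = \<gamma> powr (p - 1) * (N - p - (p - 1) * \<gamma>)"

definition mu_bar :: "real \<Rightarrow> real \<Rightarrow> real" where
  "mu_bar N p = ((N - p) / p) powr p"

text \<open>For \<open>0 < \<mu> < mu_bar N p\<close> the set of positive roots has exactly two elements.\<close>

definition nu_minus :: "real \<Rightarrow> real \<Rightarrow> real \<Rightarrow> real" where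
  "nu_minus N p \<mu> = Min {\<nu>. 0 < \<nu> \<and> hfun N p \<nu> = \<mu>}"

definition nu_plus :: "real \<Rightarrow> real \<Rightarrow> real \<Rightarrow> real" where
  "nu_plus N p \<mu> = Max {\<nu>. 0 < \<nu> \<and> hfun N p \<nu> = \<mu>}"

definition gamma_star :: "real \<Rightarrow> real \<Rightarrow> real \<Rightarrow> real" where
  "gamma_star p s q = (p + s) / (q - p + 1)"

definition crit_exponent :: "real \<Rightarrow> real \<Rightarrow> real \<Rightarrow> real" where
  "crit_exponent N p s = p * (N + s) / (N - p)"

definition Y_star :: "real \<Rightarrow> real \<Rightarrow> real \<Rightarrow> real \<Rightarrow> real \<Rightarrow> real" where
  "Y_star N p s \<mu> q = hfun N p (gamma_star p s q) - \<mu>"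

definition P_star :: "real \<Rightarrow> real \<Rightarrow> real \<Rightarrow> real \<Rightarrow> real \<Rightarrow> real \<times> real" where
  "P_star N p s \<mu> q = (gamma_star p s q, Y_star N p s \<mu> q)"

definition P_minus :: "real \<Rightarrow> real \<Rightarrow> real \<Rightarrow> real \<times> real" where
  "P_minus N p \<mu> = (nu_minus N p \<mu>, 0)"

definition P_plus :: "real \<Rightarrow> real \<Rightarrow> real \<Rightarrow> real \<times> real" where
  "P_plus N p \<mu> = (nu_plus N p \<mu>, 0)"

definition bexp :: "real \<Rightarrow> real \<Rightarrow> real \<Rightarrow> real" where
  "bexp N p s = (N - p) / (p + s) - 1"

section \<open>The planar system\<close>

definition planar_field ::
    "real \<Rightarrow> real \<Rightarrow> real \<Rightarrow> real \<Rightarrow> real \<Rightarrow> real \<times> real \<Rightarrow> real \<times> real" where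
  "planar_field N p s \<mu> q = (\<lambda>(x, Y).
     (x powr (2 - p) / (p - 1) * (\<mu> + Y - hfun N p x),
      (q - p + 1) * Y * (gamma_star p s q - x)))"

definition complete_trajectory ::
    "real \<Rightarrow> real \<Rightarrow> real \<Rightarrow> real \<Rightarrow> real \<Rightarrow> (real \<Rightarrow> real \<times> real) \<Rightarrow> bool" where
  "complete_trajectory N p s \<mu> q \<gamma> \<longleftrightarrow>
     (\<forall>t. 0 < fst (\<gamma> t) \<and> 0 < snd (\<gamma> t) \<and>
          (\<gamma> has_vector_derivative planar_field N p s \<mu> q (\<gamma> t)) (at t))"

definition Hfun :: "real \<Rightarrow> real \<Rightarrow> real \<Rightarrow> real \<Rightarrow> real \<times> real \<Rightarrow> real" where
  "Hfun N p s \<mu> = (\<lambda>(x, Y).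
     Y powr (bexp N p s + 1) / (p - 1) *
       ((\<mu> - hfun N p x) / (bexp N p s + 1) + Y / (bexp N p s + 2)))"

section \<open>The orbit of a solution\<close>

definition orbit_point ::
    "real \<Rightarrow> real \<Rightarrow> real \<Rightarrow> (real \<Rightarrow> real) \<Rightarrow> real \<Rightarrow> real \<times> real" where
  "orbit_point p s q v t = (let r = exp t in
     (- (r * deriv v r / v r), r powr (p + s) * v r powr (q - p + 1)))"

text \<open>The orbit of a solution on \<open>(R, \<infinity>)\<close> is considered where \<open>v' < 0\<close>.\<close>

definition orbit_times :: "real \<Rightarrow> (real \<Rightarrow> real) \<Rightarrow> real set" where
  "orbit_times R v = {t. R < exp t \<and> deriv v (exp t) < 0}"

definition orbit ::
    "real \<Rightarrow> real \<Rightarrow> real \<Rightarrow> real \<Rightarrow> (real \<Rightarrow> real) \<Rightarrow> (real \<times> real) set" where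
  "orbit p s q R v = orbit_point p s q v ` orbit_times R v"

text \<open>The orbit of \<open>v\<close> is nonempty and \<open>Hfun\<close> is constant on it, with value \<open>\<kappa>\<close>.\<close>

definition orbit_level ::
    "real \<Rightarrow> real \<Rightarrow> real \<Rightarrow> real \<Rightarrow> real \<Rightarrow> real \<Rightarrow> (real \<Rightarrow> real) \<Rightarrow> real \<Rightarrow> bool" where
  "orbit_level N p s \<mu> q R v \<kappa> \<longleftrightarrow> Hfun N p s \<mu> ` orbit p s q R v = {\<kappa>}"

definition global_extension ::
    "real \<Rightarrow> real \<Rightarrow> real \<Rightarrow> real \<Rightarrow> real \<Rightarrow> real \<Rightarrow> (real \<Rightarrow> real) \<Rightarrow> (real \<Rightarrow> real) \<Rightarrow> bool" where
  "global_extension N p s \<mu> q R v V \<longleftrightarrow>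
     solution N p s \<mu> q {0<..} V \<and> (\<forall>r>R. V r = v r)"

definition no_exact_decay_rate :: "(real \<Rightarrow> real) \<Rightarrow> bool" where
  "no_exact_decay_rate v \<longleftrightarrow>
     \<not> (\<exists>a c. 0 < c \<and> ((\<lambda>r. r powr a * v r) \<longlongrightarrow> c) at_top)"

section \<open>The three alternatives\<close>

definition alternative_I ::
    "real \<Rightarrow> real \<Rightarrow> real \<Rightarrow> real \<Rightarrow> real \<Rightarrow> real \<Rightarrow> (real \<Rightarrow> real) \<Rightarrow> real \<Rightarrow> bool" where
  "alternative_I N p s \<mu> q R v \<kappa> \<longleftrightarrow>
     \<kappa> = Hfun N p s \<mu> (P_star N p s \<mu> q) \<and>
     (\<forall>r>R. v r = (mu_bar N p - \<mu>) powr (1 / (q - p + 1)) * r powr (- gamma_star p s q))"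

text \<open>\<open>T\<close> is the period; \<open>inside C\<close> is the union of the bounded components of the complement
  of \<open>C\<close>.\<close>

definition alternative_II ::
    "real \<Rightarrow> real \<Rightarrow> real \<Rightarrow> real \<Rightarrow> real \<Rightarrow> real \<Rightarrow> (real \<Rightarrow> real) \<Rightarrow> real \<Rightarrow> real \<Rightarrow> bool" where
  "alternative_II N p s \<mu> q R v \<kappa> T \<longleftrightarrow>
     Hfun N p s \<mu> (P_star N p s \<mu> q) < \<kappa> \<and> \<kappa> < 0 \<and>
     (\<exists>\<gamma>. complete_trajectory N p s \<mu> q \<gamma> \<and>
          (\<exists>\<tau>>0. \<forall>t. \<gamma> (t + \<tau>) = \<gamma> t) \<and> \<not> \<gamma> constant_on UNIV \<and>
          P_star N p s \<mu> q \<in> inside (range \<gamma>) \<and>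
          (\<forall>t\<in>orbit_times R v. orbit_point p s q v t = \<gamma> t) \<and>
          orbit p s q R v = range \<gamma>) \<and>
     (\<exists>V \<Psi>. global_extension N p s \<mu> q R v V \<and>
          (\<forall>t. 0 < \<Psi> t) \<and> \<not> \<Psi> constant_on UNIV \<and>
          0 < T \<and> (\<forall>t. \<Psi> (t + T) = \<Psi> t) \<and>
          (\<forall>r>0. r powr gamma_star p s q * V r = \<Psi> (ln r))) \<and>
     (\<exists>l L. 0 < l \<and> 0 < L \<and> l \<noteq> L \<and>
          Liminf at_top (\<lambda>r. ereal (r powr gamma_star p s q * v r)) = ereal l \<and>
          Limsup at_top (\<lambda>r. ereal (r powr gamma_star p s q * v r)) = ereal L) \<and>
     no_exact_decay_rate v"

text \<open>For \<open>R > 0\<close> the orbit of \<open>v\<close> itself is only the part \<open>t > ln R\<close> of the heteroclinic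
  connection \<open>\<gamma>\<close>; the orbit of the extension is all of it.\<close>

definition alternative_III ::
    "real \<Rightarrow> real \<Rightarrow> real \<Rightarrow> real \<Rightarrow> real \<Rightarrow> real \<Rightarrow> (real \<Rightarrow> real) \<Rightarrow> real \<Rightarrow> bool" where
  "alternative_III N p s \<mu> q R v \<kappa> \<longleftrightarrow>
     \<kappa> = 0 \<and>
     (\<exists>\<gamma>. complete_trajectory N p s \<mu> q \<gamma> \<and>
          (\<gamma> \<longlongrightarrow> P_minus N p \<mu>) at_bot \<and> (\<gamma> \<longlongrightarrow> P_plus N p \<mu>) at_top \<and>
          range \<gamma> = {(x, (N + s) / (N - p) * (hfun N p x - \<mu>)) | x.
                         nu_minus N p \<mu> < x \<and> x < nu_plus N p \<mu>} \<and>
          (\<forall>t\<in>orbit_times R v. orbit_point p s q v t = \<gamma> t) \<and>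
          (\<exists>V. global_extension N p s \<mu> q R v V \<and>
               orbit p s q 0 V = range \<gamma> \<and>
               (\<exists>c>0. ((\<lambda>r. r powr nu_plus N p \<mu> * V r) \<longlongrightarrow> c) at_top) \<and>
               (\<exists>c>0. ((\<lambda>r. r powr nu_minus N p \<mu> * V r) \<longlongrightarrow> c) (at_right 0))))"

definition exactly_one :: "bool \<Rightarrow> bool \<Rightarrow> bool \<Rightarrow> bool" where
  "exactly_one A B C \<longleftrightarrow>
     (A \<and> \<not> B \<and> \<not> C) \<or> (\<not> A \<and> B \<and> \<not> C) \<or> (\<not> A \<and> \<not> B \<and> C)"

text \<open>The orbits arising in the second alternative, for a given period function \<open>T\<close> of the
  level.\<close>

definition type_II_orbits ::
    "real \<Rightarrow> real \<Rightarrow> real \<Rightarrow> real \<Rightarrow> real \<Rightarrow> (real \<Rightarrow> real) \<Rightarrow> (real \<times> real) set set" where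
  "type_II_orbits N p s \<mu> q T =
     {orbit p s q R v | R v \<kappa>. 0 < R \<and> solution N p s \<mu> q {R<..} v \<and>
        orbit_level N p s \<mu> q R v \<kappa> \<and> alternative_II N p s \<mu> q R v \<kappa> (T \<kappa>)}"

end

theory Submission
  imports Defs
begin

section \<open>Ordinary differential equations with a Lipschitz right-hand side\<close>

text \<open>In the time t = ln r the equation becomes an autonomous planar system for (x, Y). At the
  critical exponent the maximum of \<open>h\<close> sits at the abscissa \<open>a\<close> where Y'
  changes sign, and the exponent \<open>\<beta>\<close> of \<open>H\<close> satisfies
  \<open>\<beta> * m = p\<close>; this makes \<open>H\<close> a conserved quantity
  (\<open>traj_H_deriv\<close>). A positive solution therefore runs along a level curve of
  \<open>H\<close>, and the theorem is a description of these curves. The passage between solutions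
  and trajectories goes both ways: \<open>solution_traj\<close> and \<open>traj_profile\<close>. The
  second one supplies both the extensions to all r > 0 and the existence claims.

  Positive levels are impossible on a forward half-line: there x^(p-1) grows at least linearly until
  x' \<ge> x^2 / 2, and x blows up (\<open>half_line_H_nonpos\<close>). Since the flux is
  nonincreasing, this also yields v' < 0 on the whole interval (\<open>solution_orbit\<close>). From
  below, \<open>H\<close> has a strict minimum over the open quadrant at \<open>Pstar\<close>, so on
  the lowest level the trajectory is the equilibrium (\<open>H_eq_min\<close>).

  Negative levels are bounded and stay away from both axes, so trajectories on them are global
  (\<open>traj_exists\<close>). Such a trajectory, unless it is the equilibrium, crosses x =
  \<open>a\<close> after any given time (\<open>traj_returns\<close>). This line meets a level in at
  most two points, so uniqueness forces periodicity (\<open>traj_periodic\<close>). All trajectories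
  of one level share the crossing below \<open>Ystar\<close>, hence are time shifts of each other:
  the level is one closed orbit, it encloses \<open>Pstar\<close>, and its value labels it.

  The level zero is a graph over the interval between the two roots of \<open>h\<close> = \<mu>. On
  it the system reduces to a scalar equation with right-hand side \<open>drive\<close>, positive
  between two simple zeros, so x moves from one root to the other. Simplicity of the zeros makes the
  distance to the limit integrable in time (\<open>tendsto_integral_of_gap\<close>), which gives the
  exact powers at 0 and at infinity.\<close>

lemma has_vector_derivative_imp_continuous_on:
  assumes "\<And>t. t \<in> S \<Longrightarrow> (f has_vector_derivative f' t) (at t)"
  shows "continuous_on S f"
  using assms has_vector_derivative_continuous
  by (intro continuous_at_imp_continuous_on) blast

lemma antiderivative_UNIV:
  fixes g :: "real \<Rightarrow> 'a::euclidean_space"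
  assumes "continuous_on UNIV g"
  obtains G where "G 0 = 0" "\<And>t. (G has_vector_derivative g t) (at t)"
proof -
  have "isCont g x" for x
    using assms by (simp add: continuous_on_eq_continuous_at)
  then obtain F where F: "\<forall>x::real. (F has_vector_derivative g x) (at x)"
    using einterval_antiderivative[of "-\<infinity>" "\<infinity>" g] by auto
  have "((\<lambda>t. F t - F 0) has_vector_derivative g t) (at t)" for t
    using has_vector_derivative_diff[OF F[rule_format] has_vector_derivative_const[of "F 0"], of t] by simp
  then show thesis
    by (intro that[of "\<lambda>t. F t - F 0"]) auto
qed

text \<open>For t \<ge> 0 the majorant K / c * exp (c * t) has derivative K * exp (c * t), and
  negative times follow by reflection. Integration thus gains a factor 1 / c in the weighted norm,
  which is what makes the Picard operator a contraction.\<close>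

lemma norm_le_exp_of_derivative_le_exp:
  fixes G :: "real \<Rightarrow> 'a::real_normed_vector"
  assumes "G 0 = 0" and deriv: "\<And>t. (G has_vector_derivative g t) (at t)"
    and bound: "\<And>t. norm (g t) \<le> K * exp (c * \<bar>t\<bar>)" and "c > 0"
  shows "norm (G t) \<le> K / c * exp (c * \<bar>t\<bar>)"
proof -
  have "K \<ge> 0"
    using bound[of 0] norm_ge_zero[of "g 0"] by (simp del: norm_ge_zero)
  have pos: "norm (F t) \<le> K / c * exp (c * t)"
    if F: "F 0 = 0" "\<And>t. (F has_vector_derivative f t) (at t)" "\<And>t. norm (f t) \<le> K * exp (c * \<bar>t\<bar>)"
      and "t \<ge> 0" for F f :: "real \<Rightarrow> 'a" and t
  proof (cases "t = 0")
    case True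
    with F(1) \<open>K \<ge> 0\<close> \<open>c > 0\<close> show ?thesis by simp
  next
    case False
    have "norm (F t - F 0) \<le> K / c * exp (c * t) - K / c * exp (c * 0)"
    proof (rule differentiable_bound_general[where f' = f and \<phi>' = "\<lambda>t. K * exp (c * t)"])
      show "0 < t" using False \<open>t \<ge> 0\<close> by simp
      show "continuous_on {0..t} F"
        by (rule has_vector_derivative_imp_continuous_on[OF F(2)])
      show "((\<lambda>a. K / c * exp (c * a)) has_vector_derivative K * exp (c * x)) (at x)" for x
        unfolding has_real_derivative_iff_has_vector_derivative[symmetric]
        using \<open>c > 0\<close> by (auto intro!: derivative_eq_intros)
      show "norm (f x) \<le> K * exp (c * x)" if "0 < x" for x
        using F(3)[of x] that by simp
    qed (intro continuous_intros F(2))+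
    also have "\<dots> \<le> K / c * exp (c * t)"
      using \<open>K \<ge> 0\<close> \<open>c > 0\<close> by simp
    finally show ?thesis using F(1) by simp
  qed
  show ?thesis
  proof (cases "t \<ge> 0")
    case True
    then show ?thesis using pos[of G g t] assms by simp
  next
    case False
    have "((\<lambda>t. G (- t)) has_vector_derivative - g (- t)) (at t)" for t
      using vector_diff_chain_at[of "\<lambda>t. - t" "-1" t G "g (- t)"] deriv
        has_vector_derivative_minus[OF has_vector_derivative_id, of "at t"]
      by (simp add: o_def)
    moreover have "norm (- g (- t)) \<le> K * exp (c * \<bar>t\<bar>)" for t
      using bound[of "- t"] by simp
    ultimately show ?thesis
      using pos[of "\<lambda>t. G (- t)" "\<lambda>t. - g (- t)" "- t"] False assms(1) by simp
  qed
qed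

text \<open>The Picard operator is a contraction of the space of bounded continuous functions
  \<open>u\<close> after the substitution \<open>z t = z0 + exp (c * \<bar>t\<bar>) *\<^sub>R u t\<close> with \<open>c = 2 * L\<close>, so no
  continuation argument is needed.\<close>

lemma lipschitz_ode_exists:
  fixes F :: "'a::euclidean_space \<Rightarrow> 'a"
  assumes "L-lipschitz_on UNIV F"
  obtains z where "z t0 = z0" "\<And>t. (z has_vector_derivative F (z t)) (at t)"
proof -
  \<comment> \<open>\<open>L\<close> may be zero; a strictly positive constant is needed to divide
    by the weight \<open>c\<close>.\<close>
  define M where "M = L + 1"
  have M: "M > 0" and lip: "norm (F x - F y) \<le> M * norm (x - y)" for x y
    using lipschitz_on_nonneg[OF assms] lipschitz_on_normD[OF lipschitz_on_leI] assms
      lipschitz_on_normD[OF lipschitz_on_mono[OF assms], of UNIV M x y]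
    by (auto simp: M_def)
  have contF: "continuous_on UNIV F"
    using assms lipschitz_on_continuous_on by blast
  define c where "c = 2 * M"
  have c: "c > 0" using M by (simp add: c_def)
  define g where "g u t = F (z0 + exp (c * \<bar>t\<bar>) *\<^sub>R apply_bcontfun u t)" for u :: "real \<Rightarrow>\<^sub>C 'a" and t
  have contg: "continuous_on UNIV (g u)" for u
    unfolding g_def by (intro continuous_on_compose2[OF contF] continuous_intros) auto
  have "\<forall>u. \<exists>G. G 0 = 0 \<and> (\<forall>t. (G has_vector_derivative g u t) (at t))"
    using antiderivative_UNIV[OF contg] by metis
  then obtain P where P0: "P u 0 = 0" and P: "(P u has_vector_derivative g u t) (at t)" for u t
    by metis
  have contP: "continuous_on UNIV (P u)" for u
    by (rule has_vector_derivative_imp_continuous_on[OF P])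
  have g_bound: "norm (g u t) \<le> (norm (F z0) + M * norm u) * exp (c * \<bar>t\<bar>)" for u t
  proof -
    have "norm (g u t - F z0) \<le> M * norm (exp (c * \<bar>t\<bar>) *\<^sub>R apply_bcontfun u t)"
      unfolding g_def by (rule order_trans[OF lip]) simp
    also have "\<dots> \<le> M * (exp (c * \<bar>t\<bar>) * norm u)"
      using M norm_bounded[of u t] by simp
    finally have "norm (g u t) \<le> norm (F z0) + M * norm u * exp (c * \<bar>t\<bar>)"
      using norm_triangle_sub[of "g u t" "F z0"] by (simp add: mult_ac)
    also have "\<dots> \<le> norm (F z0) * exp (c * \<bar>t\<bar>) + M * norm u * exp (c * \<bar>t\<bar>)"
      using c by (simp add: mult_le_cancel_left1)
    finally show ?thesis by (simp add: algebra_simps)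
  qed
  have g_diff: "norm (g u t - g v t) \<le> M * dist u v * exp (c * \<bar>t\<bar>)" for u v t
  proof -
    have "norm (g u t - g v t) \<le> M * norm (exp (c * \<bar>t\<bar>) *\<^sub>R (apply_bcontfun u t - apply_bcontfun v t))"
      unfolding g_def scaleR_diff_right by (rule order_trans[OF lip]) simp
    also have "\<dots> \<le> M * (exp (c * \<bar>t\<bar>) * dist u v)"
      using M dist_bounded[of u t v] by (simp add: dist_norm)
    finally show ?thesis by (simp add: mult_ac)
  qed
  define T where "T u = Bcontfun (\<lambda>t. exp (- c * \<bar>t\<bar>) *\<^sub>R P u t)" for u
  have T: "apply_bcontfun (T u) t = exp (- c * \<bar>t\<bar>) *\<^sub>R P u t" for u t
  proof -
    have "norm (exp (- c * \<bar>t\<bar>) *\<^sub>R P u t) \<le> (norm (F z0) + M * norm u) / c" for t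
    proof -
      have "norm (P u t) \<le> (norm (F z0) + M * norm u) / c * exp (c * \<bar>t\<bar>)"
        using norm_le_exp_of_derivative_le_exp[OF P0 P g_bound c] .
      then show ?thesis by (simp add: exp_minus field_simps)
    qed
    then have "(\<lambda>t. exp (- c * \<bar>t\<bar>) *\<^sub>R P u t) \<in> bcontfun"
      by (intro bcontfun_normI continuous_intros contP) auto
    then show ?thesis
      by (simp add: T_def Bcontfun_inverse)
  qed
  \<comment> \<open>Integration in the weighted norm contributes 1 / c and the Lipschitz bound
    contributes M, so the factor is M / c = 1/2.\<close>
  have contraction: "dist (T u) (T v) \<le> 1/2 * dist u v" for u v
  proof (rule dist_bound)
    fix t
    have "norm (P u t - P v t) \<le> M * dist u v / c * exp (c * \<bar>t\<bar>)"
      by (rule norm_le_exp_of_derivative_le_exp[of "\<lambda>t. P u t - P v t" "\<lambda>t. g u t - g v t"])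
        (auto intro!: has_vector_derivative_diff P g_diff c simp: P0)
    then show "dist (apply_bcontfun (T u) t) (apply_bcontfun (T v) t) \<le> 1/2 * dist u v"
      using M by (simp add: T dist_norm flip: scaleR_diff_right)
        (simp add: exp_minus c_def field_simps)
  qed
  obtain u where u: "T u = u"
    using banach_fix_type[of "1/2" T] contraction by auto
  define z where "z t = z0 + P u t" for t
  have "z t = z0 + exp (c * \<bar>t\<bar>) *\<^sub>R apply_bcontfun u t" for t
    using T[of u t] by (simp add: u z_def exp_minus)
  then have "g u t = F (z t)" for t
    by (simp add: g_def)
  then have z: "z 0 = z0" "(z has_vector_derivative F (z t)) (at t)" for t
    using has_vector_derivative_add[OF has_vector_derivative_const P, of z0 u t]
    by (auto simp: z_def[abs_def] P0)
  show thesis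
  proof (rule that[of "\<lambda>t. z (t - t0)"])
    show "((\<lambda>t. z (t - t0)) has_vector_derivative F (z (t - t0))) (at t)" for t
      using vector_diff_chain_at[OF has_vector_derivative_diff[OF has_vector_derivative_id has_vector_derivative_const] z(2)]
      by (simp add: o_def)
  qed (simp add: z)
qed

text \<open>Gronwall for the squared distance \<open>d\<close>: the Lipschitz bound gives
  \<bar>d'\<bar> \<le> 2 L d, so exp (- 2 L t) d is nonincreasing to the right of t0 and exp (2 L t)
  d is nondecreasing to its left. Both vanish at t0.\<close>

lemma lipschitz_ode_unique:
  fixes F :: "'a::real_inner \<Rightarrow> 'a"
  assumes lip: "L-lipschitz_on S F" and "is_interval I"
    and z: "\<And>t. t \<in> I \<Longrightarrow> (z has_vector_derivative F (z t)) (at t)" "\<And>t. t \<in> I \<Longrightarrow> z t \<in> S"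
    and w: "\<And>t. t \<in> I \<Longrightarrow> (w has_vector_derivative F (w t)) (at t)" "\<And>t. t \<in> I \<Longrightarrow> w t \<in> S"
    and "t0 \<in> I" "z t0 = w t0" "t \<in> I"
  shows "z t = w t"
proof -
  define d where "d t = (z t - w t) \<bullet> (z t - w t)" for t
  have d: "(d has_real_derivative 2 * ((F (z t) - F (w t)) \<bullet> (z t - w t))) (at t)" if "t \<in> I" for t
  proof -
    have "((\<lambda>t. z t - w t) has_derivative (\<lambda>h. h *\<^sub>R (F (z t) - F (w t)))) (at t)"
      using has_vector_derivative_diff[OF z(1) w(1), OF that that] by (simp add: has_vector_derivative_def)
    from has_derivative_inner[OF this this] show ?thesis
      unfolding d_def has_field_derivative_def
      by (rule has_derivative_eq_rhs) (auto simp: fun_eq_iff inner_commute algebra_simps)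
  qed
  have bound: "\<bar>(F (z t) - F (w t)) \<bullet> (z t - w t)\<bar> \<le> L * d t" if "t \<in> I" for t
  proof -
    have "\<bar>(F (z t) - F (w t)) \<bullet> (z t - w t)\<bar> \<le> norm (F (z t) - F (w t)) * norm (z t - w t)"
      by (rule Cauchy_Schwarz_ineq2)
    also have "\<dots> \<le> (L * norm (z t - w t)) * norm (z t - w t)"
      using lipschitz_on_normD[OF lip z(2) w(2)] that by (intro mult_right_mono) auto
    also have "\<dots> = L * d t"
      by (simp add: d_def power2_norm_eq_inner[symmetric] power2_eq_square)
    finally show ?thesis .
  qed
  have d0: "d t \<ge> 0" for t by (simp add: d_def)
  have "d t0 = 0" using assms by (simp add: d_def)
  have between: "x \<in> I" if "a \<le> x" "x \<le> b" "a \<in> I" "b \<in> I" for a x b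
    using \<open>is_interval I\<close> that unfolding is_interval_1 by blast
  have "d t = 0"
  proof (cases "t0 \<le> t")
    case True
    have "exp (- 2 * L * t) * d t \<le> exp (- 2 * L * t0) * d t0"
    proof (rule DERIV_nonpos_imp_nonincreasing[OF True, where f = "\<lambda>x. exp (- 2 * L * x) * d x"])
      fix x assume "t0 \<le> x" "x \<le> t"
      then have "x \<in> I" using between assms by blast
      have "exp (- 2 * L * x) * (2 * ((F (z x) - F (w x)) \<bullet> (z x - w x)) - 2 * L * d x) \<le> 0"
        using bound[OF \<open>x \<in> I\<close>] by (intro mult_nonneg_nonpos) (auto simp: abs_le_iff)
      moreover have "((\<lambda>x. exp (- 2 * L * x) * d x) has_real_derivative
          exp (- 2 * L * x) * (2 * ((F (z x) - F (w x)) \<bullet> (z x - w x)) - 2 * L * d x)) (at x)"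
        by (rule derivative_eq_intros d[OF \<open>x \<in> I\<close>] refl | simp add: algebra_simps)+
      ultimately show "\<exists>y. ((\<lambda>x. exp (- 2 * L * x) * d x) has_real_derivative y) (at x) \<and> y \<le> 0"
        by blast
    qed
    then show ?thesis using d0[of t] \<open>d t0 = 0\<close> by (simp add: mult_le_0_iff)
  next
    case False
    have "exp (2 * L * t) * d t \<le> exp (2 * L * t0) * d t0"
    proof (rule DERIV_nonneg_imp_nondecreasing[where f = "\<lambda>x. exp (2 * L * x) * d x"])
      show "t \<le> t0" using False by simp
      fix x assume "t \<le> x" "x \<le> t0"
      then have "x \<in> I" using between assms by blast
      have "0 \<le> exp (2 * L * x) * (2 * L * d x + 2 * ((F (z x) - F (w x)) \<bullet> (z x - w x)))"
        using bound[OF \<open>x \<in> I\<close>] by (intro mult_nonneg_nonneg) (auto simp: abs_le_iff)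
      moreover have "((\<lambda>x. exp (2 * L * x) * d x) has_real_derivative
          exp (2 * L * x) * (2 * L * d x + 2 * ((F (z x) - F (w x)) \<bullet> (z x - w x)))) (at x)"
        by (rule derivative_eq_intros d[OF \<open>x \<in> I\<close>] refl | simp add: algebra_simps)+
      ultimately show "\<exists>y. ((\<lambda>x. exp (2 * L * x) * d x) has_real_derivative y) (at x) \<and> 0 \<le> y"
        by blast
    qed
    then show ?thesis using d0[of t] \<open>d t0 = 0\<close> by (simp add: mult_le_0_iff)
  qed
  then show ?thesis by (simp add: d_def)
qed

text \<open>By the mean value theorem f (t + 1) - f t is a value of f' beyond t; the difference
  tends to 0 and f' tends to d. This shows that a limit of a trajectory is an equilibrium.\<close>

lemma tendsto_derivative_limit_eq_0:
  fixes f :: "real \<Rightarrow> real"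
  assumes deriv: "\<And>t. t > c \<Longrightarrow> (f has_real_derivative f' t) (at t)"
    and "(f \<longlongrightarrow> l) at_top" and lim: "(f' \<longlongrightarrow> d) at_top"
  shows "d = 0"
proof -
  have "((\<lambda>t. f (t + 1) - f t) \<longlongrightarrow> l - l) at_top"
    using filterlim_tendsto_add_at_top[OF tendsto_const[of 1] filterlim_ident]
    by (intro tendsto_diff assms filterlim_compose[OF assms(2)]) (simp add: add.commute)
  then have diff: "((\<lambda>t. f (t + 1) - f t) \<longlongrightarrow> 0) at_top" by simp
  show ?thesis
  proof (rule ccontr)
    assume "d \<noteq> 0"
    have "eventually (\<lambda>t. dist (f' t) d < \<bar>d\<bar> / 2) at_top"
      using \<open>d \<noteq> 0\<close> by (intro tendstoD[OF lim]) simp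
    then obtain T where T: "\<And>t. t \<ge> T \<Longrightarrow> dist (f' t) d < \<bar>d\<bar> / 2"
      by (auto simp: eventually_at_top_linorder)
    have "eventually (\<lambda>t. dist (f (t + 1) - f t) 0 < \<bar>d\<bar> / 2) at_top"
      using \<open>d \<noteq> 0\<close> by (intro tendstoD[OF diff]) simp
    then obtain T' where T': "\<And>t. t \<ge> T' \<Longrightarrow> dist (f (t + 1) - f t) 0 < \<bar>d\<bar> / 2"
      by (auto simp: eventually_at_top_linorder)
    define t where "t = max T (max T' (c + 1))"
    have "\<exists>\<xi>. t < \<xi> \<and> \<xi> < t + 1 \<and> f (t + 1) - f t = (t + 1 - t) * f' \<xi>"
      by (rule MVT2) (auto simp: t_def intro!: deriv)
    then obtain \<xi> where "t < \<xi>" "f (t + 1) - f t = f' \<xi>" by auto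
    then have "dist (f' \<xi>) d < \<bar>d\<bar> / 2" "dist (f' \<xi>) 0 < \<bar>d\<bar> / 2"
      using T[of \<xi>] T'[of t] by (auto simp: t_def)
    then show False by (auto simp: dist_real_def abs_if split: if_splits)
  qed
qed

section \<open>The functions \<open>h\<close> and \<open>\<H>\<close> at the critical exponent\<close>

locale critical =
  fixes N p s \<mu> q :: real
  assumes N_gt_p: "N > p" and p_gt_1: "p > 1" and s_gt: "s > - p"
    and mu_pos: "0 < \<mu>" and mu_less: "\<mu> < mu_bar N p"
    and q_eq: "q = crit_exponent N p s - 1"
begin

abbreviation "a \<equiv> gamma_star p s q"
abbreviation "h \<equiv> hfun N p"
abbreviation "H \<equiv> Hfun N p s \<mu>"
abbreviation "F \<equiv> planar_field N p s \<mu> q"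
abbreviation "Ystar \<equiv> Y_star N p s \<mu> q"

text \<open>\<open>m\<close> is the exponent of v in Y, and \<open>\<beta>\<close> turns out to be
  the exponent b + 1 of \<open>H\<close> (\<open>bexp_eq\<close>). Criticality of q enters through
  \<open>m_eq\<close>, which yields \<open>N = p + p * a\<close>; afterwards everything is expressed
  in p, \<open>a\<close>, \<open>m\<close> and \<open>\<beta>\<close>.\<close>

definition "m = q - p + 1"
definition "\<beta> = p / m"

lemma m_eq: "m = p * (p + s) / (N - p)"
  unfolding m_def unfolding q_eq using N_gt_p by (simp add: crit_exponent_def field_simps)

lemma m_pos [simp]: "m > 0"
  using N_gt_p p_gt_1 s_gt by (simp add: m_eq)

lemma beta_pos [simp]: "\<beta> > 0"
  using p_gt_1 by (simp add: \<beta>_def)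

lemma nonzero_simps [simp]: "m \<noteq> 0" "\<beta> \<noteq> 0" "\<beta> + 1 \<noteq> 0" "\<beta> + 1 > 0"
  using m_pos beta_pos by linarith+

lemma beta_m: "\<beta> * m = p"
  using m_pos by (simp add: \<beta>_def del: m_pos)

lemma a_eq: "a = (N - p) / p"
  using N_gt_p p_gt_1 s_gt by (simp add: gamma_star_def flip: m_def) (simp add: m_eq)

lemma a_pos [simp]: "a > 0"
  using N_gt_p p_gt_1 by (simp add: a_eq)

lemma m_a: "m * a = p + s"
  unfolding gamma_star_def m_def[symmetric] using m_pos by (simp del: m_pos)

lemma N_eq: "N = p + p * a"
  using p_gt_1 by (simp add: a_eq)

lemma s_eq: "s = m * a - p"
  by (simp add: m_a)

lemma bexp_eq: "bexp N p s + 1 = \<beta>" "bexp N p s + 2 = \<beta> + 1"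
  using N_gt_p p_gt_1 s_gt by (simp_all add: bexp_def \<beta>_def m_eq)

text \<open>Identifies the coefficient of the heteroclinic curve in the statement with the one that
  solving \<open>H\<close> = 0 for Y produces.\<close>

lemma N_s_ratio: "(N + s) / (N - p) = (\<beta> + 1) / \<beta>"
proof -
  have "N + s = a * (p + m)" "N - p = a * p"
    using N_eq s_eq by (simp_all add: algebra_simps)
  moreover have "(\<beta> + 1) / \<beta> = (p + m) / p"
    using p_gt_1 unfolding \<beta>_def by (simp add: field_simps)
  ultimately show ?thesis
    using less_imp_neq[OF a_pos] by simp
qed

lemma F_eq: "F (x, Y) = (x powr (2 - p) / (p - 1) * (\<mu> + Y - h x), m * Y * (a - x))"
  by (simp add: planar_field_def m_def)

lemma H_eq: "H (x, Y) = Y powr \<beta> / (p - 1) * ((\<mu> - h x) / \<beta> + Y / (\<beta> + 1))"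
  by (simp add: Hfun_def bexp_eq)

lemma h_eq: "h x = x powr (p - 1) * (p * a - (p - 1) * x)"
  by (simp add: hfun_def N_eq)

lemma powr_p_minus_1: "x \<ge> 0 \<Longrightarrow> x powr (p - 1) = x * x powr (p - 2)" for x :: real
  by (simp add: powr_mult_base)

text \<open>Because N - p = p \<open>a\<close>, the two terms of the product rule combine into a
  multiple of a - x. So \<open>h\<close> turns exactly on the line where Y' changes sign.\<close>

lemma h_deriv: "x > 0 \<Longrightarrow> (h has_real_derivative p * (p - 1) * x powr (p - 2) * (a - x)) (at x)"
  unfolding h_eq[abs_def]
  by (rule derivative_eq_intros refl | simp)+ (simp add: powr_p_minus_1 algebra_simps)

lemma continuous_on_h: "continuous_on {0..} h"
  unfolding h_eq[abs_def] using p_gt_1 by (intro continuous_intros continuous_on_powr') auto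

lemma tendsto_h [tendsto_intros]:
  "(f \<longlongrightarrow> x) net \<Longrightarrow> x > 0 \<Longrightarrow> ((\<lambda>t. h (f t)) \<longlongrightarrow> h x) net"
  unfolding h_eq[abs_def] by (intro tendsto_intros) auto

lemma h_a: "h a = mu_bar N p"
proof -
  have "h a = a powr (p - 1) * a"
    by (simp add: h_eq algebra_simps)
  also have "\<dots> = a powr p"
    by (simp add: mult.commute powr_mult_base less_imp_le)
  finally show ?thesis by (simp add: mu_bar_def a_eq)
qed

lemma Ystar_eq: "Ystar = mu_bar N p - \<mu>"
  by (simp add: Y_star_def h_a)

lemma Ystar_pos [simp]: "Ystar > 0"
  using mu_less by (simp add: Ystar_eq)

lemma h_strict_mono: "h x < h y" if "0 \<le> x" "x < y" "y \<le> a"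
proof (rule DERIV_pos_imp_increasing_open[where f = h])
  fix z assume "x < z" "z < y"
  then have "0 < p * (p - 1) * z powr (p - 2) * (a - z)"
    using that p_gt_1 by auto
  then show "\<exists>D. (h has_real_derivative D) (at z) \<and> 0 < D"
    using h_deriv[of z] \<open>x < z\<close> that by auto
qed (use that in \<open>auto intro: continuous_on_subset[OF continuous_on_h]\<close>)

lemma h_strict_antimono: "h y < h x" if "a \<le> x" "x < y"
proof (rule DERIV_neg_imp_decreasing_open[where f = h])
  have "0 < x" using that a_pos by linarith
  show "continuous_on {x..y} h"
    using \<open>0 < x\<close> by (auto intro: continuous_on_subset[OF continuous_on_h])
  fix z assume "x < z" "z < y"
  then have "p * (p - 1) * z powr (p - 2) * (a - z) < 0"
    using that p_gt_1 \<open>0 < x\<close> by (intro mult_pos_neg) auto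
  then show "\<exists>D. (h has_real_derivative D) (at z) \<and> D < 0"
    using h_deriv[of z] \<open>x < z\<close> \<open>0 < x\<close> by auto
qed (use that in auto)

lemma h_less: "x > 0 \<Longrightarrow> x \<noteq> a \<Longrightarrow> h x < mu_bar N p"
  using h_strict_mono[of x a] h_strict_antimono[of a x] by (cases "x < a") (auto simp: h_a)

lemma h_le: "x > 0 \<Longrightarrow> h x \<le> mu_bar N p"
  using h_less[of x] h_a by (cases "x = a") auto

definition "\<nu>m = nu_minus N p \<mu>"
definition "\<nu>p = nu_plus N p \<mu>"

text \<open>\<open>h\<close> increases from 0 at 0 to \<open>mu_bar N p\<close> at \<open>a\<close>
  and then decreases, vanishing at p a / (p - 1). The intermediate value theorem gives one root of
  \<open>h\<close> = \<mu> on each side of \<open>a\<close> and strict monotonicity excludes others,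
  so the \<open>Min\<close> and \<open>Max\<close> in the definitions are those two roots.\<close>

lemma nu_roots:
  shows "0 < \<nu>m" "\<nu>m < a" "a < \<nu>p" "h \<nu>m = \<mu>" "h \<nu>p = \<mu>"
    and h_gt_mu_iff: "\<And>x. x > 0 \<Longrightarrow> \<mu> < h x \<longleftrightarrow> \<nu>m < x \<and> x < \<nu>p"
proof -
  have cont: "continuous_on {x..y} h" if "x \<ge> 0" for x y
    using that by (auto intro: continuous_on_subset[OF continuous_on_h])
  have "h 0 = 0" using p_gt_1 by (simp add: h_eq)
  then obtain u where u: "0 \<le> u" "u \<le> a" "h u = \<mu>"
    using IVT'[of h 0 \<mu> a] mu_pos mu_less h_a a_pos cont[of 0 a] by (auto simp: less_imp_le)
  have "0 < u" "u < a"
    using u \<open>h 0 = 0\<close> mu_pos mu_less h_a by (auto simp: order_less_le)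
  define b where "b = p * a / (p - 1)"
  have "a < b" "h b = 0"
    using p_gt_1 a_pos by (auto simp: b_def h_eq field_simps)
  then obtain w where w: "a \<le> w" "w \<le> b" "h w = \<mu>"
    using IVT2'[of h b \<mu> a] mu_pos mu_less h_a a_pos cont[of a b] by (auto simp: less_imp_le)
  have "a < w"
    using w mu_less h_a by (auto simp: order_less_le)
  have less: "h x < \<mu>" if "x > 0" "x < u \<or> w < x" for x
    using h_strict_mono[of x u] h_strict_antimono[of w x] u w that by linarith
  have gr: "\<mu> < h x" if "u < x" "x < w" for x
  proof (cases "x \<le> a")
    case True
    then show ?thesis using h_strict_mono[of u x] u that by simp
  next
    case False
    then show ?thesis using h_strict_antimono[of x w] w that by simp
  qed
  have gt: "\<mu> < h x \<longleftrightarrow> u < x \<and> x < w" if "x > 0" for x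
    using less[OF that] gr[of x] u w by (metis linorder_neqE_linordered_idom order_less_asym)
  have "x = u \<or> x = w" if "x > 0" "h x = \<mu>" for x
    using less[OF that(1)] gr[of x] that by (metis linorder_neqE_linordered_idom order_less_irrefl)
  then have "{\<nu>. 0 < \<nu> \<and> h \<nu> = \<mu>} = {u, w}"
    using u w \<open>0 < u\<close> \<open>a < w\<close> \<open>u < a\<close> by auto
  then have eq: "\<nu>m = u" "\<nu>p = w"
    using \<open>u < a\<close> \<open>a < w\<close> by (auto simp: \<nu>m_def \<nu>p_def nu_minus_def nu_plus_def)
  show "0 < \<nu>m" "\<nu>m < a" "a < \<nu>p" "h \<nu>m = \<mu>" "h \<nu>p = \<mu>"
    using eq u w \<open>0 < u\<close> \<open>u < a\<close> \<open>a < w\<close> by auto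
  show "\<And>x. x > 0 \<Longrightarrow> \<mu> < h x \<longleftrightarrow> \<nu>m < x \<and> x < \<nu>p"
    using gt eq by simp
qed

lemma nu_pos [simp]: "0 < \<nu>m" "0 < \<nu>p"
  using nu_roots a_pos by linarith+

section \<open>The minimum of \<open>H\<close> and its nonpositive sublevel\<close>

lemma H_a_deriv:
  assumes "Y > 0"
  shows "((\<lambda>Y. H (a, Y)) has_real_derivative Y powr (\<beta> - 1) / (p - 1) * (Y - Ystar)) (at Y)"
proof -
  have [simp]: "\<mu> - h a = - Ystar" by (simp add: Ystar_eq h_a)
  have "((\<lambda>Y. Y powr \<beta> / (p - 1)) has_real_derivative \<beta> * Y powr (\<beta> - 1) / (p - 1)) (at Y)"
    using assms by (intro DERIV_cdivide has_real_derivative_powr)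
  moreover have "((\<lambda>Y. (\<mu> - h a) / \<beta> + Y / (\<beta> + 1)) has_real_derivative 1 / (\<beta> + 1)) (at Y)"
    by (auto intro!: derivative_eq_intros)
  ultimately have "((\<lambda>Y. H (a, Y)) has_real_derivative
      \<beta> * Y powr (\<beta> - 1) / (p - 1) * (- Ystar / \<beta> + Y / (\<beta> + 1)) + Y powr \<beta> / (p - 1) * (1 / (\<beta> + 1))) (at Y)"
    unfolding H_eq by (rule DERIV_cong[OF DERIV_mult]) simp
  also have "Y powr \<beta> = Y * Y powr (\<beta> - 1)"
    using assms by (simp add: powr_mult_base)
  also have "\<beta> * Y powr (\<beta> - 1) / (p - 1) * (- Ystar / \<beta> + Y / (\<beta> + 1)) + Y * Y powr (\<beta> - 1) / (p - 1) * (1 / (\<beta> + 1))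
     = Y powr (\<beta> - 1) / (p - 1) * (\<beta> * (- Ystar / \<beta> + Y / (\<beta> + 1)) + Y / (\<beta> + 1))"
    by (simp add: algebra_simps add_divide_distrib)
  also have "\<beta> * (- Ystar / \<beta> + Y / (\<beta> + 1)) + Y / (\<beta> + 1) = Y - Ystar"
  proof -
    have "\<beta> * (Y / (\<beta> + 1)) + Y / (\<beta> + 1) = (\<beta> + 1) * (Y / (\<beta> + 1))"
      by (simp only: distrib_right mult_1)
    then show ?thesis by (simp add: right_diff_distrib)
  qed
  finally show ?thesis .
qed

lemma continuous_on_H_a: "continuous_on {0..} (\<lambda>Y. H (a, Y))"
  unfolding H_eq using p_gt_1 by (intro continuous_intros continuous_on_powr') auto

lemma H_a_strict_antimono: "H (a, Y') < H (a, Y)" if "0 \<le> Y" "Y < Y'" "Y' \<le> Ystar"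
proof (rule DERIV_neg_imp_decreasing_open[where f = "\<lambda>Y. H (a, Y)"])
  fix z assume "Y < z" "z < Y'"
  then have "z powr (\<beta> - 1) / (p - 1) * (z - Ystar) < 0"
    using that p_gt_1 by (intro mult_pos_neg) auto
  then show "\<exists>D. ((\<lambda>Y. H (a, Y)) has_real_derivative D) (at z) \<and> D < 0"
    using H_a_deriv[of z] \<open>Y < z\<close> that by auto
qed (use that in \<open>auto intro: continuous_on_subset[OF continuous_on_H_a]\<close>)

lemma H_a_strict_mono: "H (a, Y) < H (a, Y')" if "Ystar \<le> Y" "Y < Y'"
proof (rule DERIV_pos_imp_increasing_open[where f = "\<lambda>Y. H (a, Y)"])
  have "0 < Y" using that Ystar_pos by linarith
  show "continuous_on {Y..Y'} (\<lambda>Y. H (a, Y))"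
    using \<open>0 < Y\<close> by (auto intro: continuous_on_subset[OF continuous_on_H_a])
  fix z assume "Y < z" "z < Y'"
  then have "0 < z powr (\<beta> - 1) / (p - 1) * (z - Ystar)"
    using that p_gt_1 \<open>0 < Y\<close> by auto
  then show "\<exists>D. ((\<lambda>Y. H (a, Y)) has_real_derivative D) (at z) \<and> 0 < D"
    using H_a_deriv[of z] \<open>Y < z\<close> \<open>0 < Y\<close> by auto
qed (use that in auto)

text \<open>By \<open>H_a_deriv\<close> the sign of the derivative of \<open>H\<close> along the
  line x = \<open>a\<close> is that of Y - \<open>Ystar\<close>: a strict fall up to
  \<open>Ystar\<close> and a strict rise afterwards. The same fact limits the line to two points of
  any level.\<close>

lemma H_a_ge: "Y > 0 \<Longrightarrow> H (a, Ystar) \<le> H (a, Y) \<and> (H (a, Y) = H (a, Ystar) \<longrightarrow> Y = Ystar)"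
  using H_a_strict_antimono[of Y Ystar] H_a_strict_mono[of Ystar Y]
  by (cases Y Ystar rule: linorder_cases) auto

text \<open>For fixed Y the value of \<open>H\<close> decreases with h x, and \<open>h\<close> has
  its only maximum at \<open>a\<close>. Together with the comparison along x = \<open>a\<close> this
  makes \<open>Pstar\<close> the only minimiser.\<close>

lemma H_ge_H_a: "x > 0 \<Longrightarrow> Y > 0 \<Longrightarrow> H (a, Y) \<le> H (x, Y) \<and> (H (x, Y) = H (a, Y) \<longrightarrow> x = a)"
  using h_less[of x] p_gt_1 beta_pos
  by (cases "x = a") (auto simp: H_eq h_a divide_simps simp del: beta_pos)

abbreviation "Pstar \<equiv> P_star N p s \<mu> q"
abbreviation "quadrant \<equiv> {z :: real \<times> real. fst z > 0 \<and> snd z > 0}"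

lemma Pstar_eq: "Pstar = (a, Ystar)"
  by (simp add: P_star_def)

lemma H_ge: "z \<in> quadrant \<Longrightarrow> H Pstar \<le> H z"
  and H_eq_min: "z \<in> quadrant \<Longrightarrow> H z = H Pstar \<Longrightarrow> z = Pstar"
  using H_a_ge[of "snd z"] H_ge_H_a[of "fst z" "snd z"] by (auto simp: Pstar_eq prod_eq_iff)

lemma H_Pstar_neg: "H Pstar < 0"
proof -
  have "H (a, Ystar) < H (a, 0)"
    using H_a_strict_antimono[of 0 Ystar] by simp
  then show ?thesis by (simp add: Pstar_eq H_eq)
qed

text \<open>\<open>H\<close> is a positive factor times the difference of the two sides. Hence the
  level zero is a graph over the x-axis, and the nonpositive levels lie on or below it.\<close>

lemma H_nonpos_iff:
  assumes "x > 0" "Y > 0"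
  shows "H (x, Y) \<le> 0 \<longleftrightarrow> Y \<le> (\<beta> + 1) / \<beta> * (h x - \<mu>)"
    and "H (x, Y) = 0 \<longleftrightarrow> Y = (\<beta> + 1) / \<beta> * (h x - \<mu>)"
proof -
  define K where "K = Y powr \<beta> / ((p - 1) * (\<beta> + 1))"
  have "K > 0" using assms p_gt_1 beta_pos by (auto simp: K_def simp del: beta_pos intro!: add_pos_pos)
  have "H (x, Y) = K * (Y - (\<beta> + 1) / \<beta> * (h x - \<mu>))"
    using beta_pos p_gt_1 by (simp add: H_eq K_def field_simps del: beta_pos)
  then show "H (x, Y) \<le> 0 \<longleftrightarrow> Y \<le> (\<beta> + 1) / \<beta> * (h x - \<mu>)"
    "H (x, Y) = 0 \<longleftrightarrow> Y = (\<beta> + 1) / \<beta> * (h x - \<mu>)"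
    using \<open>K > 0\<close> by (auto simp: mult_le_0_iff)
qed

text \<open>Y > 0 below the zero curve forces h x > \<mu>, so x lies between the roots; the bound on
  Y uses the maximum of \<open>h\<close>. By conservation of \<open>H\<close> these become a priori
  bounds along trajectories.\<close>

lemma H_nonpos_bounds:
  assumes "z \<in> quadrant" "H z \<le> 0"
  shows "\<nu>m < fst z" "fst z < \<nu>p" "snd z \<le> (\<beta> + 1) / \<beta> * Ystar"
proof -
  have le: "snd z \<le> (\<beta> + 1) / \<beta> * (h (fst z) - \<mu>)"
    using H_nonpos_iff(1)[of "fst z" "snd z"] assms by simp
  then have "0 < (\<beta> + 1) / \<beta> * (h (fst z) - \<mu>)"
    using assms by simp
  then have "\<mu> < h (fst z)"
    using beta_pos by (simp add: zero_less_mult_iff divide_less_0_iff zero_less_divide_iff del: beta_pos)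
  then show "\<nu>m < fst z" "fst z < \<nu>p"
    using h_gt_mu_iff[of "fst z"] assms by auto
  have "h (fst z) - \<mu> \<le> Ystar"
    using h_le[of "fst z"] assms by (simp add: Ystar_eq)
  then show "snd z \<le> (\<beta> + 1) / \<beta> * Ystar"
    using le beta_pos by (elim order_trans) (intro mult_left_mono, auto simp del: beta_pos)
qed

lemma continuous_on_H: "continuous_on quadrant H"
proof -
  have "continuous_on quadrant (\<lambda>z. H (fst z, snd z))"
    unfolding H_eq h_eq using p_gt_1 by (intro continuous_intros) auto
  then show ?thesis by simp
qed

end

section \<open>Lipschitz bounds on compact sets and their extension to the whole space\<close>

lemma lipschitz_on_plane:
  fixes f :: "real \<times> real \<Rightarrow> real"
  assumes "convex S" "compact S"
    and deriv: "\<And>z. z \<in> S \<Longrightarrow> (f has_derivative (\<lambda>d. A z * fst d + B z * snd d)) (at z within S)"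
    and cont: "continuous_on S A" "continuous_on S B"
  obtains L where "L-lipschitz_on S f"
proof -
  have "bounded (A ` S)" "bounded (B ` S)"
    using assms by (auto intro!: compact_imp_bounded compact_continuous_image)
  then obtain K1 K2 where K: "K1 > 0" "K2 > 0" "\<And>z. z \<in> S \<Longrightarrow> norm (A z) \<le> K1" "\<And>z. z \<in> S \<Longrightarrow> norm (B z) \<le> K2"
    unfolding bounded_pos by (metis imageI)
  have "onorm (\<lambda>d. A z * fst d + B z * snd d) \<le> K1 + K2" if "z \<in> S" for z
  proof (rule onorm_le)
    fix d :: "real \<times> real"
    have "norm (A z * fst d + B z * snd d) \<le> norm (A z) * norm (fst d) + norm (B z) * norm (snd d)"
      by (metis norm_triangle_ineq norm_mult)
    also have "\<dots> \<le> K1 * norm d + K2 * norm d"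
      using K that norm_fst_le[of "fst d" "snd d"] norm_snd_le[of "snd d" "fst d"]
      by (intro add_mono mult_mono) (auto simp: less_imp_le)
    finally show "norm (A z * fst d + B z * snd d) \<le> (K1 + K2) * norm d"
      by (simp add: algebra_simps)
  qed
  then have "(K1 + K2)-lipschitz_on S f"
    using deriv K assms(1) by (intro bounded_derivative_imp_lipschitz) auto
  then show thesis ..
qed

text \<open>The nearest-point projection to a box does not increase distances, so the Lipschitz
  constant survives.\<close>

lemma lipschitz_on_clamp:
  fixes f :: "'a::euclidean_space \<Rightarrow> 'b::metric_space"
  assumes L: "L-lipschitz_on (cbox lo hi) f" and "cbox lo hi \<noteq> {}"
  shows "L-lipschitz_on UNIV (\<lambda>z. f (clamp lo hi z))"
proof (rule lipschitz_onI)
  have le: "\<And>i. i \<in> Basis \<Longrightarrow> lo \<bullet> i \<le> hi \<bullet> i"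
    using assms(2) by (simp add: box_ne_empty)
  fix z w
  have "dist (f (clamp lo hi z)) (f (clamp lo hi w)) \<le> L * dist (clamp lo hi z) (clamp lo hi w)"
    using le by (intro lipschitz_onD[OF L] clamp_in_interval) auto
  also have "\<dots> \<le> L * dist z w"
    using lipschitz_on_nonneg[OF L] by (intro mult_left_mono dist_clamps_le_dist_args)
  finally show "dist (f (clamp lo hi z)) (f (clamp lo hi w)) \<le> L * dist z w" .
qed (rule lipschitz_on_nonneg[OF L])

section \<open>Trajectories of the planar system\<close>

context critical
begin

text \<open>Localised to a set of times because the orbit of a solution is at first known only on an
  open set; \<open>traj UNIV\<close> is \<open>complete_trajectory\<close>.\<close>

definition traj :: "real set \<Rightarrow> (real \<Rightarrow> real \<times> real) \<Rightarrow> bool" where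
  "traj I \<gamma> \<longleftrightarrow> (\<forall>t\<in>I. \<gamma> t \<in> quadrant \<and> (\<gamma> has_vector_derivative F (\<gamma> t)) (at t))"

lemma complete_trajectory_iff: "complete_trajectory N p s \<mu> q \<gamma> \<longleftrightarrow> traj UNIV \<gamma>"
  by (simp add: complete_trajectory_def traj_def)

lemma traj_subset: "traj I \<gamma> \<Longrightarrow> J \<subseteq> I \<Longrightarrow> traj J \<gamma>"
  by (auto simp: traj_def)

lemma traj_shift: "traj UNIV \<gamma> \<Longrightarrow> traj UNIV (\<lambda>t. \<gamma> (t + c))"
  using vector_diff_chain_at[OF has_vector_derivative_add[OF has_vector_derivative_id has_vector_derivative_const]]
  by (force simp: traj_def o_def)

lemma traj_continuous_on: "traj I \<gamma> \<Longrightarrow> continuous_on I \<gamma>"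
  by (rule has_vector_derivative_imp_continuous_on) (auto simp: traj_def)

lemma trajD:
  assumes "traj I \<gamma>" "t \<in> I"
  shows "fst (\<gamma> t) > 0" "snd (\<gamma> t) > 0"
    and "((\<lambda>t. fst (\<gamma> t)) has_real_derivative
           fst (\<gamma> t) powr (2 - p) / (p - 1) * (\<mu> + snd (\<gamma> t) - h (fst (\<gamma> t)))) (at t)"
    and "((\<lambda>t. snd (\<gamma> t)) has_real_derivative m * snd (\<gamma> t) * (a - fst (\<gamma> t))) (at t)"
proof -
  show "fst (\<gamma> t) > 0" "snd (\<gamma> t) > 0"
    using assms by (auto simp: traj_def)
  have "(\<gamma> has_vector_derivative F (fst (\<gamma> t), snd (\<gamma> t))) (at t)"
    using assms by (auto simp: traj_def)
  from bounded_linear.has_vector_derivative[OF bounded_linear_fst this]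
    bounded_linear.has_vector_derivative[OF bounded_linear_snd this]
  show "((\<lambda>t. fst (\<gamma> t)) has_real_derivative
           fst (\<gamma> t) powr (2 - p) / (p - 1) * (\<mu> + snd (\<gamma> t) - h (fst (\<gamma> t)))) (at t)"
    "((\<lambda>t. snd (\<gamma> t)) has_real_derivative m * snd (\<gamma> t) * (a - fst (\<gamma> t))) (at t)"
    by (simp_all only: F_eq fst_conv snd_conv has_real_derivative_iff_has_vector_derivative)
qed

lemma trajI:
  assumes "\<And>t. t \<in> I \<Longrightarrow> x t > 0" "\<And>t. t \<in> I \<Longrightarrow> Y t > 0"
    and "\<And>t. t \<in> I \<Longrightarrow> (x has_real_derivative x t powr (2 - p) / (p - 1) * (\<mu> + Y t - h (x t))) (at t)"
    and "\<And>t. t \<in> I \<Longrightarrow> (Y has_real_derivative m * Y t * (a - x t)) (at t)"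
  shows "traj I (\<lambda>t. (x t, Y t))"
  using assms unfolding traj_def F_eq has_real_derivative_iff_has_vector_derivative
  by (auto intro: has_vector_derivative_Pair)

text \<open>Multiplying x' by (p - 1) x^(p-2) removes the power x^(2-p). The variable x^(p-1) is the
  rescaled flux, so this is the form in which the second-order equation appears.\<close>

lemma traj_powr_deriv:
  assumes "traj I \<gamma>" "t \<in> I"
  shows "((\<lambda>t. fst (\<gamma> t) powr (p - 1)) has_real_derivative \<mu> + snd (\<gamma> t) - h (fst (\<gamma> t))) (at t)"
proof -
  note D = trajD[OF assms]
  have "((\<lambda>t. fst (\<gamma> t) powr (p - 1)) has_real_derivative
     (p - 1) * fst (\<gamma> t) powr (p - 1 - 1) * (fst (\<gamma> t) powr (2 - p) / (p - 1) * (\<mu> + snd (\<gamma> t) - h (fst (\<gamma> t))))) (at t)"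
    using DERIV_chain2[OF has_real_derivative_powr[OF D(1)] D(3)] .
  also have "(p - 1) * fst (\<gamma> t) powr (p - 1 - 1) * (fst (\<gamma> t) powr (2 - p) / (p - 1) * (\<mu> + snd (\<gamma> t) - h (fst (\<gamma> t))))
     = (fst (\<gamma> t) powr (p - 1 - 1) * fst (\<gamma> t) powr (2 - p)) * (\<mu> + snd (\<gamma> t) - h (fst (\<gamma> t)))"
    using p_gt_1 by simp
  also have "fst (\<gamma> t) powr (p - 1 - 1) * fst (\<gamma> t) powr (2 - p) = 1"
    using D(1) by (simp flip: powr_add)
  finally show ?thesis by simp
qed

lemma traj_h_deriv:
  assumes "traj I \<gamma>" "t \<in> I"
  shows "((\<lambda>t. h (fst (\<gamma> t))) has_real_derivative p * (a - fst (\<gamma> t)) * (\<mu> + snd (\<gamma> t) - h (fst (\<gamma> t)))) (at t)"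
proof -
  note D = trajD[OF assms]
  have "((\<lambda>t. h (fst (\<gamma> t))) has_real_derivative
     p * (p - 1) * fst (\<gamma> t) powr (p - 2) * (a - fst (\<gamma> t)) * (fst (\<gamma> t) powr (2 - p) / (p - 1) * (\<mu> + snd (\<gamma> t) - h (fst (\<gamma> t))))) (at t)"
    using DERIV_chain2[OF h_deriv[OF D(1)] D(3)] .
  also have "p * (p - 1) * fst (\<gamma> t) powr (p - 2) * (a - fst (\<gamma> t)) * (fst (\<gamma> t) powr (2 - p) / (p - 1) * (\<mu> + snd (\<gamma> t) - h (fst (\<gamma> t))))
     = (fst (\<gamma> t) powr (p - 2) * fst (\<gamma> t) powr (2 - p)) * (p * (a - fst (\<gamma> t)) * (\<mu> + snd (\<gamma> t) - h (fst (\<gamma> t))))"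
    using p_gt_1 by simp
  also have "fst (\<gamma> t) powr (p - 2) * fst (\<gamma> t) powr (2 - p) = 1"
    using D(1) by (simp flip: powr_add)
  finally show ?thesis by simp
qed

text \<open>Both terms of the product rule carry the factor Y^\<beta> (a - x): one from Y', the
  other from Y' and from the derivative of \<open>h\<close> along the trajectory. The remaining
  bracket vanishes because \<open>\<beta> * m = p\<close>.\<close>

lemma traj_H_deriv:
  assumes "traj I \<gamma>" "t \<in> I"
  shows "((\<lambda>t. H (\<gamma> t)) has_real_derivative 0) (at t)"
proof -
  note D = trajD[OF assms]
  define x Y where "x = fst (\<gamma> t)" and "Y = snd (\<gamma> t)"
  have Y: "Y > 0" using D by (simp add: Y_def)
  have "((\<lambda>t. snd (\<gamma> t) powr \<beta> / (p - 1)) has_real_derivative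
      \<beta> * Y powr (\<beta> - 1) * (m * Y * (a - x)) / (p - 1)) (at t)"
    unfolding x_def Y_def by (intro DERIV_cdivide DERIV_chain2[OF has_real_derivative_powr] D)
  moreover have "((\<lambda>t. (\<mu> - h (fst (\<gamma> t))) / \<beta> + snd (\<gamma> t) / (\<beta> + 1)) has_real_derivative
      (0 - p * (a - x) * (\<mu> + Y - h x)) / \<beta> + (m * Y * (a - x)) / (\<beta> + 1)) (at t)"
    unfolding x_def Y_def by (intro DERIV_add DERIV_cdivide DERIV_diff DERIV_const D traj_h_deriv[OF assms])
  ultimately have "((\<lambda>t. H (fst (\<gamma> t), snd (\<gamma> t))) has_real_derivative
      \<beta> * Y powr (\<beta> - 1) * (m * Y * (a - x)) / (p - 1) * ((\<mu> - h x) / \<beta> + Y / (\<beta> + 1))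
      + ((0 - p * (a - x) * (\<mu> + Y - h x)) / \<beta> + (m * Y * (a - x)) / (\<beta> + 1)) * (Y powr \<beta> / (p - 1))) (at t)"
    unfolding H_eq x_def Y_def by (rule DERIV_mult)
  also have "Y powr \<beta> = Y * Y powr (\<beta> - 1)"
    using Y by (simp add: powr_mult_base)
  also have "\<beta> * Y powr (\<beta> - 1) * (m * Y * (a - x)) / (p - 1) * ((\<mu> - h x) / \<beta> + Y / (\<beta> + 1))
      + ((0 - p * (a - x) * (\<mu> + Y - h x)) / \<beta> + (m * Y * (a - x)) / (\<beta> + 1)) * (Y * Y powr (\<beta> - 1) / (p - 1))
      = Y * Y powr (\<beta> - 1) * (a - x) / (p - 1) *
        (\<beta> * m * ((\<mu> - h x) / \<beta> + Y / (\<beta> + 1)) - p * (\<mu> + Y - h x) / \<beta> + m * Y / (\<beta> + 1))"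
    using p_gt_1 by (simp add: divide_simps) (simp add: algebra_simps)
  also have "\<beta> * m * ((\<mu> - h x) / \<beta> + Y / (\<beta> + 1)) - p * (\<mu> + Y - h x) / \<beta> + m * Y / (\<beta> + 1) = 0"
  proof -
    have "b * k * ((u - v) / b + Y / (b + 1)) - c * (u + Y - v) / b + k * Y / (b + 1) = 0"
      if "b \<noteq> 0" "b + 1 \<noteq> 0" "b * k = c" for b k c u v :: real
      unfolding that(3)[symmetric] using that(1,2)
      by (simp add: divide_simps) (simp add: algebra_simps)
    then show ?thesis by (simp add: beta_m)
  qed
  finally show ?thesis by simp
qed

lemma traj_H_const:
  assumes "traj I \<gamma>" "is_interval I" "t \<in> I" "t' \<in> I"
  shows "H (\<gamma> t) = H (\<gamma> t')"
proof -
  have "\<exists>c. \<forall>t\<in>I. H (\<gamma> t) = c"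
    using assms by (intro has_field_derivative_zero_constant is_interval_convex)
      (auto intro: has_field_derivative_at_within traj_H_deriv)
  then show ?thesis using assms by metis
qed

section \<open>Uniqueness on nonpositive levels and global existence on negative ones\<close>

lemma lipschitz_F:
  assumes "fst lo > 0"
  obtains L where "L-lipschitz_on (cbox lo hi) F"
proof -
  define S where "S = cbox lo hi"
  define k where "k = 1 / (p - 1)"
  have pos: "fst z > 0" if "z \<in> S" for z
    using that assms by (cases z; cases lo; cases hi) (auto simp: S_def)
  obtain L1 where L1: "L1-lipschitz_on S
    (\<lambda>z. k * (fst z powr (2 - p) * (\<mu> + snd z) - fst z * (p * a - (p - 1) * fst z)))"
  proof (rule lipschitz_on_plane)
    show "((\<lambda>z. k * (fst z powr (2 - p) * (\<mu> + snd z) - fst z * (p * a - (p - 1) * fst z)))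
      has_derivative (\<lambda>d. k * ((2 - p) * fst z powr (1 - p) * (\<mu> + snd z) - (p * a - 2 * (p - 1) * fst z)) * fst d
        + k * fst z powr (2 - p) * snd d)) (at z within S)" if "z \<in> S" for z
    proof -
      define P where "P w = fst w powr (2 - p)" for w :: "real \<times> real"
      have P: "(P has_derivative (\<lambda>d. (2 - p) * fst z powr (1 - p) * fst d)) (at z within S)"
        unfolding P_def
        using has_derivative_compose[OF has_derivative_fst[OF has_derivative_ident]
            has_real_derivative_powr[OF pos[OF that], of "2 - p", unfolded has_field_derivative_def]] by simp
      show ?thesis
        unfolding P_def[symmetric]
        by (auto intro!: derivative_eq_intros P simp: fun_eq_iff algebra_simps)
    qed
    have "fst z \<noteq> 0" if "z \<in> S" for z using pos[OF that] by simp
    then show "continuous_on S (\<lambda>z. k * ((2 - p) * fst z powr (1 - p) * (\<mu> + snd z) - (p * a - 2 * (p - 1) * fst z)))"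
      "continuous_on S (\<lambda>z. k * fst z powr (2 - p))"
      by (auto intro!: continuous_intros)
  qed (auto simp: S_def)
  \<comment> \<open>Since x^(2-p) x^(p-1) = x, the contribution of \<open>h\<close> to the first
    component is a quadratic polynomial in x; only x^(2-p) remains, which is smooth for x >
    0.\<close>
  have F1: "fst (F z) = k * (fst z powr (2 - p) * (\<mu> + snd z) - fst z * (p * a - (p - 1) * fst z))"
    if "z \<in> S" for z
  proof -
    have "fst z powr (2 - p) * h (fst z) = (fst z powr (2 - p) * fst z powr (p - 1)) * (p * a - (p - 1) * fst z)"
      by (simp add: h_eq)
    also have "fst z powr (2 - p) * fst z powr (p - 1) = fst z"
      using pos[OF that] by (simp flip: powr_add)
    finally have "fst z powr (2 - p) * h (fst z) = fst z * (p * a - (p - 1) * fst z)" .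
    moreover have "fst (F z) = k * (fst z powr (2 - p) * (\<mu> + snd z) - fst z powr (2 - p) * h (fst z))"
      by (cases z) (simp add: F_eq k_def right_diff_distrib)
    ultimately show ?thesis by simp
  qed
  obtain L2 where L2: "L2-lipschitz_on S (\<lambda>z. m * snd z * (a - fst z))"
  proof (rule lipschitz_on_plane)
    show "((\<lambda>z. m * snd z * (a - fst z)) has_derivative (\<lambda>d. (- m * snd z) * fst d + (m * (a - fst z)) * snd d)) (at z within S)" for z
      by (auto intro!: derivative_eq_intros simp: algebra_simps)
  qed (auto simp: S_def intro!: continuous_intros)
  have "(sqrt (L1\<^sup>2 + L2\<^sup>2))-lipschitz_on S (\<lambda>z. (fst (F z), m * snd z * (a - fst z)))"
    using L1 L2 F1 by (intro lipschitz_on_Pair) (auto cong: lipschitz_on_cong)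
  then have "(sqrt (L1\<^sup>2 + L2\<^sup>2))-lipschitz_on S F"
    by (rule lipschitz_on_transform) (auto simp: planar_field_def case_prod_beta m_def)
  then show thesis using that by (simp add: S_def)
qed

text \<open>Conservation of \<open>H\<close> and the a priori bounds keep both trajectories in one
  box with x \<ge> \<open>\<nu>m\<close> > 0, where the field is Lipschitz. The box reaches down to
  Y = 0, so the level zero is covered as well.\<close>

lemma traj_unique:
  assumes "traj I \<gamma>" "traj I \<delta>" "is_interval I" "t0 \<in> I" "\<gamma> t0 = \<delta> t0" "H (\<gamma> t0) \<le> 0" "t \<in> I"
  shows "\<gamma> t = \<delta> t"
proof -
  define S where "S = cbox (\<nu>m, 0) (\<nu>p, (\<beta> + 1) / \<beta> * Ystar)"
  obtain L where L: "L-lipschitz_on S F"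
    using lipschitz_F[of "(\<nu>m, 0)"] nu_pos unfolding S_def by auto
  have in_S: "\<zeta> t \<in> S" if "traj I \<zeta>" "t \<in> I" "\<zeta> t0 = \<gamma> t0" for \<zeta> t
  proof -
    have "H (\<zeta> t) \<le> 0"
      using traj_H_const[OF that(1) assms(3) that(2) assms(4)] that assms(6) by simp
    from H_nonpos_bounds[OF _ this] that show ?thesis
      by (cases "\<zeta> t") (auto simp: S_def traj_def)
  qed
  show ?thesis
    by (rule lipschitz_ode_unique[OF L assms(3), of \<gamma> \<delta> t0])
      (use assms in_S[of \<gamma>] in_S[of \<delta>] in \<open>auto simp: traj_def\<close>)
qed

text \<open>As \<open>h\<close> is at most \<open>mu_bar N p\<close>, the bracket in
  \<open>H\<close> is at least - Ystar / \<beta>. A negative value of \<open>H\<close> therefore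
  forces Y^\<beta> to be at least \<open>K\<close>.\<close>

lemma level_lower_bound:
  assumes "\<kappa> < 0"
  obtains y0 where "y0 > 0" "\<And>z. z \<in> quadrant \<Longrightarrow> H z \<le> \<kappa> \<Longrightarrow> y0 \<le> snd z"
proof -
  define K where "K = (p - 1) * \<beta> * (- \<kappa>) / Ystar"
  have "K > 0" using assms p_gt_1 unfolding K_def
    by (intro divide_pos_pos mult_pos_pos) auto
  have "K powr (1 / \<beta>) \<le> snd z" if z: "z \<in> quadrant" "H z \<le> \<kappa>" for z
  proof -
    define x Y where "x = fst z" and "Y = snd z"
    have pos: "x > 0" "Y > 0" using z by (auto simp: x_def Y_def)
    have "Y powr \<beta> / (p - 1) * (- Ystar / \<beta>) \<le> Y powr \<beta> / (p - 1) * ((\<mu> - h x) / \<beta> + Y / (\<beta> + 1))"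
    proof (rule mult_left_mono)
      have "- Ystar / \<beta> \<le> (\<mu> - h x) / \<beta>"
        using h_le[OF pos(1)] by (intro divide_right_mono) (auto simp: Ystar_eq less_imp_le)
      moreover have "0 \<le> Y / (\<beta> + 1)" using pos by (simp add: less_imp_le)
      ultimately show "- Ystar / \<beta> \<le> (\<mu> - h x) / \<beta> + Y / (\<beta> + 1)" by linarith
    qed (use p_gt_1 in auto)
    also have "\<dots> \<le> \<kappa>"
      using z by (cases z) (simp add: x_def Y_def H_eq)
    finally have "K \<le> Y powr \<beta>"
      using p_gt_1 by (simp add: K_def field_simps)
    then have "K powr (1 / \<beta>) \<le> (Y powr \<beta>) powr (1 / \<beta>)"
      using \<open>K > 0\<close> by (intro powr_mono2) (auto simp: less_imp_le)
    also have "\<dots> = Y" using pos by (simp add: powr_powr)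
    finally show ?thesis by (simp add: Y_def)
  qed
  then show thesis
    using \<open>K > 0\<close> by (intro that[of "K powr (1 / \<beta>)"]) auto
qed

text \<open>The a priori bounds are relaxed by a factor 1/2 below and by 1 above, so that the
  sublevel lies in the open box while the closed box still avoids the axes.\<close>

lemma sublevel_box:
  assumes "\<kappa> < 0"
  obtains lo hi where "fst lo > 0" "cbox lo hi \<subseteq> quadrant"
    "\<And>z. z \<in> quadrant \<Longrightarrow> H z \<le> \<kappa> \<Longrightarrow> z \<in> box lo hi"
proof -
  obtain y0 where y0: "y0 > 0" "\<And>z. z \<in> quadrant \<Longrightarrow> H z \<le> \<kappa> \<Longrightarrow> y0 \<le> snd z"
    by (rule level_lower_bound[OF assms]) blast
  define lo hi where "lo = (\<nu>m / 2, y0 / 2)" and "hi = (\<nu>p + 1, (\<beta> + 1) / \<beta> * Ystar + 1)"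
  show thesis
  proof (rule that[of lo hi])
    show "fst lo > 0" by (simp add: lo_def)
    show "cbox lo hi \<subseteq> quadrant"
      using y0(1) nu_pos by (auto simp: lo_def hi_def simp del: nu_pos)
    show "z \<in> box lo hi" if "z \<in> quadrant" "H z \<le> \<kappa>" for z
      using H_nonpos_bounds[OF that(1)] y0(2)[OF that] y0(1) that(2) assms nu_pos
      by (cases z) (auto simp: lo_def hi_def mem_box Basis_prod_def simp del: nu_pos)
  qed
qed

text \<open>The vector field is extended to a Lipschitz field on the plane by projection to a box that
  contains the level in its interior.\<close>

lemma traj_exists:
  assumes "z0 \<in> quadrant" "H z0 < 0"
  obtains \<gamma> where "traj UNIV \<gamma>" "\<gamma> t0 = z0"
proof -
  define \<kappa> where "\<kappa> = H z0"
  then have "\<kappa> < 0" using assms by simp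
  then obtain lo hi where lo: "fst lo > 0" and box_pos: "cbox lo hi \<subseteq> quadrant"
    and sub: "\<And>z. z \<in> quadrant \<Longrightarrow> H z \<le> \<kappa> \<Longrightarrow> z \<in> box lo hi"
    by (rule sublevel_box) blast
  have level_box: "z \<in> box lo hi" if "z \<in> quadrant" "H z = \<kappa>" for z
    using sub that by simp
  obtain L where L: "L-lipschitz_on (cbox lo hi) F"
    using lipschitz_F[OF lo] .
  have "L-lipschitz_on UNIV (\<lambda>z. F (clamp lo hi z))"
    using level_box[of z0] assms box_subset_cbox[of lo hi]
    by (intro lipschitz_on_clamp[OF L]) (auto simp: \<kappa>_def)
  then obtain \<gamma> where \<gamma>: "\<gamma> t0 = z0" "\<And>t. (\<gamma> has_vector_derivative F (clamp lo hi (\<gamma> t))) (at t)"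
    by (rule lipschitz_ode_exists[where ?z0.0 = z0 and ?t0.0 = t0]) blast
  have cont: "continuous_on UNIV \<gamma>"
    by (rule has_vector_derivative_imp_continuous_on[OF \<gamma>(2)])
  \<comment> \<open>The times at which the solution of the extended system is on the level form a
    closed set, because the level is closed in the box, and an open set, because near such a time
    the solution is inside the box, where the extended field is \<open>F\<close> and conserves
    \<open>H\<close>. Connectedness of the line gives all times.\<close>
  define T where "T = {t. \<gamma> t \<in> quadrant \<and> H (\<gamma> t) = \<kappa>}"
  have "T = \<gamma> -` {z \<in> cbox lo hi. H z = \<kappa>}"
  proof (intro set_eqI iffI)
    fix t assume "t \<in> T"
    then have "\<gamma> t \<in> cbox lo hi" "H (\<gamma> t) = \<kappa>"
      using level_box[of "\<gamma> t"] box_subset_cbox[of lo hi] by (auto simp: T_def)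
    then show "t \<in> \<gamma> -` {z \<in> cbox lo hi. H z = \<kappa>}" by simp
  next
    fix t assume "t \<in> \<gamma> -` {z \<in> cbox lo hi. H z = \<kappa>}"
    then have "\<gamma> t \<in> cbox lo hi" "H (\<gamma> t) = \<kappa>" by auto
    then show "t \<in> T" using subsetD[OF box_pos, of "\<gamma> t"] by (simp add: T_def)
  qed
  moreover have "closed {z \<in> cbox lo hi. H z = \<kappa>}"
    using continuous_closed_preimage_constant[OF continuous_on_subset[OF continuous_on_H box_pos]] by auto
  ultimately have "closed T"
    by (simp only: closed_vimage[OF _ cont])
  have "open T"
    unfolding open_dist
  proof
    fix t assume "t \<in> T"
    then have "\<gamma> t \<in> box lo hi" using level_box by (auto simp: T_def)
    moreover have "open (\<gamma> -` box lo hi)"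
      using cont by (intro open_vimage open_box)
    ultimately obtain e where e: "e > 0" "ball t e \<subseteq> \<gamma> -` box lo hi"
      
      using openE[of "\<gamma> -` box lo hi" t] by (metis vimageI)
    have "traj (ball t e) \<gamma>"
      unfolding traj_def
    proof
      fix t' assume "t' \<in> ball t e"
      then have "\<gamma> t' \<in> box lo hi" using e by auto
      then have "\<gamma> t' \<in> cbox lo hi" using box_subset_cbox[of lo hi] by blast
      then show "\<gamma> t' \<in> quadrant \<and> (\<gamma> has_vector_derivative F (\<gamma> t')) (at t')"
        using \<gamma>(2)[of t'] box_pos by auto
    qed
    moreover have "is_interval (ball t e)" "t \<in> ball t e"
      using e(1) by (auto simp: is_interval_ball_real)
    ultimately have "t' \<in> T" if "t' \<in> ball t e" for t'
      using traj_H_const[of "ball t e" \<gamma> t' t] that \<open>t \<in> T\<close> unfolding T_def traj_def by auto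
    then show "\<exists>e>0. \<forall>t'. dist t' t < e \<longrightarrow> t' \<in> T"
      using e(1) by (auto simp: dist_commute)
  qed
  have "t0 \<in> T" using assms \<gamma>(1) by (simp add: T_def \<kappa>_def)
  then have "T = UNIV"
    using \<open>open T\<close> \<open>closed T\<close> clopen by blast
  have "traj UNIV \<gamma>"
    unfolding traj_def
  proof
    fix t
    have "t \<in> T" using \<open>T = UNIV\<close> by simp
    then have "\<gamma> t \<in> quadrant" "\<gamma> t \<in> cbox lo hi"
      using level_box[of "\<gamma> t"] box_subset_cbox[of lo hi] by (auto simp: T_def)
    then show "\<gamma> t \<in> quadrant \<and> (\<gamma> has_vector_derivative F (\<gamma> t)) (at t)"
      using \<gamma>(2)[of t] by simp
  qed
  then show thesis using \<gamma>(1) that by blast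
qed

end

lemma C1_differentiable_on_real_deriv:
  fixes f :: "real \<Rightarrow> real"
  assumes "f C1_differentiable_on S"
  shows "\<And>x. x \<in> S \<Longrightarrow> (f has_real_derivative deriv f x) (at x)" "continuous_on S (deriv f)"
proof -
  obtain D where D: "\<And>x. x \<in> S \<Longrightarrow> (f has_real_derivative D x) (at x)" "continuous_on S D"
    using assms by (auto simp: C1_differentiable_on_def has_real_derivative_iff_has_vector_derivative)
  have "deriv f x = D x" if "x \<in> S" for x
    using DERIV_imp_deriv[OF D(1)[OF that]] .
  then show "\<And>x. x \<in> S \<Longrightarrow> (f has_real_derivative deriv f x) (at x)" "continuous_on S (deriv f)"
    using D by (simp_all cong: continuous_on_cong)
qed

lemma C1_differentiable_on_realI:
  fixes f :: "real \<Rightarrow> real"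
  assumes "\<And>x. x \<in> S \<Longrightarrow> (f has_real_derivative D x) (at x)" "continuous_on S D"
  shows "f C1_differentiable_on S"
  using assms by (auto simp: C1_differentiable_on_def has_real_derivative_iff_has_vector_derivative)

section \<open>Levels above zero\<close>

context critical
begin

text \<open>Eliminates h x with the help of the value of \<open>H\<close>: on a fixed level the sign
  of x' is determined by Y alone. On positive levels the right-hand side is bounded below by a
  positive constant, on negative levels it increases with Y.\<close>

lemma level_drive:
  assumes "Y > 0"
  shows "\<mu> + Y - h x = \<beta> * (p - 1) * H (x, Y) / Y powr \<beta> + Y / (\<beta> + 1)"
proof -
  have "H (x, Y) * (p - 1) / Y powr \<beta> = (\<mu> - h x) / \<beta> + Y / (\<beta> + 1)"
  proof -
    have "w / (p - 1) * B * (p - 1) / w = B" if "w \<noteq> 0" for w B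
      using that p_gt_1 by simp
    then show ?thesis unfolding H_eq using assms by simp
  qed
  then have "\<beta> * (H (x, Y) * (p - 1) / Y powr \<beta>) = (\<mu> - h x) + (\<beta> + 1 - 1) * (Y / (\<beta> + 1))"
    by (simp add: distrib_left)
  then show ?thesis
    by (simp only: left_diff_distrib) (simp add: mult_ac)
qed

text \<open>On a positive level \<open>x powr (p - 1)\<close> grows at least linearly, and once \<open>x\<close> is large
  it satisfies \<open>x' \<ge> x\<^sup>2 / 2\<close>, which forces blow-up in finite time.\<close>

lemma half_line_H_nonpos:
  assumes "traj {c<..} \<gamma>" "t1 > c"
  shows "H (\<gamma> t1) \<le> 0"
proof (rule ccontr)
  assume "\<not> H (\<gamma> t1) \<le> 0"
  define \<kappa> where "\<kappa> = H (\<gamma> t1)"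
  have \<kappa>: "\<kappa> > 0" using \<open>\<not> H (\<gamma> t1) \<le> 0\<close> by (simp add: \<kappa>_def)
  define x Y where "x t = fst (\<gamma> t)" and "Y t = snd (\<gamma> t)" for t
  have pos: "x t > 0" "Y t > 0" if "t > c" for t
    using trajD[OF assms(1), of t] that by (auto simp: x_def Y_def)
  have level: "H (x t, Y t) = \<kappa>" if "t > c" for t
    using traj_H_const[OF assms(1), of t t1] that assms(2)
    by (simp add: x_def Y_def \<kappa>_def is_interval_io)
  \<comment> \<open>The first entry bounds the term with \<kappa> when Y \<le> 1, the second bounds
    the term Y / (\<beta> + 1) when Y \<ge> 1.\<close>
  define c0 where "c0 = min (\<beta> * (p - 1) * \<kappa>) (1 / (\<beta> + 1))"
  have c0: "c0 > 0" using \<kappa> p_gt_1 by (simp add: c0_def)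
  have growth: "c0 \<le> \<mu> + Y t - h (x t)" if "t > c" for t
  proof -
    have "\<mu> + Y t - h (x t) = \<beta> * (p - 1) * \<kappa> / Y t powr \<beta> + Y t / (\<beta> + 1)"
      using level_drive[of "Y t" "x t"] pos[OF that] level[OF that] by simp
    moreover have "c0 \<le> \<beta> * (p - 1) * \<kappa> / Y t powr \<beta> + Y t / (\<beta> + 1)"
    proof (cases "Y t \<ge> 1")
      case True
      then have "1 / (\<beta> + 1) \<le> Y t / (\<beta> + 1)"
        by (intro divide_right_mono) (auto simp: less_imp_le)
      moreover have "0 \<le> \<beta> * (p - 1) * \<kappa> / Y t powr \<beta>"
        using \<kappa> p_gt_1 by (simp add: less_imp_le)
      ultimately show ?thesis by (simp add: c0_def)
    next
      case False
      then have "Y t powr \<beta> \<le> 1"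
        using pos[OF that] by (intro powr_le1) (auto simp: less_imp_le)
      then have "\<beta> * (p - 1) * \<kappa> / 1 \<le> \<beta> * (p - 1) * \<kappa> / Y t powr \<beta>"
        using \<kappa> p_gt_1 pos[OF that] by (intro divide_left_mono mult_nonneg_nonneg) (auto simp: less_imp_le)
      moreover have "0 \<le> Y t / (\<beta> + 1)"
        using pos[OF that] by (simp add: less_imp_le)
      ultimately show ?thesis by (simp add: c0_def)
    qed
    ultimately show ?thesis by simp
  qed
  have lin: "x t1 powr (p - 1) - c0 * t1 \<le> x t powr (p - 1) - c0 * t" if "t1 \<le> t" for t
  proof (rule DERIV_nonneg_imp_nondecreasing[OF that, where f = "\<lambda>t. x t powr (p - 1) - c0 * t"])
    fix u assume "t1 \<le> u"
    then have u: "u > c" using assms by simp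
    have "((\<lambda>t. x t powr (p - 1) - c0 * t) has_real_derivative (\<mu> + Y u - h (x u)) - c0) (at u)"
      using DERIV_diff[OF traj_powr_deriv[OF assms(1), of u] DERIV_cmult_Id[of c0]] u
      by (simp add: x_def Y_def)
    then show "\<exists>y. ((\<lambda>t. x t powr (p - 1) - c0 * t) has_real_derivative y) (at u) \<and> 0 \<le> y"
      using growth[OF u] by fastforce
  qed
  \<comment> \<open>Twice the positive zero of \<open>h\<close>: for x \<ge> X the lower bound x (x
    - X / 2) for x' is at least x^2 / 2.\<close>
  define X where "X = 2 * (p * a / (p - 1))"
  have X: "X > 0" using p_gt_1 by (simp add: X_def)
  define t2 where "t2 = t1 + X powr (p - 1) / c0"
  have t2: "t2 \<ge> t1" using c0 by (simp add: t2_def)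
  have large: "x t \<ge> X" if "t \<ge> t2" for t
  proof (rule ccontr)
    assume "\<not> x t \<ge> X"
    then have "x t powr (p - 1) < X powr (p - 1)"
      using pos[of t] that t2 assms p_gt_1 by (intro powr_less_mono2) auto
    also have "X powr (p - 1) = c0 * (t2 - t1)"
      using c0 by (simp add: t2_def)
    also have "\<dots> \<le> c0 * (t - t1)"
      using that c0 by (intro mult_left_mono) auto
    also have "\<dots> \<le> x t powr (p - 1)"
      using lin[of t] that t2 powr_ge_zero[of "x t1" "p - 1"] unfolding right_diff_distrib by linarith
    finally show False by simp
  qed
  \<comment> \<open>From x' \<ge> x^2 / 2 the derivative of 1 / x is at most - 1/2, so 1 / x would
    reach 0 by the time t2 + 2 / x t2.\<close>
  have dec: "1 / x t + t / 2 \<le> 1 / x t2 + t2 / 2" if "t2 \<le> t" for t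
  proof (rule DERIV_nonpos_imp_nonincreasing[OF that, where f = "\<lambda>t. 1 / x t + t / 2"])
    fix u assume "t2 \<le> u"
    then have u: "u > c" "x u \<ge> X" using assms t2 large by auto
    note p = pos[OF u(1)]
    define x' where "x' = x u powr (2 - p) / (p - 1) * (\<mu> + Y u - h (x u))"
    have D: "(x has_real_derivative x') (at u)"
      using trajD(3)[OF assms(1), of u] u by (simp add: x_def[abs_def] Y_def x'_def)
    have "x u powr (2 - p) / (p - 1) * (- h (x u)) \<le> x'"
      unfolding x'_def using p mu_pos p_gt_1 by (intro mult_left_mono) auto
    moreover have "x u powr (2 - p) / (p - 1) * (- h (x u))
        = (x u powr (2 - p) * x u powr (p - 1)) * (((p - 1) * x u - p * a) / (p - 1))"
    proof -
      have "- h (x u) = x u powr (p - 1) * ((p - 1) * x u - p * a)"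
        by (simp add: h_eq algebra_simps)
      then show ?thesis by simp
    qed
    moreover have "x u powr (2 - p) * x u powr (p - 1) = x u"
      using p by (simp flip: powr_add)
    moreover have "((p - 1) * x u - p * a) / (p - 1) = x u - X / 2"
    proof -
      have half: "X / 2 = p * a / (p - 1)"
        unfolding X_def by (rule nonzero_mult_div_cancel_left) simp
      show ?thesis unfolding half using p_gt_1 by (simp add: diff_divide_distrib)
    qed
    ultimately have "x u * (x u - X / 2) \<le> x'" by simp
    moreover have "x u * (x u / 2) \<le> x u * (x u - X / 2)"
      using p u by (intro mult_left_mono) auto
    ultimately have le: "(x u)\<^sup>2 / 2 \<le> x'" by (simp add: power2_eq_square)
    have "((\<lambda>t. 1 / x t + t / 2) has_real_derivative - x' / (x u)\<^sup>2 + 1 / 2) (at u)"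
      using p by (auto intro!: derivative_eq_intros D simp: power2_eq_square)
    moreover have "- x' / (x u)\<^sup>2 + 1 / 2 \<le> 0"
      using le p by (simp add: field_simps)
    ultimately show "\<exists>y. ((\<lambda>t. 1 / x t + t / 2) has_real_derivative y) (at u) \<and> y \<le> 0"
      by blast
  qed
  define t3 where "t3 = t2 + 2 / x t2"
  have "t2 > c" using t2 assms by simp
  then have "t3 \<ge> t2" using pos[of t2] by (simp add: t3_def)
  have "1 / x t3 \<le> 0"
    using dec[OF \<open>t3 \<ge> t2\<close>] by (simp add: t3_def add_divide_distrib)
  then show False
    using pos[of t3] \<open>t3 \<ge> t2\<close> \<open>t2 > c\<close> by (simp add: divide_le_0_iff)
qed

section \<open>Solutions and trajectories\<close>

lemma orbit_point_eq:
  "orbit_point p s q v t =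
    (- (exp t * deriv v (exp t) / v (exp t)), exp t powr (p + s) * v (exp t) powr m)"
  by (simp add: orbit_point_def Let_def m_def)

lemma solution_flux_neg:
  "r > 0 \<Longrightarrow> flux N p v r < 0 \<longleftrightarrow> deriv v r < 0"
  by (auto simp: flux_def mult_less_0_iff)

lemma flux_eq_of_neg:
  assumes "deriv v r < 0"
  shows "flux N p v r = - (r powr (N - 1) * (- deriv v r) powr (p - 1))"
  using assms powr_p_minus_1[of "- deriv v r"] by (simp add: flux_def mult.commute)

lemma solutionD:
  assumes "solution N p s \<mu> q I v" "r \<in> I"
  shows "v r > 0" "(v has_real_derivative deriv v r) (at r)"
    "(flux N p v has_real_derivative
       - (\<mu> * r powr (N - 1 - p) * v r powr (p - 1) + r powr (N - 1 + s) * v r powr q)) (at r)"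
proof -
  show "v r > 0" "(v has_real_derivative deriv v r) (at r)"
    using assms C1_differentiable_on_real_deriv(1)[of v I] by (auto simp: solution_def)
  have "(flux N p v has_real_derivative deriv (flux N p v) r) (at r)"
    using assms C1_differentiable_on_real_deriv(1)[of "flux N p v" I] by (auto simp: solution_def)
  then show "(flux N p v has_real_derivative
       - (\<mu> * r powr (N - 1 - p) * v r powr (p - 1) + r powr (N - 1 + s) * v r powr q)) (at r)"
    using assms unfolding solution_def by (metis minus_minus)
qed

text \<open>v' is only known to be continuous, so x cannot be differentiated directly. The flux is
  C1, and its rescaling \<open>y\<close> equals x^(p-1); hence the equation for the flux gives that
  for x^(p-1), and x = y^(1/(p-1)) is differentiable because y > 0.\<close>

lemma solution_traj:
  assumes sol: "solution N p s \<mu> q I v"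
    and J: "\<And>t. t \<in> J \<Longrightarrow> exp t \<in> I \<and> deriv v (exp t) < 0" "open J"
  shows "traj J (orbit_point p s q v)"
proof -
  define x where "x t = - (exp t * deriv v (exp t) / v (exp t))" for t
  define lv where "lv t = ln (v (exp t))" for t
  define Y where "Y t = exp ((p + s) * t + m * lv t)" for t
  \<comment> \<open>The flux divided by r^(N-p) v^(p-1), with the sign changed; the powers of r and
    v then combine to (- r v' / v)^(p-1).\<close>
  define y where "y t = - flux N p v (exp t) * exp (- ((N - p) * t) - (p - 1) * lv t)" for t
  note S = solutionD[OF sol]
  have v: "v (exp t) = exp (lv t)" if "t \<in> J" for t
    using S(1) J(1)[OF that] by (simp add: lv_def)
  have lv': "(lv has_real_derivative - x t) (at t)" if "t \<in> J" for t
  proof -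
    have "(lv has_real_derivative 1 / v (exp t) * (deriv v (exp t) * exp t)) (at t)"
      unfolding lv_def using J(1)[OF that]
      by (intro DERIV_chain2[of ln] DERIV_chain2[of v] DERIV_exp S DERIV_ln_divide) auto
    then show ?thesis by (simp add: x_def mult.commute)
  qed
  have Y_eq: "exp t powr (p + s) * v (exp t) powr m = Y t" if "t \<in> J" for t
    by (simp add: v[OF that] Y_def powr_def exp_add)
  have x_pos: "x t > 0" if "t \<in> J" for t
    using J(1)[OF that] S(1)[of "exp t"] by (simp add: x_def divide_less_0_iff mult_less_0_iff)
  have y_x: "y t = x t powr (p - 1)" if "t \<in> J" for t
  proof -
    have "- deriv v (exp t) = x t * exp (lv t - t)"
      by (simp add: x_def v[OF that] exp_diff)
    then have "y t = exp t powr (N - 1) * (x t * exp (lv t - t)) powr (p - 1) * exp (- ((N - p) * t) - (p - 1) * lv t)"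
      using J(1)[OF that] by (simp add: y_def flux_eq_of_neg)
    also have "(x t * exp (lv t - t)) powr (p - 1) = x t powr (p - 1) * exp ((p - 1) * (lv t - t))"
      using x_pos[OF that] by (simp add: powr_mult less_imp_le) (simp add: powr_def)
    also have "exp t powr (N - 1) = exp ((N - 1) * t)"
      by (simp add: powr_def)
    also have "exp ((N - 1) * t) * (x t powr (p - 1) * exp ((p - 1) * (lv t - t))) * exp (- ((N - p) * t) - (p - 1) * lv t)
      = x t powr (p - 1) * exp ((N - 1) * t + (p - 1) * (lv t - t) + (- ((N - p) * t) - (p - 1) * lv t))"
      by (simp only: exp_add mult_ac)
    also have "(N - 1) * t + (p - 1) * (lv t - t) + (- ((N - p) * t) - (p - 1) * lv t) = 0"
      by (simp add: algebra_simps)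
    finally show ?thesis by simp
  qed
  have y': "(y has_real_derivative \<mu> + Y t - h (x t)) (at t)" if "t \<in> J" for t
  proof -
    define A where "A = \<mu> * exp t powr (N - 1 - p) * v (exp t) powr (p - 1) + exp t powr (N - 1 + s) * v (exp t) powr q"
    have A: "exp t * A * exp (- ((N - p) * t) - (p - 1) * lv t) = \<mu> + Y t"
    proof -
      have "exp t * A * exp (- ((N - p) * t) - (p - 1) * lv t)
        = \<mu> * exp (t + (N - 1 - p) * t + (p - 1) * lv t - (N - p) * t - (p - 1) * lv t)
         + exp (t + (N - 1 + s) * t + q * lv t - (N - p) * t - (p - 1) * lv t)"
        unfolding A_def v[OF that] by (simp add: powr_def exp_add exp_diff exp_minus field_simps)
      also have "t + (N - 1 - p) * t + (p - 1) * lv t - (N - p) * t - (p - 1) * lv t = 0"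
        by (simp add: algebra_simps)
      also have "t + (N - 1 + s) * t + q * lv t - (N - p) * t - (p - 1) * lv t = (p + s) * t + m * lv t"
        by (simp add: algebra_simps m_def)
      finally show ?thesis by (simp add: Y_def)
    qed
    have "((\<lambda>t. - flux N p v (exp t)) has_real_derivative exp t * A) (at t)"
      using DERIV_minus[OF DERIV_chain2[OF S(3) DERIV_exp]] J(1)[OF that]
      by (simp add: A_def algebra_simps)
    moreover have "((\<lambda>t. exp (- ((N - p) * t) - (p - 1) * lv t)) has_real_derivative
        exp (- ((N - p) * t) - (p - 1) * lv t) * (- (N - p) + (p - 1) * x t)) (at t)"
      by (auto intro!: derivative_eq_intros lv'[OF that])
    ultimately have "(y has_real_derivative exp t * A * exp (- ((N - p) * t) - (p - 1) * lv t)
        + exp (- ((N - p) * t) - (p - 1) * lv t) * (- (N - p) + (p - 1) * x t) * (- flux N p v (exp t))) (at t)"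
      unfolding y_def by (rule DERIV_mult)
    also have "exp (- ((N - p) * t) - (p - 1) * lv t) * (- (N - p) + (p - 1) * x t) * (- flux N p v (exp t))
        = - h (x t)"
      using y_x[OF that] unfolding y_def hfun_def by (simp add: algebra_simps)
    finally show ?thesis by (simp add: A)
  qed
  have "traj J (\<lambda>t. (x t, Y t))"
  proof (rule trajI)
    fix t assume t: "t \<in> J"
    show "x t > 0" "Y t > 0" using x_pos[OF t] by (auto simp: Y_def)
    show "(Y has_real_derivative m * Y t * (a - x t)) (at t)"
    proof -
      have "(Y has_real_derivative Y t * ((p + s) + m * (- x t))) (at t)"
        unfolding Y_def by (auto intro!: derivative_eq_intros lv'[OF t])
      also have "Y t * ((p + s) + m * (- x t)) = m * Y t * (a - x t)"
        unfolding m_a[symmetric] by (simp add: algebra_simps)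
      finally show ?thesis .
    qed
    have "y t > 0" using y_x[OF t] x_pos[OF t] by simp
    then have "((\<lambda>t. y t powr (1 / (p - 1))) has_real_derivative
        1 / (p - 1) * y t powr (1 / (p - 1) - 1) * (\<mu> + Y t - h (x t))) (at t)"
      by (intro DERIV_chain2[OF has_real_derivative_powr] y'[OF t])
    also have "y t powr (1 / (p - 1) - 1) = x t powr (2 - p)"
    proof -
      have "(p - 1) * (1 / (p - 1) - 1) = 2 - p"
        using p_gt_1 by (simp add: right_diff_distrib)
      then show ?thesis by (simp only: y_x[OF t] powr_powr)
    qed
    finally have "((\<lambda>t. y t powr (1 / (p - 1))) has_real_derivative
        x t powr (2 - p) / (p - 1) * (\<mu> + Y t - h (x t))) (at t)" by simp
    then show "(x has_real_derivative x t powr (2 - p) / (p - 1) * (\<mu> + Y t - h (x t))) (at t)"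
    proof (rule has_field_derivative_transform_within_open[OF _ J(2) t])
      show "y u powr (1 / (p - 1)) = x u" if "u \<in> J" for u
        using x_pos[OF that] p_gt_1 by (simp add: y_x[OF that] powr_powr)
    qed
  qed
  show ?thesis
    unfolding traj_def
  proof
    fix t assume t: "t \<in> J"
    have eq: "orbit_point p s q v u = (x u, Y u)" if "u \<in> J" for u
      by (simp add: orbit_point_eq x_def Y_eq[OF that])
    have "((\<lambda>t. (x t, Y t)) has_vector_derivative F (orbit_point p s q v t)) (at t)"
      using \<open>traj J (\<lambda>t. (x t, Y t))\<close> t by (simp add: traj_def eq)
    then have "(orbit_point p s q v has_vector_derivative F (orbit_point p s q v t)) (at t)"
      by (rule has_vector_derivative_transform_within_open[OF _ J(2) t]) (simp add: eq)
    then show "orbit_point p s q v t \<in> quadrant \<and>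
        (orbit_point p s q v has_vector_derivative F (orbit_point p s q v t)) (at t)"
      using \<open>traj J (\<lambda>t. (x t, Y t))\<close> t by (simp add: traj_def eq)
  qed
qed

text \<open>If \<open>v' \<ge> 0\<close> everywhere then \<open>v\<close> is bounded below, and since \<open>N > p\<close> the flux tends to
  \<open>-\<infinity>\<close>.\<close>

lemma solution_deriv_neg_somewhere:
  assumes sol: "solution N p s \<mu> q {R<..} v" and "R > 0"
  obtains r where "r > R" "deriv v r < 0"
proof (rule ccontr)
  assume "\<not> thesis"
  with that have nonneg: "deriv v r \<ge> 0" if "r > R" for r
    using that by fastforce
  define r0 where "r0 = R + 1"
  have "r0 > R" "r0 > 0" using \<open>R > 0\<close> by (auto simp: r0_def)
  have mono: "v r0 \<le> v r" if "r0 \<le> r" for r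
  proof (rule DERIV_nonneg_imp_nondecreasing[OF that])
    fix u assume "r0 \<le> u"
    then show "\<exists>y. (v has_real_derivative y) (at u) \<and> 0 \<le> y"
      using solutionD(2)[OF sol, of u] nonneg[of u] \<open>r0 > R\<close> by auto
  qed
  \<comment> \<open>K r^(N-p) is a primitive of \<mu> r^(N-1-p) v(r0)^(p-1), a lower bound for the
    decay of the flux while v \<ge> v(r0).\<close>
  define K where "K = \<mu> * v r0 powr (p - 1) / (N - p)"
  have v0: "v r0 > 0" using solutionD(1)[OF sol, of r0] \<open>r0 > R\<close> by simp
  have K: "K > 0" using v0 mu_pos N_gt_p by (simp add: K_def)
  have dec: "flux N p v r + K * r powr (N - p) \<le> flux N p v r0 + K * r0 powr (N - p)" if "r0 \<le> r" for r
  proof (rule DERIV_nonpos_imp_nonincreasing[OF that, where f = "\<lambda>r. flux N p v r + K * r powr (N - p)"])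
    fix u assume u: "r0 \<le> u" "u \<le> r"
    then have "u > R" "u > 0" using \<open>r0 > R\<close> \<open>R > 0\<close> by auto
    define D where "D = - (\<mu> * u powr (N - 1 - p) * v u powr (p - 1) + u powr (N - 1 + s) * v u powr q)
        + K * ((N - p) * u powr (N - 1 - p))"
    have "((\<lambda>r. r powr (N - p)) has_real_derivative (N - p) * u powr (N - 1 - p)) (at u)"
      using has_real_derivative_powr[OF \<open>u > 0\<close>, of "N - p"] by (simp add: algebra_simps)
    then have D: "((\<lambda>r. flux N p v r + K * r powr (N - p)) has_real_derivative D) (at u)"
      unfolding D_def using solutionD(3)[OF sol, of u] \<open>u > R\<close> \<open>u > 0\<close>
      by (intro DERIV_add DERIV_cmult) auto
    have "v r0 powr (p - 1) \<le> v u powr (p - 1)"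
      using mono[OF u(1)] v0 p_gt_1 by (intro powr_mono2) auto
    then have "\<mu> * u powr (N - 1 - p) * v r0 powr (p - 1) \<le> \<mu> * u powr (N - 1 - p) * v u powr (p - 1)"
      using mu_pos by (intro mult_left_mono) auto
    moreover have "K * ((N - p) * u powr (N - 1 - p)) = \<mu> * u powr (N - 1 - p) * v r0 powr (p - 1)"
      using N_gt_p by (simp add: K_def)
    moreover have "0 \<le> u powr (N - 1 + s) * v u powr q" by simp
    ultimately have "D \<le> 0"
      unfolding D_def by linarith
    with D show "\<exists>y. ((\<lambda>r. flux N p v r + K * r powr (N - p)) has_real_derivative y) (at u) \<and> y \<le> 0"
      by blast
  qed
  define Z where "Z = flux N p v r0 + K * r0 powr (N - p)"
  \<comment> \<open>The value of r^(N-p) at which the flux is at most Z - K M \<le> - K < 0; the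
    first entry ensures r \<ge> r0.\<close>
  define M where "M = max (r0 powr (N - p)) (Z / K + 1)"
  define r where "r = M powr (1 / (N - p))"
  have "M > 0" using \<open>r0 > 0\<close> by (simp add: M_def less_max_iff_disj)
  have "(r0 powr (N - p)) powr (1 / (N - p)) \<le> r"
    unfolding r_def using N_gt_p by (intro powr_mono2) (auto simp: M_def)
  then have "r0 \<le> r" using \<open>r0 > 0\<close> N_gt_p by (simp add: powr_powr)
  have "r powr (N - p) = M"
    using \<open>M > 0\<close> N_gt_p by (simp add: r_def powr_powr)
  then have "flux N p v r + K * M \<le> Z"
    using dec[OF \<open>r0 \<le> r\<close>] by (simp add: Z_def)
  moreover have "K * (Z / K + 1) \<le> K * M"
    using K by (intro mult_left_mono) (auto simp: M_def)
  ultimately have "flux N p v r < 0"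
    using K by (simp add: distrib_left)
  moreover have "r > R" "r > 0" using \<open>r0 \<le> r\<close> \<open>r0 > R\<close> \<open>R > 0\<close> by auto
  ultimately show False
    using solution_flux_neg nonneg[of r] by fastforce
qed

text \<open>The flux decreases, so once v' < 0 this persists, and from there on the trajectory lives
  on a half-line: its level is nonpositive and x > \<open>\<nu>m\<close>. Backwards in time x is
  continuous as long as v is defined, and it cannot descend to 0 without passing through (0,
  \<open>\<nu>m\<close>), where v' < 0 still holds and x > \<open>\<nu>m\<close> is violated. So v'
  < 0 on the whole interval.\<close>

lemma solution_orbit:
  assumes sol: "solution N p s \<mu> q {R<..} v" and "R > 0"
  shows "orbit_times R v = {ln R<..}" "traj {ln R<..} (orbit_point p s q v)"
    and "\<And>t. t > ln R \<Longrightarrow> H (orbit_point p s q v t) \<le> 0"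
proof -
  define J where "J = orbit_times R v"
  have R_exp: "R < exp t \<longleftrightarrow> ln R < t" for t
    using \<open>R > 0\<close> by (metis exp_less_cancel_iff exp_ln)
  have J_iff: "t \<in> J \<longleftrightarrow> t > ln R \<and> deriv v (exp t) < 0" for t
    by (simp add: J_def orbit_times_def R_exp)
  have exp_gt: "exp t > R" if "t > ln R" for t
    using that by (simp add: R_exp)
  have J_flux: "J = {ln R<..} \<inter> (\<lambda>t. flux N p v (exp t)) -` {..<0}"
    by (simp add: set_eq_iff J_iff solution_flux_neg)
  have "continuous_on {ln R<..} (\<lambda>t. flux N p v (exp t))"
  proof (rule DERIV_continuous_on)
    fix t assume "t \<in> {ln R<..}"
    then have "exp t \<in> {R<..}" using exp_gt by simp
    from has_field_derivative_at_within[OF DERIV_chain2[OF solutionD(3)[OF sol this] DERIV_exp]]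
    show "((\<lambda>t. flux N p v (exp t)) has_real_derivative
        - (\<mu> * exp t powr (N - 1 - p) * v (exp t) powr (p - 1) + exp t powr (N - 1 + s) * v (exp t) powr q) * exp t)
        (at t within {ln R<..})" .
  qed
  then have "open J"
    unfolding J_flux by (rule continuous_open_preimage) auto
  have traj_J: "traj J (orbit_point p s q v)"
    using \<open>open J\<close> exp_gt by (intro solution_traj[OF sol]) (auto simp: J_iff)
  have flux_dec: "flux N p v r' \<le> flux N p v r" if "R < r" "r \<le> r'" for r r'
  proof (rule DERIV_nonpos_imp_nonincreasing[OF that(2)])
    fix u assume "r \<le> u"
    then have "u > R" using that by simp
    have "0 \<le> \<mu> * u powr (N - 1 - p) * v u powr (p - 1) + u powr (N - 1 + s) * v u powr q"
      using mu_pos by (intro add_nonneg_nonneg mult_nonneg_nonneg) auto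
    then show "\<exists>y. (flux N p v has_real_derivative y) (at u) \<and> y \<le> 0"
      using solutionD(3)[OF sol, of u] \<open>u > R\<close> by (metis greaterThan_iff neg_le_0_iff_le)
  qed
  have up: "t' \<in> J" if "t \<in> J" "t \<le> t'" for t t'
  proof -
    have t: "t > ln R" "flux N p v (exp t) < 0" using that by (auto simp: J_flux)
    then show ?thesis using flux_dec[of "exp t" "exp t'"] exp_gt that by (auto simp: J_flux)
  qed
  have H_J: "H (orbit_point p s q v t) \<le> 0" if t: "t \<in> J" for t
  proof -
    obtain e where e: "e > 0" "ball t e \<subseteq> J"
      using openE[OF \<open>open J\<close> t] by blast
    \<comment> \<open>The exclusion of positive levels concerns times strictly inside a half-line,
      so the half-line has to start before t.\<close>
    then have "t - e / 2 \<in> J" by (auto simp: dist_real_def subset_iff)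
    then have "traj {t - e / 2<..} (orbit_point p s q v)"
      using up by (intro traj_subset[OF traj_J]) auto
    then show ?thesis
      by (rule half_line_H_nonpos) (use e in simp)
  qed
  have x_J: "\<nu>m < fst (orbit_point p s q v t)" if "t \<in> J" for t
    using H_nonpos_bounds(1)[OF _ H_J[OF that]] traj_J that by (simp add: traj_def)
  obtain r1 where r1: "r1 > R" "deriv v r1 < 0"
    using solution_deriv_neg_somewhere[OF sol \<open>R > 0\<close>] .
  define t1 where "t1 = ln r1"
  have t1: "t1 \<in> J"
    using r1 \<open>R > 0\<close> by (simp add: J_iff t1_def)
  have J_all: "t \<in> J" if "t > ln R" for t
  proof (rule ccontr)
    assume "t \<notin> J"
    then have "deriv v (exp t) \<ge> 0" using that by (simp add: J_iff)
    have "t \<le> t1" using up[OF t1] \<open>t \<notin> J\<close> by (metis linear)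
    have in_R: "exp u > R" if "u \<in> {t..t1}" for u
      using exp_gt that \<open>t > ln R\<close> by simp
    have C1: "v C1_differentiable_on {R<..}"
      using sol by (simp add: solution_def)
    have exp_cont: "continuous_on {t..t1} exp"
      by (intro continuous_on_exp continuous_on_id)
    have "continuous_on {t..t1} (\<lambda>u. - (exp u * deriv v (exp u) / v (exp u)))"
    proof (intro continuous_intros)
      show "continuous_on {t..t1} (\<lambda>u. deriv v (exp u))"
        using in_R by (intro continuous_on_compose2[OF C1_differentiable_on_real_deriv(2)[OF C1] exp_cont]) auto
      show "continuous_on {t..t1} (\<lambda>u. v (exp u))"
        using in_R by (intro continuous_on_compose2[OF C1_differentiable_imp_continuous_on[OF C1] exp_cont]) auto
      show "\<forall>u\<in>{t..t1}. v (exp u) \<noteq> 0"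
        using solutionD(1)[OF sol] in_R by fastforce
    qed
    then have "continuous_on {t..t1} (\<lambda>u. fst (orbit_point p s q v u))"
      by (simp add: orbit_point_eq)
    moreover have "fst (orbit_point p s q v t) \<le> 0"
      using \<open>deriv v (exp t) \<ge> 0\<close> solutionD(1)[OF sol, of "exp t"] exp_gt[OF that]
      by (simp add: orbit_point_eq)
    \<comment> \<open>Any value strictly between 0 and \<open>\<nu>m\<close> would do: it is
      positive, hence v' < 0 at u, yet it violates the lower bound for x.\<close>
    ultimately obtain u where u: "t \<le> u" "u \<le> t1" "fst (orbit_point p s q v u) = \<nu>m / 2"
      using IVT'[of "\<lambda>u. fst (orbit_point p s q v u)" t "\<nu>m / 2" t1] x_J[OF t1] \<open>t \<le> t1\<close> nu_pos
      by fastforce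
    have "fst (orbit_point p s q v u) > 0"
      unfolding u(3) using nu_pos(1) by (simp del: nu_pos)
    then have "deriv v (exp u) < 0"
      using solutionD(1)[OF sol, of "exp u"] in_R[of u] u
      by (auto simp: orbit_point_eq divide_less_0_iff mult_less_0_iff)
    then have "u \<in> J" using u that by (simp add: J_iff)
    then show False using x_J u nu_pos by fastforce
  qed
  then have "J = {ln R<..}" by (auto simp: J_iff)
  then show "orbit_times R v = {ln R<..}" "traj {ln R<..} (orbit_point p s q v)"
    "\<And>t. t > ln R \<Longrightarrow> H (orbit_point p s q v t) \<le> 0"
    using traj_J H_J by (auto simp: J_def)
qed

section \<open>The inverse passage: solving Y = r^(p+s) v^m for v along a complete
  trajectory\<close>

definition profile :: "(real \<Rightarrow> real \<times> real) \<Rightarrow> real \<Rightarrow> real" where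
  "profile \<gamma> r = exp ((ln (snd (\<gamma> (ln r))) - (p + s) * ln r) / m)"

lemma profile_eqI:
  assumes "v r > 0" "r > 0" "\<gamma> (ln r) = orbit_point p s q v (ln r)"
  shows "profile \<gamma> r = v r"
proof -
  have "ln (snd (\<gamma> (ln r))) = (p + s) * ln r + m * ln (v r)"
    using assms by (simp add: orbit_point_eq ln_mult ln_powr)
  then show ?thesis using assms by (simp add: profile_def)
qed

text \<open>The equation for Y says that r V' / V = - x for the \<open>profile\<close> V, so the
  orbit of V is the given trajectory. The flux then equals - r^(N-p) V^(p-1) x^(p-1), and the
  equation for x^(p-1) turns into the equation for V.\<close>

lemma traj_profile:
  assumes \<gamma>: "traj UNIV \<gamma>"
  shows "solution N p s \<mu> q {0<..} (profile \<gamma>)" "\<And>t. orbit_point p s q (profile \<gamma>) t = \<gamma> t"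
    and "\<And>r. r > 0 \<Longrightarrow> (profile \<gamma> has_real_derivative - (fst (\<gamma> (ln r)) * profile \<gamma> r / r)) (at r)"
    and "\<And>r. r > 0 \<Longrightarrow> deriv (profile \<gamma>) r < 0"
proof -
  define x Y where "x t = fst (\<gamma> t)" and "Y t = snd (\<gamma> t)" for t
  define V where "V = profile \<gamma>"
  note D = trajD[OF \<gamma> UNIV_I]
  have pos: "x t > 0" "Y t > 0" for t using D by (auto simp: x_def Y_def)
  have V_pos: "V r > 0" for r by (simp add: V_def profile_def)
  have V': "(V has_real_derivative - (x (ln r) * V r / r)) (at r)" if "r > 0" for r
  proof -
    have "((\<lambda>r. ln (snd (\<gamma> (ln r)))) has_real_derivative m * (a - x (ln r)) / r) (at r)"
    proof -
      have "((\<lambda>r. ln (snd (\<gamma> (ln r)))) has_real_derivative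
          1 / snd (\<gamma> (ln r)) * (m * snd (\<gamma> (ln r)) * (a - fst (\<gamma> (ln r))) * (1 / r))) (at r)"
        using that by (intro DERIV_chain2[of ln] DERIV_chain2[of "\<lambda>t. snd (\<gamma> t)"] D DERIV_ln_divide)
      then show ?thesis using pos[of "ln r"] by (simp add: x_def Y_def)
    qed
    then have "((\<lambda>r. exp ((ln (snd (\<gamma> (ln r))) - (p + s) * ln r) / m)) has_real_derivative
       exp ((ln (snd (\<gamma> (ln r))) - (p + s) * ln r) / m) * ((m * (a - x (ln r)) / r - (p + s) * (1 / r)) / m)) (at r)"
      using that by (intro DERIV_chain2[of exp] DERIV_cdivide DERIV_diff DERIV_cmult DERIV_ln_divide DERIV_exp)
    moreover have "(m * (a - x (ln r)) / r - (p + s) * (1 / r)) / m = - x (ln r) / r"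
      unfolding m_a[symmetric] using that by (simp add: field_simps)
    ultimately have "((\<lambda>r. exp ((ln (snd (\<gamma> (ln r))) - (p + s) * ln r) / m)) has_real_derivative
       exp ((ln (snd (\<gamma> (ln r))) - (p + s) * ln r) / m) * (- x (ln r) / r)) (at r)"
      by (simp only:)
    then show ?thesis
      unfolding V_def profile_def[abs_def] by (simp add: mult.commute)
  qed
  then show "\<And>r. r > 0 \<Longrightarrow> (profile \<gamma> has_real_derivative - (fst (\<gamma> (ln r)) * profile \<gamma> r / r)) (at r)"
    by (simp add: x_def V_def)
  have dV: "deriv V r = - (x (ln r) * V r / r)" if "r > 0" for r
    using DERIV_imp_deriv[OF V'[OF that]] .
  then show "\<And>r. r > 0 \<Longrightarrow> deriv (profile \<gamma>) r < 0"
    using pos V_pos by (simp add: V_def)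
  have Y_eq: "r powr (p + s) * V r powr m = Y (ln r)" if "r > 0" for r
  proof -
    have "V r powr m = exp (ln (Y (ln r)) - (p + s) * ln r)"
      by (simp add: V_def profile_def powr_def Y_def)
    then show ?thesis
      using pos[of "ln r"] that by (simp add: powr_def exp_diff)
  qed
  show "orbit_point p s q (profile \<gamma>) t = \<gamma> t" for t
    using V_pos[of "exp t"] Y_eq[of "exp t"]
    by (simp add: orbit_point_eq prod_eq_iff dV[of "exp t", unfolded V_def] x_def Y_def V_def)
  have flux_eq: "flux N p V r = - (r powr (N - p) * V r powr (p - 1) * x (ln r) powr (p - 1))" if "r > 0" for r
  proof -
    have "deriv V r < 0" using dV[OF that] pos V_pos that by simp
    then have "flux N p V r = - (r powr (N - 1) * (x (ln r) * V r / r) powr (p - 1))"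
      by (simp add: flux_eq_of_neg dV[OF that])
    also have "(x (ln r) * V r / r) powr (p - 1) = x (ln r) powr (p - 1) * V r powr (p - 1) / r powr (p - 1)"
      using that pos[of "ln r"] V_pos[of r] by (simp add: powr_mult powr_divide less_imp_le)
    also have "r powr (N - 1) * (x (ln r) powr (p - 1) * V r powr (p - 1) / r powr (p - 1))
      = (r powr (N - 1) / r powr (p - 1)) * V r powr (p - 1) * x (ln r) powr (p - 1)"
      by simp
    also have "r powr (N - 1) / r powr (p - 1) = r powr (N - p)"
      by (simp flip: powr_diff)
    finally show ?thesis .
  qed
  define rhs where "rhs r = \<mu> * r powr (N - 1 - p) * V r powr (p - 1) + r powr (N - 1 + s) * V r powr q" for r
  have flux': "(flux N p V has_real_derivative - rhs r) (at r)" if "r > 0" for r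
  proof -
    define y where "y = x (ln r) powr (p - 1)"
    have 1: "((\<lambda>r. x (ln r) powr (p - 1)) has_real_derivative (\<mu> + Y (ln r) - h (x (ln r))) * (1 / r)) (at r)"
      unfolding x_def Y_def using that
      by (intro DERIV_chain2[of "\<lambda>t. fst (\<gamma> t) powr (p - 1)"] traj_powr_deriv[OF \<gamma>] DERIV_ln_divide) auto
    have 2: "((\<lambda>r. V r powr (p - 1)) has_real_derivative
        (p - 1) * V r powr (p - 1 - 1) * (- (x (ln r) * V r / r))) (at r)"
      by (intro DERIV_chain2[OF has_real_derivative_powr] V' V_pos that)
    have "c * w * (- (x (ln r) * V r / r)) = - c * (x (ln r) / r) * (V r * w)" for c w
      by simp
    then have "(p - 1) * V r powr (p - 1 - 1) * (- (x (ln r) * V r / r)) = - (p - 1) * (x (ln r) / r) * (V r * V r powr (p - 1 - 1))" .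
    also have "V r * V r powr (p - 1 - 1) = V r powr (p - 1)"
      using V_pos[of r] by (simp add: powr_mult_base less_imp_le)
    finally have 2: "((\<lambda>r. V r powr (p - 1)) has_real_derivative - (p - 1) * (x (ln r) / r) * V r powr (p - 1)) (at r)"
      using 2 by (simp only:)
    have "r powr (N - p) = r * r powr (N - p - 1)"
      using that by (simp add: powr_mult_base)
    then have 3: "((\<lambda>r. r powr (N - p)) has_real_derivative (N - p) * (r powr (N - p) / r)) (at r)"
      using has_real_derivative_powr[OF that, of "N - p"] that by simp
    have "((\<lambda>r. - (r powr (N - p) * V r powr (p - 1) * x (ln r) powr (p - 1))) has_real_derivative
      - (((N - p) * (r powr (N - p) / r) * V r powr (p - 1) + - (p - 1) * (x (ln r) / r) * V r powr (p - 1) * r powr (N - p)) * y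
        + (\<mu> + Y (ln r) - h (x (ln r))) * (1 / r) * (r powr (N - p) * V r powr (p - 1)))) (at r)"
      unfolding y_def by (intro DERIV_minus DERIV_mult 1 2 3)
    \<comment> \<open>The terms (N - p) y and - (p - 1) x y add up to h x and cancel the - h x of
      the trajectory.\<close>
    also have "((N - p) * (r powr (N - p) / r) * V r powr (p - 1) + - (p - 1) * (x (ln r) / r) * V r powr (p - 1) * r powr (N - p)) * y
        + (\<mu> + Y (ln r) - h (x (ln r))) * (1 / r) * (r powr (N - p) * V r powr (p - 1))
       = r powr (N - p) / r * V r powr (p - 1) * (\<mu> + Y (ln r))"
      unfolding hfun_def y_def[symmetric] using that by (simp add: field_simps)
    also have "\<dots> = rhs r"
    proof -
      have a: "r powr (N - p) / r = r powr (N - 1 - p)"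
        using that powr_diff[of r "N - p" 1] by (simp add: algebra_simps)
      have b: "V r powr q = V r powr (p - 1) * V r powr m"
        using powr_add[of "V r" "p - 1" m] by (simp add: m_def)
      have c: "r powr (N - 1 + s) = r powr (N - 1 - p) * r powr (p + s)"
        using powr_add[of r "N - 1 - p" "p + s"] by (simp add: algebra_simps)
      show ?thesis
        unfolding rhs_def a b c Y_eq[OF that, symmetric] by (simp add: algebra_simps)
    qed
    finally show ?thesis
      by (rule has_field_derivative_transform_within_open[of _ _ _ "{0<..}"])
        (use that flux_eq in auto)
  qed
  have cont_x: "continuous_on {0<..} (\<lambda>r. x (ln r))"
    unfolding x_def
    by (intro continuous_on_compose2[OF traj_continuous_on[OF \<gamma>]] continuous_intros) auto
  have cont_V: "continuous_on {0<..} V"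
    by (rule DERIV_continuous_on) (auto intro: has_field_derivative_at_within V')
  have V_nz: "V r \<noteq> 0" for r using V_pos[of r] by simp
  have "V C1_differentiable_on {0<..}"
    by (rule C1_differentiable_on_realI[OF V']) (auto intro!: continuous_intros cont_x cont_V)
  moreover have "flux N p V C1_differentiable_on {0<..}"
    unfolding rhs_def
    by (rule C1_differentiable_on_realI[OF flux'])
      (auto simp: rhs_def[abs_def] V_nz intro!: continuous_intros cont_V)
  moreover have "- deriv (flux N p V) r = rhs r" if "r > 0" for r
    using DERIV_imp_deriv[OF flux'[OF that]] by simp
  ultimately show "solution N p s \<mu> q {0<..} (profile \<gamma>)"
    using V_pos by (simp add: solution_def rhs_def flip: V_def)
qed

lemma solution_subset: "solution N p s \<mu> q I v \<Longrightarrow> J \<subseteq> I \<Longrightarrow> solution N p s \<mu> q J v"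
  by (auto simp: solution_def intro: C1_differentiable_on_subset)

end

section \<open>Monotone and periodic functions\<close>

lemma tendsto_at_top_of_mono_bounded:
  fixes f :: "real \<Rightarrow> real"
  assumes mono: "\<And>s t. c < s \<Longrightarrow> s \<le> t \<Longrightarrow> f s \<le> f t" and bound: "\<And>t. t > c \<Longrightarrow> f t \<le> B"
  shows "\<exists>l. (f \<longlongrightarrow> l) at_top"
proof (intro exI order_tendstoI)
  have bdd: "bdd_above (f ` {c<..})" using bound by (auto intro!: bdd_aboveI[of _ B])
  have ne: "f ` {c<..} \<noteq> {}" by auto
  fix y
  show "eventually (\<lambda>t. y < f t) at_top" if y: "y < Sup (f ` {c<..})"
  proof -
    obtain s where "s > c" "y < f s"
      using y unfolding less_cSup_iff[OF ne bdd] by auto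
    then have "y < f t" if "t \<ge> s" for t using mono[of s t] that by simp
    then show ?thesis by (auto simp: eventually_at_top_linorder)
  qed
  show "eventually (\<lambda>t. f t < y) at_top" if "Sup (f ` {c<..}) < y"
  proof -
    have "f t < y" if "t > c" for t
      using cSup_upper[OF _ bdd, of "f t"] that \<open>Sup (f ` {c<..}) < y\<close> by fastforce
    then show ?thesis
      using eventually_gt_at_top[of c] by (rule eventually_mono[rotated])
  qed
qed

lemma tendsto_at_top_of_deriv_sign:
  fixes f :: "real \<Rightarrow> real"
  assumes deriv: "\<And>t. t > c \<Longrightarrow> (f has_real_derivative f' t) (at t)"
    and bound: "\<And>t. t > c \<Longrightarrow> \<bar>f t\<bar> \<le> B"
    and sign: "(\<forall>t>c. f' t \<ge> 0) \<or> (\<forall>t>c. f' t \<le> 0)"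
  shows "\<exists>l. (f \<longlongrightarrow> l) at_top"
  using sign
proof
  assume *: "\<forall>t>c. f' t \<ge> 0"
  show ?thesis
  proof (rule tendsto_at_top_of_mono_bounded[of c])
    show "f s \<le> f t" if "c < s" "s \<le> t" for s t
    proof (rule DERIV_nonneg_imp_nondecreasing[OF that(2)])
      fix u assume "s \<le> u"
      then show "\<exists>y. (f has_real_derivative y) (at u) \<and> 0 \<le> y"
        using * deriv[of u] that(1) by auto
    qed
    show "f t \<le> B" if "t > c" for t using bound[OF that] by simp
  qed
next
  assume *: "\<forall>t>c. f' t \<le> 0"
  have "\<exists>l. ((\<lambda>t. - f t) \<longlongrightarrow> l) at_top"
  proof (rule tendsto_at_top_of_mono_bounded[of c])
    show "- f s \<le> - f t" if "c < s" "s \<le> t" for s t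
      unfolding neg_le_iff_le
    proof (rule DERIV_nonpos_imp_nonincreasing[OF that(2)])
      fix u assume "s \<le> u"
      then show "\<exists>y. (f has_real_derivative y) (at u) \<and> y \<le> 0"
        using * deriv[of u] that(1) by auto
    qed
    show "- f t \<le> B" if "t > c" for t using bound[OF that] by simp
  qed
  then show ?thesis using tendsto_minus_cancel_left by blast
qed

lemma periodic_nat:
  fixes f :: "real \<Rightarrow> 'a"
  assumes "\<And>t. f (t + T) = f t"
  shows "f (t + real n * T) = f t"
proof (induction n)
  case (Suc n)
  then show ?case using assms[of "t + real n * T"] by (simp add: algebra_simps)
qed simp

lemma periodic_representative:
  fixes f :: "real \<Rightarrow> 'a"
  assumes "\<And>t. f (t + T) = f t" "T > 0"
  obtains u where "c \<le> u" "u \<le> c + T" "f u = f t"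
proof (cases "t \<ge> c")
  case True
  define n where "n = nat \<lfloor>(t - c) / T\<rfloor>"
  have n: "real n = of_int \<lfloor>(t - c) / T\<rfloor>" using True assms by (simp add: n_def)
  have "real n \<le> (t - c) / T" "(t - c) / T \<le> real n + 1"
    unfolding n by linarith+
  then have "real n * T \<le> t - c" "t - c \<le> (real n + 1) * T"
    using assms by (simp_all add: pos_le_divide_eq pos_divide_le_eq)
  then show thesis
    using periodic_nat[of f T "t - real n * T" n, OF assms(1)]
    by (intro that[of "t - real n * T"]) (auto simp: algebra_simps)
next
  case False
  define n where "n = nat \<lceil>(c - t) / T\<rceil>"
  have "(c - t) / T > 0" using False assms by simp
  then have n: "real n = of_int \<lceil>(c - t) / T\<rceil>" by (simp add: n_def)
  have "(c - t) / T \<le> real n" "real n \<le> (c - t) / T + 1"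
    unfolding n by linarith+
  then have "c - t \<le> real n * T" "real n * T \<le> c - t + T"
    using assms by (simp_all add: field_simps)
  then show thesis
    using periodic_nat[of f T t n, OF assms(1)] by (intro that[of "t + real n * T"]) auto
qed

lemma periodic_attains_min:
  fixes f :: "real \<Rightarrow> real"
  assumes per: "\<And>t. f (t + T) = f t" "T > 0" and "continuous_on UNIV f"
  obtains u where "\<And>t. f u \<le> f t"
proof -
  have "continuous_on {0..T} f"
    using assms(3) by (rule continuous_on_subset) simp
  then obtain u where u: "\<forall>t\<in>{0..T}. f u \<le> f t"
    using continuous_attains_inf[of "{0..T}" f] per(2) by auto
  have "f u \<le> f t" for t
  proof -
    obtain w where "0 \<le> w" "w \<le> 0 + T" "f w = f t"
      by (rule periodic_representative[where f = f and T = T and c = 0 and t = t]) (use per in auto)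
    then show ?thesis using u by (metis add_0 atLeastAtMost_iff)
  qed
  then show thesis by (rule that)
qed

text \<open>The minimum is a lower bound everywhere, and by periodicity it is attained again at
  arbitrarily large ln r.\<close>

lemma Liminf_periodic_ln:
  fixes f :: "real \<Rightarrow> real"
  assumes per: "\<And>t. f (t + T) = f t" "T > 0" and min: "\<And>t. f u \<le> f t"
  shows "Liminf at_top (\<lambda>r. ereal (f (ln r))) = ereal (f u)"
proof (rule antisym)
  show "ereal (f u) \<le> Liminf at_top (\<lambda>r. ereal (f (ln r)))"
    using min by (intro Liminf_bounded) simp
  show "Liminf at_top (\<lambda>r. ereal (f (ln r))) \<le> ereal (f u)"
  proof (rule ccontr)
    assume "\<not> ?thesis"
    then have "eventually (\<lambda>r. ereal (f u) < ereal (f (ln r))) at_top"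
      using less_LiminfD by (metis not_le)
    then obtain R where R: "\<And>r. r \<ge> R \<Longrightarrow> f u < f (ln r)"
      by (auto simp: eventually_at_top_linorder)
    obtain w where w: "ln (max R 1) \<le> w" "f w = f u"
      by (rule periodic_representative[where f = f and T = T and c = "ln (max R 1)" and t = u])
        (use per in auto)
    then have "max R 1 \<le> exp w" by (metis exp_le_cancel_iff exp_ln less_max_iff_disj zero_less_one)
    then show False using R[of "exp w"] w(2) by simp
  qed
qed

lemma periodic_limits:
  fixes f :: "real \<Rightarrow> real"
  assumes per: "\<And>t. f (t + T) = f t" "T > 0" and cont: "continuous_on UNIV f"
    and "\<not> f constant_on UNIV"
  obtains t1 t2 where "f t1 \<noteq> f t2"
    "Liminf at_top (\<lambda>r. ereal (f (ln r))) = ereal (f t1)"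
    "Limsup at_top (\<lambda>r. ereal (f (ln r))) = ereal (f t2)"
proof -
  obtain t1 where t1: "\<And>t. f t1 \<le> f t"
    using periodic_attains_min[OF per cont] by blast
  have per': "- f (t + T) = - f t" for t using per(1) by simp
  obtain t2 where t2: "\<And>t. - f t2 \<le> - f t"
    using periodic_attains_min[of "\<lambda>t. - f t", OF per' per(2)] cont continuous_on_minus by blast
  have "Liminf at_top (\<lambda>r. - ereal (f (ln r))) = - ereal (f t2)"
    using Liminf_periodic_ln[of "\<lambda>t. - f t", OF per' per(2) t2] by simp
  then have "Limsup at_top (\<lambda>r. ereal (f (ln r))) = ereal (f t2)"
    unfolding ereal_Liminf_uminus by (metis ereal_uminus_uminus)
  moreover have "f t1 \<noteq> f t2"
  proof
    assume "f t1 = f t2"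
    then have "f t = f t1" for t using t1[of t] t2[of t] by simp
    then show False using assms(4) by (auto simp: constant_on_def)
  qed
  ultimately show thesis
    using Liminf_periodic_ln[OF per t1] by (intro that)
qed

text \<open>A translation by T multiplies r^a v, written in t = ln r, by exp ((a - b) T). A positive
  limit forces this factor to be 1, so a = b, and then a convergent periodic function would have to
  be constant.\<close>

lemma periodic_no_exact_decay_rate:
  fixes f :: "real \<Rightarrow> real"
  assumes per: "\<And>t. f (t + T) = f t" "T > 0" and nonconst: "\<not> f constant_on UNIV"
    and v: "\<And>r. r > R \<Longrightarrow> r powr b * v r = f (ln r)"
  shows "no_exact_decay_rate v"
  unfolding no_exact_decay_rate_def
proof
  assume "\<exists>a c. 0 < c \<and> ((\<lambda>r. r powr a * v r) \<longlongrightarrow> c) at_top"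
  then obtain a c where c: "c > 0" "((\<lambda>r. r powr a * v r) \<longlongrightarrow> c) at_top" by blast
  define g where "g t = exp ((a - b) * t) * f t" for t
  have "((\<lambda>t. exp t powr a * v (exp t)) \<longlongrightarrow> c) at_top"
    using filterlim_compose[OF c(2) exp_at_top] .
  moreover have "eventually (\<lambda>t. exp t powr a * v (exp t) = g t) at_top"
    using filterlim_at_top_dense[THEN iffD1, OF exp_at_top, rule_format, of R]
  proof (eventually_elim)
    case (elim t)
    have "exp t powr a = exp ((a - b) * t) * exp t powr b"
      by (simp add: powr_def algebra_simps flip: exp_add)
    then show ?case using v[of "exp t"] elim by (simp add: g_def)
  qed
  ultimately have g: "(g \<longlongrightarrow> c) at_top"
    by (simp cong: tendsto_cong)
  have gT: "((\<lambda>t. g (t + T)) \<longlongrightarrow> c) at_top"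
    by (rule filterlim_compose[OF g])
      (use filterlim_tendsto_add_at_top[OF tendsto_const[of T] filterlim_ident] in \<open>simp add: add.commute\<close>)
  have shift: "g (t + T) = exp ((a - b) * T) * g t" for t
    unfolding g_def per(1) by (simp add: distrib_left exp_add)
  have "((\<lambda>t. g (t + T)) \<longlongrightarrow> exp ((a - b) * T) * c) at_top"
    unfolding shift by (rule tendsto_mult_left[OF g])
  from tendsto_unique[OF trivial_limit_at_top_linorder this gT]
  have "exp ((a - b) * T) * c = c" .
  then have "a = b" using c(1) per(2) by simp
  then have f: "(f \<longlongrightarrow> c) at_top" using g by (simp add: g_def[abs_def])
  have "f t = c" for t
  proof -
    have const: "f (t + real n * T) = f t" for n
      by (rule periodic_nat) (rule per(1))
    have "((\<lambda>n. f (t + real n * T)) \<longlongrightarrow> c) sequentially"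
    proof (rule filterlim_compose[OF f])
      have "filterlim (\<lambda>n. T * real n) at_top sequentially"
        using per(2) by (intro filterlim_tendsto_pos_mult_at_top[OF tendsto_const]) (auto simp: filterlim_real_sequentially)
      then show "filterlim (\<lambda>n. t + real n * T) at_top sequentially"
        by (simp add: filterlim_tendsto_add_at_top[OF tendsto_const] mult.commute)
    qed
    then show ?thesis unfolding const by (simp add: LIMSEQ_const_iff)
  qed
  then show False using nonconst by (auto simp: constant_on_def)
qed

section \<open>Levels between \<open>\<H>(P_*)\<close> and zero\<close>

context critical
begin

lemma isCont_H: "z \<in> quadrant \<Longrightarrow> isCont H z"
proof -
  have "quadrant = {0<..} \<times> {0<..}" by auto
  then have "open quadrant" by (simp add: open_Times)
  then show "z \<in> quadrant \<Longrightarrow> isCont H z"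
    using continuous_on_H continuous_on_eq_continuous_at by blast
qed

text \<open>The limit of a convergent trajectory is an equilibrium, and \<open>Pstar\<close> is the
  only one in the open quadrant. Continuity carries the constant value of \<open>H\<close> over to
  it.\<close>

lemma traj_limit_Pstar:
  assumes "traj UNIV \<gamma>" "((\<lambda>t. fst (\<gamma> t)) \<longlongrightarrow> x0) at_top" "((\<lambda>t. snd (\<gamma> t)) \<longlongrightarrow> y0) at_top"
    and "x0 > 0" "y0 > 0"
  shows "H (\<gamma> t) = H Pstar"
proof -
  note D = trajD[OF assms(1) UNIV_I]
  have "m * y0 * (a - x0) = 0"
    by (rule tendsto_derivative_limit_eq_0[OF D(4) assms(3)]) (intro tendsto_intros assms)
  then have "x0 = a" using assms(5) by simp
  have "x0 powr (2 - p) / (p - 1) * (\<mu> + y0 - h x0) = 0"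
    by (rule tendsto_derivative_limit_eq_0[OF D(3) assms(2)])
      (use p_gt_1 assms(4) in \<open>intro tendsto_intros assms(2,3), auto\<close>)
  then have "y0 = Ystar" using p_gt_1 assms(4) \<open>x0 = a\<close> by (simp add: Ystar_eq h_a)
  have "(\<gamma> \<longlongrightarrow> Pstar) at_top"
    using tendsto_Pair[OF assms(2,3)] by (simp add: Pstar_eq \<open>x0 = a\<close> \<open>y0 = Ystar\<close>)
  then have "((\<lambda>t. H (\<gamma> t)) \<longlongrightarrow> H Pstar) at_top"
    by (rule isCont_tendsto_compose[rotated]) (auto intro!: isCont_H simp: Pstar_eq)
  moreover have "(\<lambda>u. H (\<gamma> u)) = (\<lambda>u. H (\<gamma> t))"
    using traj_H_const[OF assms(1), of _ t] by auto
  ultimately have "((\<lambda>u :: real. H (\<gamma> t)) \<longlongrightarrow> H Pstar) at_top" by (simp only:)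
  then show ?thesis by (simp add: tendsto_const_iff)
qed

text \<open>If \<open>x\<close> stayed on one side of \<open>a\<close>, then \<open>Y\<close> would be monotone; on a negative level
  the sign of \<open>x'\<close> is that of an increasing function of \<open>Y\<close>, so \<open>x\<close> would be eventually
  monotone as well and the trajectory would converge to an equilibrium.\<close>

lemma traj_returns:
  assumes \<gamma>: "traj UNIV \<gamma>" and "H (\<gamma> 0) = \<kappa>" "\<kappa> < 0" "\<kappa> \<noteq> H Pstar"
  obtains t where "t > t0" "fst (\<gamma> t) = a"
proof (rule ccontr)
  assume "\<not> thesis"
  with that have ne: "fst (\<gamma> t) \<noteq> a" if "t > t0" for t using that by blast
  define x Y where "x t = fst (\<gamma> t)" and "Y t = snd (\<gamma> t)" for t
  note D = trajD[OF \<gamma> UNIV_I, folded x_def Y_def]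
  have quad: "\<gamma> t \<in> quadrant" for t using \<gamma> by (simp add: traj_def)
  have level: "H (\<gamma> t) = \<kappa>" for t
    using traj_H_const[OF \<gamma>, of t 0] assms(2) by simp
  have bounds: "\<nu>m < x t" "x t < \<nu>p" "Y t \<le> (\<beta> + 1) / \<beta> * Ystar" for t
    using H_nonpos_bounds[OF quad, of t] level[of t] \<open>\<kappa> < 0\<close> by (auto simp: x_def Y_def)
  obtain y0 where "y0 > 0" and y0': "\<And>z. z \<in> quadrant \<Longrightarrow> H z \<le> \<kappa> \<Longrightarrow> y0 \<le> snd z"
    by (rule level_lower_bound[OF \<open>\<kappa> < 0\<close>]) blast
  have y0: "y0 > 0" "y0 \<le> Y t" for t
    using \<open>y0 > 0\<close> y0'[OF quad] level by (auto simp: Y_def)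
  have contx: "continuous_on UNIV x"
    using traj_continuous_on[OF \<gamma>] unfolding x_def by (intro continuous_intros)
  have side: "(\<forall>t>t0. x t < a) \<or> (\<forall>t>t0. x t > a)"
  proof (rule ccontr)
    assume "\<not> ?thesis"
    then obtain t u where tu: "t > t0" "x t > a" "u > t0" "x u < a"
      using ne unfolding x_def by (metis linorder_neqE_linordered_idom)
    have "connected (x ` {t0<..})"
      by (intro connected_continuous_image continuous_on_subset[OF contx]) auto
    from connectedD_interval[OF this, of "x u" "x t" a] have "a \<in> x ` {t0<..}"
      using tu by simp
    then obtain w where "w > t0" "x w = a" by auto
    then show False using ne[of w] by (simp add: x_def)
  qed
  have sgnY: "(\<forall>t>t0. m * Y t * (a - x t) \<ge> 0) \<or> (\<forall>t>t0. m * Y t * (a - x t) \<le> 0)"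
    using side
  proof
    assume "\<forall>t>t0. x t < a"
    then have "\<forall>t>t0. m * Y t * (a - x t) \<ge> 0" using D(2) by (simp add: less_imp_le)
    then show ?thesis ..
  next
    assume "\<forall>t>t0. x t > a"
    then have "\<forall>t>t0. m * Y t * (a - x t) \<le> 0" using D(2) by (auto intro!: mult_nonneg_nonpos simp: less_imp_le)
    then show ?thesis ..
  qed
  have "\<exists>l. (Y \<longlongrightarrow> l) at_top"
    by (rule tendsto_at_top_of_deriv_sign[OF D(4) _ sgnY, of "(\<beta> + 1) / \<beta> * Ystar"])
      (use bounds(3) D(2) in \<open>simp add: abs_of_pos\<close>)
  then obtain yl where yl: "(Y \<longlongrightarrow> yl) at_top" by blast
  have "yl \<ge> y0"
    using tendsto_lowerbound[OF yl] y0(2) by simp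
  \<comment> \<open>\<open>d\<close> has the sign of x'. By \<open>level_drive\<close> it is a
    function of Y alone, increasing because \<kappa> < 0.\<close>
  define d where "d t = \<mu> + Y t - h (x t)" for t
  have d_mono: "d s \<le> d t" if "Y s \<le> Y t" for s t
  proof -
    have d: "d t = Y t / (\<beta> + 1) - \<beta> * (p - 1) * (- \<kappa>) / Y t powr \<beta>" for t
      using level_drive[of "Y t" "x t"] D(2)[of t] level[of t] by (simp add: d_def x_def Y_def)
    have "Y s powr \<beta> \<le> Y t powr \<beta>"
      using that D(2)[of s] by (intro powr_mono2) (auto simp: less_imp_le)
    then have "\<beta> * (p - 1) * (- \<kappa>) / Y t powr \<beta> \<le> \<beta> * (p - 1) * (- \<kappa>) / Y s powr \<beta>"
      using p_gt_1 \<open>\<kappa> < 0\<close> D(2)[of s] D(2)[of t]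
      by (intro divide_left_mono mult_nonneg_nonneg mult_pos_pos) (auto simp: less_imp_le)
    moreover have "Y s / (\<beta> + 1) \<le> Y t / (\<beta> + 1)"
      using that by (intro divide_right_mono) (auto simp: less_imp_le)
    ultimately show ?thesis unfolding d by linarith
  qed
  have Y_mono: "(\<forall>s>t0. \<forall>t\<ge>s. Y s \<le> Y t) \<or> (\<forall>s>t0. \<forall>t\<ge>s. Y t \<le> Y s)"
    using sgnY
  proof
    assume *: "\<forall>t>t0. m * Y t * (a - x t) \<ge> 0"
    have "Y s \<le> Y t" if "s > t0" "t \<ge> s" for s t
      by (rule DERIV_nonneg_imp_nondecreasing[OF that(2)]) (use * D(4) that in fastforce)
    then show ?thesis by blast
  next
    assume *: "\<forall>t>t0. m * Y t * (a - x t) \<le> 0"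
    have "Y t \<le> Y s" if "s > t0" "t \<ge> s" for s t
      by (rule DERIV_nonpos_imp_nonincreasing[OF that(2)]) (use * D(4) that in fastforce)
    then show ?thesis by blast
  qed
  \<comment> \<open>Since Y is monotone beyond t0, so is \<open>d\<close>; hence it has a constant
    sign eventually.\<close>
  have "\<exists>c. (\<forall>t>c. d t \<ge> 0) \<or> (\<forall>t>c. d t \<le> 0)"
    using Y_mono
  proof
    assume mono: "\<forall>s>t0. \<forall>t\<ge>s. Y s \<le> Y t"
    show ?thesis
    proof (cases "\<exists>s>t0. d s \<ge> 0")
      case True
      then obtain s where "s > t0" "d s \<ge> 0" by blast
      then have "d t \<ge> 0" if "t > s" for t using mono d_mono[of s t] that by auto
      then show ?thesis by blast
    next
      case False
      then have "\<forall>t>t0. d t \<le> 0" by (simp add: not_le less_imp_le)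
      then show ?thesis by blast
    qed
  next
    assume mono: "\<forall>s>t0. \<forall>t\<ge>s. Y t \<le> Y s"
    show ?thesis
    proof (cases "\<exists>s>t0. d s \<le> 0")
      case True
      then obtain s where "s > t0" "d s \<le> 0" by blast
      then have "d t \<le> 0" if "t > s" for t using mono d_mono[of t s] that by auto
      then show ?thesis by blast
    next
      case False
      then have "\<forall>t>t0. d t \<ge> 0" by (simp add: not_le less_imp_le)
      then show ?thesis by blast
    qed
  qed
  then obtain c where c: "(\<forall>t>c. d t \<ge> 0) \<or> (\<forall>t>c. d t \<le> 0)" by blast
  have pw: "x t powr (2 - p) / (p - 1) \<ge> 0" for t using p_gt_1 by simp
  have "\<exists>l. (x \<longlongrightarrow> l) at_top"
  proof (rule tendsto_at_top_of_deriv_sign[OF D(3)])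
    show "\<bar>x t\<bar> \<le> \<nu>p" for t using bounds[of t] D(1)[of t] by simp
    show "(\<forall>t>c. 0 \<le> x t powr (2 - p) / (p - 1) * (\<mu> + Y t - h (x t))) \<or>
      (\<forall>t>c. x t powr (2 - p) / (p - 1) * (\<mu> + Y t - h (x t)) \<le> 0)"
      using c pw unfolding d_def by (meson mult_nonneg_nonneg mult_nonneg_nonpos)
  qed
  then obtain xl where xl: "(x \<longlongrightarrow> xl) at_top" by blast
  have "xl \<ge> \<nu>m"
    using tendsto_lowerbound[OF xl] bounds(1) by (simp add: less_imp_le)
  have "H (\<gamma> 0) = H Pstar"
    by (rule traj_limit_Pstar[OF \<gamma> xl[unfolded x_def] yl[unfolded Y_def]])
      (use \<open>xl \<ge> \<nu>m\<close> nu_pos(1) \<open>yl \<ge> y0\<close> \<open>y0 > 0\<close> in linarith)+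
  then show False using assms by simp
qed

lemma H_a_same_side:
  assumes "Y > 0" "Y' > 0" "H (a, Y) = H (a, Y')" "Y < Ystar \<longleftrightarrow> Y' < Ystar"
  shows "Y = Y'"
proof (cases "Y < Ystar")
  case True
  then show ?thesis
    using assms H_a_strict_antimono[of Y Y'] H_a_strict_antimono[of Y' Y]
    by (cases Y Y' rule: linorder_cases) auto
next
  case False
  then show ?thesis
    using assms H_a_strict_mono[of Y Y'] H_a_strict_mono[of Y' Y]
    by (cases Y Y' rule: linorder_cases) auto
qed

text \<open>The line \<open>x = a\<close> meets a level in at most two points, so among three visits to it two
  coincide.\<close>

lemma traj_periodic:
  assumes \<gamma>: "traj UNIV \<gamma>" and "H (\<gamma> 0) = \<kappa>" "\<kappa> < 0" "\<kappa> \<noteq> H Pstar"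
  obtains T where "T > 0" "\<And>t. \<gamma> (t + T) = \<gamma> t"
proof -
  note ret = traj_returns[OF assms]
  obtain t1 where t1: "fst (\<gamma> t1) = a" using ret[of 0] by blast
  obtain t2 where t2: "t2 > t1" "fst (\<gamma> t2) = a" using ret[of t1] by blast
  obtain t3 where t3: "t3 > t2" "fst (\<gamma> t3) = a" using ret[of t2] by blast
  have same: "\<gamma> t = \<gamma> u"
    if "fst (\<gamma> t) = a" "fst (\<gamma> u) = a" "snd (\<gamma> t) < Ystar \<longleftrightarrow> snd (\<gamma> u) < Ystar" for t u
  proof -
    have "H (a, snd (\<gamma> t)) = H (a, snd (\<gamma> u))"
      using traj_H_const[OF \<gamma>, of t u] that by (metis UNIV_I is_interval_univ prod.collapse)
    then have "snd (\<gamma> t) = snd (\<gamma> u)"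
      using H_a_same_side that(3) trajD(2)[OF \<gamma> UNIV_I] by blast
    then show ?thesis using that by (simp add: prod_eq_iff)
  qed
  obtain t u where tu: "t < u" "\<gamma> t = \<gamma> u"
    using same[OF t1 t2(2)] same[OF t2(2) t3(2)] same[OF t1 t3(2)] t2(1) t3(1) by fastforce
  define T where "T = u - t"
  have le: "H (\<gamma> s) \<le> 0" for s
    using traj_H_const[OF \<gamma>, of s 0] assms by simp
  have "\<gamma> (s + T) = \<gamma> s" for s
    by (rule traj_unique[OF traj_shift[OF \<gamma>, of T] \<gamma>, of t s])
      (use tu le in \<open>auto simp: T_def\<close>)
  then show thesis using tu by (intro that[of T]) (auto simp: T_def)
qed

section \<open>Each negative level other than the minimum is a single closed orbit\<close>

lemma traj_constant_x:
  assumes \<gamma>: "traj UNIV \<gamma>" and "\<And>t. fst (\<gamma> t) = a"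
  shows "\<gamma> t = Pstar"
proof -
  have "((\<lambda>t. fst (\<gamma> t)) has_real_derivative 0) (at t)"
    by (simp add: assms(2))
  from DERIV_unique[OF this trajD(3)[OF \<gamma> UNIV_I]]
  have "\<mu> + snd (\<gamma> t) - h a = 0"
    using p_gt_1 a_pos by (simp add: assms(2) del: a_pos)
  then have "snd (\<gamma> t) = Ystar" by (simp add: h_a Ystar_eq)
  then show ?thesis by (simp add: Pstar_eq prod_eq_iff assms(2))
qed

lemma traj_not_constant_Y:
  assumes \<gamma>: "traj UNIV \<gamma>" and "H (\<gamma> 0) \<noteq> H Pstar"
  shows "\<not> (\<lambda>t. snd (\<gamma> t)) constant_on UNIV"
proof
  assume "(\<lambda>t. snd (\<gamma> t)) constant_on UNIV"
  then obtain c where c: "\<And>t. snd (\<gamma> t) = c" by (auto simp: constant_on_def)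
  have "fst (\<gamma> t) = a" for t
  proof -
    have "((\<lambda>t. snd (\<gamma> t)) has_real_derivative 0) (at t)"
      by (simp add: c)
    from DERIV_unique[OF this trajD(4)[OF \<gamma> UNIV_I]] trajD(2)[OF \<gamma> UNIV_I, of t]
    show ?thesis by simp
  qed
  then show False using traj_constant_x[OF \<gamma>, of 0] assms by simp
qed

text \<open>At a minimum and at a maximum of Y one has Y' = 0, so x = \<open>a\<close>. Were the
  minimum not below \<open>Ystar\<close>, both extremes would be points of the same level on the
  same side, hence equal, and Y would be constant.\<close>

lemma traj_hits_lower_half:
  assumes \<gamma>: "traj UNIV \<gamma>" and "H (\<gamma> 0) = \<kappa>" "\<kappa> < 0" "\<kappa> \<noteq> H Pstar"
  obtains t where "fst (\<gamma> t) = a" "snd (\<gamma> t) < Ystar"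
proof -
  define Y where "Y t = snd (\<gamma> t)" for t
  obtain T where T: "T > 0" "\<And>t. \<gamma> (t + T) = \<gamma> t"
    using traj_periodic[OF assms] by blast
  have contY: "continuous_on UNIV Y"
    using traj_continuous_on[OF \<gamma>] unfolding Y_def by (intro continuous_intros)
  obtain t1 where t1: "\<And>t. Y t1 \<le> Y t"
    using periodic_attains_min[of Y T] T contY by (auto simp: Y_def)
  obtain t2 where t2: "\<And>t. - Y t2 \<le> - Y t"
    using periodic_attains_min[of "\<lambda>t. - Y t" T] T contY continuous_on_minus[OF contY] by (auto simp: Y_def)
  have Y': "(Y has_real_derivative m * Y t * (a - fst (\<gamma> t))) (at t)" for t
    using trajD(4)[OF \<gamma> UNIV_I] by (simp add: Y_def[abs_def])
  have Y_pos: "Y t > 0" for t using trajD(2)[OF \<gamma> UNIV_I] by (simp add: Y_def)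
  have "m * Y t1 * (a - fst (\<gamma> t1)) = 0"
    using DERIV_local_min[OF Y', of 1] t1 by simp
  then have x1: "fst (\<gamma> t1) = a" using Y_pos[of t1] by simp
  have "m * Y t2 * (a - fst (\<gamma> t2)) = 0"
    using DERIV_local_max[OF Y', of 1] t2 by simp
  then have x2: "fst (\<gamma> t2) = a" using Y_pos[of t2] by simp
  have lev: "H (a, Y t1) = \<kappa>" "H (a, Y t2) = \<kappa>"
    using traj_H_const[OF \<gamma>, of t1 0] traj_H_const[OF \<gamma>, of t2 0] assms(2) x1 x2
    by (auto simp: Y_def) (metis prod.collapse)+
  have "Y t1 < Ystar"
  proof (rule ccontr)
    assume "\<not> Y t1 < Ystar"
    then have "Y t1 = Y t2"
      using H_a_same_side[of "Y t1" "Y t2"] Y_pos lev t1[of t2] by simp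
    then have "Y t = Y t1" for t using t1[of t] t2[of t] by simp
    then show False
      using traj_not_constant_Y[OF \<gamma>] assms by (auto simp: constant_on_def Y_def)
  qed
  then show thesis using that x1 by (simp add: Y_def)
qed

text \<open>The level has only one point on x = \<open>a\<close> below \<open>Ystar\<close>; both
  trajectories pass through it, and uniqueness does the rest.\<close>

lemma traj_same_level_shift:
  assumes \<gamma>: "traj UNIV \<gamma>" and \<delta>: "traj UNIV \<delta>"
    and "H (\<gamma> 0) = \<kappa>" "H (\<delta> 0) = \<kappa>" "\<kappa> < 0" "\<kappa> \<noteq> H Pstar"
  obtains c where "\<And>t. \<gamma> t = \<delta> (t + c)"
proof -
  obtain t where t: "fst (\<gamma> t) = a" "snd (\<gamma> t) < Ystar"
    using traj_hits_lower_half[OF \<gamma> assms(3,5,6)] .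
  obtain u where u: "fst (\<delta> u) = a" "snd (\<delta> u) < Ystar"
    using traj_hits_lower_half[OF \<delta> assms(4,5,6)] .
  have lev: "H (\<gamma> t) = \<kappa>" "H (\<delta> u) = \<kappa>"
    using traj_H_const[OF \<gamma>, of t 0] traj_H_const[OF \<delta>, of u 0] assms by auto
  then have "H (a, snd (\<gamma> t)) = H (a, snd (\<delta> u))"
    using t u by (metis prod.collapse)
  then have "snd (\<gamma> t) = snd (\<delta> u)"
    using H_a_same_side t u trajD(2)[OF \<gamma> UNIV_I] trajD(2)[OF \<delta> UNIV_I] by blast
  then have "\<gamma> t = \<delta> u" using t u by (simp add: prod_eq_iff)
  define c where "c = u - t"
  have "\<gamma> s = \<delta> (s + c)" for s
    by (rule traj_unique[OF \<gamma> traj_shift[OF \<delta>, of c], of t s])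
      (use \<open>\<gamma> t = \<delta> u\<close> lev assms in \<open>auto simp: c_def\<close>)
  then show thesis by (rule that)
qed

definition level_set :: "real \<Rightarrow> (real \<times> real) set" where
  "level_set \<kappa> = {z \<in> quadrant. H z = \<kappa>}"

text \<open>Through every point of the level there is a trajectory, and it is a time shift of the
  given one.\<close>

lemma range_traj_eq_level_set:
  assumes \<gamma>: "traj UNIV \<gamma>" and "H (\<gamma> 0) = \<kappa>" "\<kappa> < 0" "\<kappa> \<noteq> H Pstar"
  shows "range \<gamma> = level_set \<kappa>"
proof
  show "range \<gamma> \<subseteq> level_set \<kappa>"
    using traj_H_const[OF \<gamma>, of _ 0] assms by (auto simp: level_set_def traj_def)
  show "level_set \<kappa> \<subseteq> range \<gamma>"
  proof
    fix z assume z: "z \<in> level_set \<kappa>"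
    then obtain \<delta> where \<delta>: "traj UNIV \<delta>" "\<delta> 0 = z"
      using traj_exists[of z 0] assms by (auto simp: level_set_def)
    obtain c where "\<And>t. \<delta> t = \<gamma> (t + c)"
      using traj_same_level_shift[OF \<delta>(1) \<gamma>, of \<kappa>] \<delta>(2) z assms by (auto simp: level_set_def)
    then show "z \<in> range \<gamma>" using \<delta>(2) by (metis rangeI)
  qed
qed

lemma level_set_nonempty:
  assumes "H Pstar < \<kappa>" "\<kappa> < 0"
  shows "level_set \<kappa> \<noteq> {}"
proof -
  have "H (a, 0) = 0" by (simp add: H_eq)
  then obtain Y where Y: "0 \<le> Y" "Y \<le> Ystar" "H (a, Y) = \<kappa>"
    using IVT2'[of "\<lambda>Y. H (a, Y)" Ystar \<kappa> 0] assms continuous_on_subset[OF continuous_on_H_a, of "{0..Ystar}"]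
    by (auto simp: Pstar_eq less_imp_le)
  then have "Y \<noteq> 0" using \<open>H (a, 0) = 0\<close> assms by auto
  then have "(a, Y) \<in> level_set \<kappa>" using Y by (auto simp: level_set_def)
  then show ?thesis by blast
qed

lemma common_period:
  assumes "H Pstar < \<kappa>" "\<kappa> < 0"
  shows "\<exists>T>0. \<forall>\<gamma>. traj UNIV \<gamma> \<longrightarrow> H (\<gamma> 0) = \<kappa> \<longrightarrow> (\<forall>t. \<gamma> (t + T) = \<gamma> t)"
proof -
  obtain z where z: "z \<in> quadrant" "H z = \<kappa>"
    using level_set_nonempty[OF assms] by (auto simp: level_set_def)
  then obtain \<delta> where \<delta>: "traj UNIV \<delta>" "\<delta> 0 = z"
    using traj_exists[of z 0] assms by auto
  obtain T where T: "T > 0" "\<And>t. \<delta> (t + T) = \<delta> t"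
    using traj_periodic[OF \<delta>(1), of \<kappa>] \<delta>(2) z assms by auto
  have "\<gamma> (t + T) = \<gamma> t" if \<gamma>: "traj UNIV \<gamma>" "H (\<gamma> 0) = \<kappa>" for \<gamma> t
  proof -
    obtain c where c: "\<And>t. \<gamma> t = \<delta> (t + c)"
      using traj_same_level_shift[OF \<gamma>(1) \<delta>(1), of \<kappa>] \<gamma> \<delta>(2) z assms by auto
    show ?thesis unfolding c using T(2)[of "t + c"] by (simp add: algebra_simps)
  qed
  then show ?thesis using T(1) by blast
qed

text \<open>One period common to all trajectories of the level, so that it depends on \<kappa> and
  not on the solution. It is an arbitrary choice and not claimed to be minimal.\<close>

definition period :: "real \<Rightarrow> real" where
  "period \<kappa> = (SOME T. T > 0 \<and> (\<forall>\<gamma>. traj UNIV \<gamma> \<longrightarrow> H (\<gamma> 0) = \<kappa> \<longrightarrow> (\<forall>t. \<gamma> (t + T) = \<gamma> t)))"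

lemma period:
  assumes "H Pstar < \<kappa>" "\<kappa> < 0"
  shows "period \<kappa> > 0" "traj UNIV \<gamma> \<Longrightarrow> H (\<gamma> 0) = \<kappa> \<Longrightarrow> \<gamma> (t + period \<kappa>) = \<gamma> t"
  using someI_ex[OF common_period[OF assms]] by (auto simp: period_def)

text \<open>The open sublevel \<open>U\<close> is bounded and its frontier lies on the level. The
  component of \<open>Pstar\<close> in the complement of the level cannot cross this frontier, so it
  stays in \<open>U\<close> and is bounded.\<close>

lemma Pstar_inside_level_set:
  assumes "H Pstar < \<kappa>" "\<kappa> < 0"
  shows "Pstar \<in> inside (level_set \<kappa>)"
proof -
  define U where "U = {z \<in> quadrant. H z < \<kappa>}"
  define C where "C = connected_component_set (- level_set \<kappa>) Pstar"
  obtain lo hi where box: "cbox lo hi \<subseteq> quadrant"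
    "\<And>z. z \<in> quadrant \<Longrightarrow> H z \<le> \<kappa> \<Longrightarrow> z \<in> box lo hi"
    by (rule sublevel_box[OF assms(2)]) blast
  have "Pstar \<in> U" using assms by (simp add: U_def Pstar_eq)
  have "Pstar \<notin> level_set \<kappa>" using assms by (simp add: level_set_def)
  have "U \<subseteq> cbox lo hi"
    using box(2) box_subset_cbox[of lo hi] by (auto simp: U_def less_imp_le)
  have "open quadrant"
  proof -
    have "quadrant = {0<..} \<times> {0<..}" by auto
    then show ?thesis by (simp add: open_Times)
  qed
  then have "open U"
    using continuous_open_preimage[OF continuous_on_H _ open_lessThan[of \<kappa>]]
    by (simp add: U_def vimage_def Int_def)
  have "closed (cbox lo hi \<inter> H -` {..\<kappa>})"
    using continuous_on_subset[OF continuous_on_H box(1)] by (intro continuous_closed_preimage) auto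
  moreover have "U \<subseteq> cbox lo hi \<inter> H -` {..\<kappa>}"
    using \<open>U \<subseteq> cbox lo hi\<close> by (auto simp: U_def)
  ultimately have "closure U \<subseteq> cbox lo hi \<inter> H -` {..\<kappa>}"
    by (intro closure_minimal)
  then have frontier: "frontier U \<subseteq> level_set \<kappa>"
    using \<open>open U\<close> box(1) by (auto simp: frontier_def interior_open U_def level_set_def)
  have "C \<subseteq> U"
  proof (rule ccontr)
    assume "\<not> C \<subseteq> U"
    moreover have "Pstar \<in> C"
      using \<open>Pstar \<notin> level_set \<kappa>\<close> by (simp add: C_def)
    moreover have "connected C" by (simp add: C_def)
    ultimately have "C \<inter> frontier U \<noteq> {}"
      using \<open>Pstar \<in> U\<close> by (intro connected_Int_frontier) auto
    moreover have "C \<subseteq> - level_set \<kappa>"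
      by (simp add: C_def connected_component_subset)
    ultimately show False using frontier by blast
  qed
  then have "bounded C"
    using \<open>U \<subseteq> cbox lo hi\<close> by (intro bounded_subset[OF bounded_cbox]) auto
  then show ?thesis
    using \<open>Pstar \<notin> level_set \<kappa>\<close> by (simp add: inside_def C_def)
qed

section \<open>From closed orbits to the second alternative\<close>

lemma powr_a_profile:
  "r > 0 \<Longrightarrow> r powr a * profile \<gamma> r = exp (ln (snd (\<gamma> (ln r))) / m)"
  unfolding profile_def m_a[symmetric] by (simp add: powr_def diff_divide_distrib exp_diff)

lemma orbit_levelD:
  assumes "orbit_level N p s \<mu> q R v \<kappa>" "t \<in> orbit_times R v"
  shows "H (orbit_point p s q v t) = \<kappa>"
  using assms by (auto simp: orbit_level_def orbit_def)

text \<open>By uniqueness the orbit of v is the restriction to t > ln R of the complete trajectory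
  through one of its points. The \<open>profile\<close> of that trajectory extends v, and its
  rescaling by r^a inherits the period.\<close>

lemma alternative_II_if:
  assumes sol: "solution N p s \<mu> q {R<..} v" and "R > 0"
    and lev: "orbit_level N p s \<mu> q R v \<kappa>" and \<kappa>: "H Pstar < \<kappa>" "\<kappa> < 0"
  shows "alternative_II N p s \<mu> q R v \<kappa> (period \<kappa>)" "orbit p s q R v = level_set \<kappa>"
proof -
  note O = solution_orbit[OF sol \<open>R > 0\<close>]
  define t1 where "t1 = ln R + 1"
  have lev1: "H (orbit_point p s q v t1) = \<kappa>"
    by (rule orbit_levelD[OF lev]) (simp add: O t1_def)
  have "orbit_point p s q v t1 \<in> quadrant"
    using O(2) by (simp add: traj_def t1_def)
  then obtain \<gamma> where \<gamma>: "traj UNIV \<gamma>" "\<gamma> t1 = orbit_point p s q v t1"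
    using traj_exists[of _ t1] lev1 \<kappa> by metis
  have \<gamma>_lev: "H (\<gamma> 0) = \<kappa>"
    using traj_H_const[OF \<gamma>(1), of 0 t1] \<gamma>(2) lev1 by simp
  have eq: "orbit_point p s q v t = \<gamma> t" if "t > ln R" for t
    by (rule traj_unique[OF O(2) traj_subset[OF \<gamma>(1)], of t1])
      (use that \<gamma>(2) lev1 \<kappa> in \<open>auto simp: t1_def is_interval_io\<close>)
  define T where "T = period \<kappa>"
  have T: "T > 0" "\<And>t. \<gamma> (t + T) = \<gamma> t"
    using period[OF \<kappa>] \<gamma>(1) \<gamma>_lev by (auto simp: T_def)
  have range_eq: "range \<gamma> = level_set \<kappa>"
    using range_traj_eq_level_set[OF \<gamma>(1) \<gamma>_lev] \<kappa> by simp
  \<comment> \<open>The orbit of v covers only a half-line of times, but by periodicity every point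
    of the closed orbit recurs there.\<close>
  have "\<gamma> t \<in> orbit p s q R v" for t
  proof -
    obtain u where u: "ln R + 1 \<le> u" "\<gamma> u = \<gamma> t"
      by (rule periodic_representative[where f = \<gamma> and T = T and c = "ln R + 1" and t = t])
        (use T in auto)
    then have "\<gamma> t = orbit_point p s q v u" using eq[of u] by simp
    then show ?thesis using u(1) by (auto simp: orbit_def O(1))
  qed
  moreover have "orbit p s q R v \<subseteq> range \<gamma>"
    using eq by (auto simp: orbit_def O(1))
  ultimately have orbit_eq: "orbit p s q R v = range \<gamma>" by blast
  then show "orbit p s q R v = level_set \<kappa>" using range_eq by simp
  \<comment> \<open>This is Y^(1/m), which equals r^a times the profile by
    \<open>powr_a_profile\<close>.\<close>
  define \<Psi> where "\<Psi> t = exp (ln (snd (\<gamma> t)) / m)" for t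
  have Y_nc: "\<not> (\<lambda>t. snd (\<gamma> t)) constant_on UNIV"
    using traj_not_constant_Y[OF \<gamma>(1)] \<gamma>_lev \<kappa> by simp
  have \<Psi>_nc: "\<not> \<Psi> constant_on UNIV"
  proof
    assume "\<Psi> constant_on UNIV"
    then obtain c where c: "\<And>t. \<Psi> t = c" by (auto simp: constant_on_def)
    have "snd (\<gamma> t) = snd (\<gamma> 0)" for t
    proof -
      have "exp (ln (snd (\<gamma> t)) / m) = exp (ln (snd (\<gamma> 0)) / m)"
        using c[of t] c[of 0] by (simp add: \<Psi>_def)
      then have "ln (snd (\<gamma> t)) = ln (snd (\<gamma> 0))" by simp
      then show ?thesis using trajD(2)[OF \<gamma>(1) UNIV_I] by (metis exp_ln)
    qed
    then show False using Y_nc by (auto simp: constant_on_def)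
  qed
  have \<Psi>_per: "\<Psi> (t + T) = \<Psi> t" for t by (simp add: \<Psi>_def T)
  have \<Psi>_cont: "continuous_on UNIV \<Psi>"
    unfolding \<Psi>_def using traj_continuous_on[OF \<gamma>(1)] trajD(2)[OF \<gamma>(1) UNIV_I]
    by (intro continuous_intros) (auto simp: less_imp_neq[symmetric])
  have V_eq: "profile \<gamma> r = v r" if "r > R" for r
  proof (rule profile_eqI)
    show "r > 0" using that \<open>R > 0\<close> by simp
    show "v r > 0" using solutionD(1)[OF sol] that by simp
    show "\<gamma> (ln r) = orbit_point p s q v (ln r)"
      using eq[of "ln r"] that \<open>R > 0\<close> by simp
  qed
  have \<Psi>_v: "r powr a * v r = \<Psi> (ln r)" if "r > R" for r
    using powr_a_profile[of r \<gamma>] V_eq[OF that] that \<open>R > 0\<close> by (simp add: \<Psi>_def)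
  have II1: "\<exists>\<gamma>. complete_trajectory N p s \<mu> q \<gamma> \<and>
          (\<exists>\<tau>>0. \<forall>t. \<gamma> (t + \<tau>) = \<gamma> t) \<and> \<not> \<gamma> constant_on UNIV \<and>
          Pstar \<in> inside (range \<gamma>) \<and>
          (\<forall>t\<in>orbit_times R v. orbit_point p s q v t = \<gamma> t) \<and>
          orbit p s q R v = range \<gamma>"
  proof (intro exI[of _ \<gamma>] conjI)
    show "\<not> \<gamma> constant_on UNIV" using Y_nc unfolding constant_on_def by metis
    show "Pstar \<in> inside (range \<gamma>)"
      using Pstar_inside_level_set[OF \<kappa>] by (simp add: range_eq)
  qed (use \<gamma>(1) T eq O(1) orbit_eq in \<open>auto simp: complete_trajectory_iff\<close>)
  have II2: "\<exists>V \<Psi>. global_extension N p s \<mu> q R v V \<and>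
          (\<forall>t. 0 < \<Psi> t) \<and> \<not> \<Psi> constant_on UNIV \<and>
          0 < T \<and> (\<forall>t. \<Psi> (t + T) = \<Psi> t) \<and>
          (\<forall>r>0. r powr a * V r = \<Psi> (ln r))"
  proof (rule exI[of _ "profile \<gamma>"], rule exI[of _ \<Psi>], intro conjI)
    show "global_extension N p s \<mu> q R v (profile \<gamma>)"
      using traj_profile(1)[OF \<gamma>(1)] V_eq by (simp add: global_extension_def)
    show "\<forall>r>0. r powr a * profile \<gamma> r = \<Psi> (ln r)"
      by (simp add: powr_a_profile \<Psi>_def)
  qed (use \<Psi>_nc T \<Psi>_per in \<open>auto simp: \<Psi>_def\<close>)
  obtain u1 u2 where u: "\<Psi> u1 \<noteq> \<Psi> u2"
    "Liminf at_top (\<lambda>r. ereal (\<Psi> (ln r))) = ereal (\<Psi> u1)"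
    "Limsup at_top (\<lambda>r. ereal (\<Psi> (ln r))) = ereal (\<Psi> u2)"
    using periodic_limits[OF \<Psi>_per T(1) \<Psi>_cont \<Psi>_nc] .
  have ev: "eventually (\<lambda>r. ereal (r powr a * v r) = ereal (\<Psi> (ln r))) at_top"
    using eventually_gt_at_top[of R] by eventually_elim (simp add: \<Psi>_v)
  have II3: "\<exists>l L. 0 < l \<and> 0 < L \<and> l \<noteq> L \<and>
          Liminf at_top (\<lambda>r. ereal (r powr a * v r)) = ereal l \<and>
          Limsup at_top (\<lambda>r. ereal (r powr a * v r)) = ereal L"
    using u Liminf_eq[OF ev] Limsup_eq[OF ev]
    by (intro exI[of _ "\<Psi> u1"] exI[of _ "\<Psi> u2"]) (auto simp: \<Psi>_def)
  have II4: "no_exact_decay_rate v"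
    using periodic_no_exact_decay_rate[OF \<Psi>_per T(1) \<Psi>_nc \<Psi>_v] .
  show "alternative_II N p s \<mu> q R v \<kappa> (period \<kappa>)"
    unfolding alternative_II_def using \<kappa> II1 II2 II3 II4 by (simp only: T_def simp_thms)
qed

end

section \<open>The zero level\<close>

text \<open>Near the simple zero e the speed f \<xi> is comparable to the gap e - \<xi>, so
  eventually the gap is at most K \<xi>'. Its integral g is then bounded by K times the remaining
  distance, and g is monotone.\<close>

lemma tendsto_integral_of_gap:
  fixes \<xi> f g :: "real \<Rightarrow> real"
  assumes \<xi>: "\<And>t. (\<xi> has_real_derivative f (\<xi> t)) (at t)" and less: "\<And>t. \<xi> t < e"
    and lim: "(\<xi> \<longlongrightarrow> e) at_top"
    and f: "f e = 0" "(f has_real_derivative d) (at e)" "d < 0"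
    and g: "\<And>t. (g has_real_derivative e - \<xi> t) (at t)"
  shows "\<exists>l. (g \<longlongrightarrow> l) at_top"
proof -
  have "((\<lambda>x. (f x - f e) / (x - e)) \<longlongrightarrow> d) (at e)"
    using f(2) by (simp add: has_field_derivative_iff)
  then have "((\<lambda>t. (f (\<xi> t) - f e) / (\<xi> t - e)) \<longlongrightarrow> d) at_top"
    by (rule filterlim_compose) (use lim less in \<open>auto simp: filterlim_at less_imp_neq\<close>)
  then have "eventually (\<lambda>t. f (\<xi> t) / (\<xi> t - e) < d / 2) at_top"
    using f by (intro order_tendstoD(2)[of _ d]) simp_all
  then obtain T where T: "\<And>t. t \<ge> T \<Longrightarrow> f (\<xi> t) / (\<xi> t - e) < d / 2"
    by (auto simp: eventually_at_top_linorder)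
  \<comment> \<open>The quotient f \<xi> / (\<xi> - e) tends to d < 0 and is eventually below d / 2;
    multiplying out by the negative \<xi> - e gives the bound with - 2 / d.\<close>
  define K where "K = - 2 / d"
  have "K > 0" using f(3) by (simp add: K_def)
  have gap: "e - \<xi> t \<le> K * f (\<xi> t)" if "t \<ge> T" for t
    using T[OF that] less[of t] f(3) by (simp add: K_def field_simps)
  have "g s \<le> g t" if "s \<le> t" for s t
    by (rule DERIV_nonneg_imp_nondecreasing[OF that]) (use g less less_imp_le in fastforce)
  moreover have "g t \<le> g T - K * \<xi> T + K * e" if "t > T" for t
  proof -
    have "g t - K * \<xi> t \<le> g T - K * \<xi> T"
    proof (rule DERIV_nonpos_imp_nonincreasing[where f = "\<lambda>t. g t - K * \<xi> t"])
      show "T \<le> t" using that by simp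
      fix u assume "T \<le> u"
      moreover have "((\<lambda>t. g t - K * \<xi> t) has_real_derivative (e - \<xi> u) - K * f (\<xi> u)) (at u)"
        by (intro DERIV_diff DERIV_cmult g \<xi>)
      ultimately show "\<exists>y. ((\<lambda>t. g t - K * \<xi> t) has_real_derivative y) (at u) \<and> y \<le> 0"
        using gap[of u] by fastforce
    qed
    moreover have "K * \<xi> t \<le> K * e"
      using less[of t] \<open>K > 0\<close> by simp
    ultimately show ?thesis by linarith
  qed
  ultimately show ?thesis
    by (intro tendsto_at_top_of_mono_bounded[of T g]) auto
qed

context critical
begin

text \<open>The right-hand side of the x-equation on the level zero, where \<mu> + Y - h x equals (h
  x - \<mu>) / \<beta>.\<close>

definition drive :: "real \<Rightarrow> real" where
  "drive x = x powr (2 - p) / (p - 1) * ((h x - \<mu>) / \<beta>)"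

lemma drive_zero: "drive \<nu>m = 0" "drive \<nu>p = 0"
  using nu_roots by (simp_all add: drive_def)

lemma drive_pos: "\<nu>m < x \<Longrightarrow> x < \<nu>p \<Longrightarrow> drive x > 0"
proof -
  assume x: "\<nu>m < x" "x < \<nu>p"
  then have "x > 0" using nu_roots(1) by linarith
  then show ?thesis
    using h_gt_mu_iff[of x] x p_gt_1 by (simp add: drive_def)
qed

lemma drive_deriv:
  assumes "x > 0"
  shows "(drive has_real_derivative
    ((2 - p) * x powr (1 - p) / (p - 1) * ((h x - \<mu>) / \<beta>) + p * (a - x) / \<beta>)) (at x)"
proof -
  have "((\<lambda>x. x powr (2 - p) / (p - 1)) has_real_derivative (2 - p) * x powr (2 - p - 1) / (p - 1)) (at x)"
    by (intro DERIV_cdivide has_real_derivative_powr assms)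
  moreover have "((\<lambda>x. (h x - \<mu>) / \<beta>) has_real_derivative (p * (p - 1) * x powr (p - 2) * (a - x) - 0) / \<beta>) (at x)"
    by (intro DERIV_cdivide DERIV_diff h_deriv DERIV_const assms)
  ultimately have "(drive has_real_derivative
    (2 - p) * x powr (2 - p - 1) / (p - 1) * ((h x - \<mu>) / \<beta>)
    + (p * (p - 1) * x powr (p - 2) * (a - x) - 0) / \<beta> * (x powr (2 - p) / (p - 1))) (at x)"
    unfolding drive_def[abs_def] by (rule DERIV_mult)
  also have "(p * (p - 1) * x powr (p - 2) * (a - x) - 0) / \<beta> * (x powr (2 - p) / (p - 1))
    = (x powr (p - 2) * x powr (2 - p)) * (p * (a - x) / \<beta>)"
    using p_gt_1 by simp
  also have "x powr (p - 2) * x powr (2 - p) = 1"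
    using assms by (simp flip: powr_add)
  also have "2 - p - 1 = 1 - p" by simp
  finally show ?thesis by simp
qed

lemma lipschitz_drive: obtains L where "L-lipschitz_on {\<nu>m..\<nu>p} drive"
proof -
  have pos: "x > 0" if "x \<in> {\<nu>m..\<nu>p}" for x
    using that nu_roots(1) by (auto simp del: nu_pos)
  define D where "D x = (2 - p) * x powr (1 - p) / (p - 1) * ((h x - \<mu>) / \<beta>) + p * (a - x) / \<beta>" for x
  have "continuous_on {\<nu>m..\<nu>p} D"
    unfolding D_def using p_gt_1 nu_roots(1)
    by (intro continuous_intros continuous_on_subset[OF continuous_on_h]) (auto simp del: nu_pos)
  then have "bounded (D ` {\<nu>m..\<nu>p})"
    by (intro compact_imp_bounded compact_continuous_image) auto
  then obtain K where K: "K > 0" "\<And>x. x \<in> {\<nu>m..\<nu>p} \<Longrightarrow> norm (D x) \<le> K"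
    unfolding bounded_pos by (metis imageI)
  have "K-lipschitz_on {\<nu>m..\<nu>p} drive"
  proof (rule lipschitz_onI)
    fix x y assume "x \<in> {\<nu>m..\<nu>p}" "y \<in> {\<nu>m..\<nu>p}"
    then show "dist (drive x) (drive y) \<le> K * dist x y"
      unfolding dist_norm
      by (intro field_differentiable_bound[of "{\<nu>m..\<nu>p}" drive D])
        (use K(2) drive_deriv[OF pos] in \<open>auto simp: D_def intro: has_field_derivative_at_within\<close>)
  qed (use K in simp)
  then show thesis by (rule that)
qed

text \<open>The field is made globally Lipschitz by projection to the closed interval. Its endpoints
  are zeros of \<open>drive\<close>, so by uniqueness they are never reached and the solution stays
  strictly between them.\<close>

lemma drive_flow_exists:
  assumes "\<nu>m < x0" "x0 < \<nu>p"
  obtains \<xi> where "\<xi> t0 = x0" "\<And>t. \<nu>m < \<xi> t \<and> \<xi> t < \<nu>p"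
    "\<And>t. (\<xi> has_real_derivative drive (\<xi> t)) (at t)"
proof -
  obtain L where L: "L-lipschitz_on {\<nu>m..\<nu>p} drive"
    using lipschitz_drive .
  have lip: "L-lipschitz_on UNIV (\<lambda>x. drive (clamp \<nu>m \<nu>p x))"
    using L assms by (intro lipschitz_on_clamp) auto
  obtain \<xi> where \<xi>: "\<xi> t0 = x0" "\<And>t. (\<xi> has_vector_derivative drive (clamp \<nu>m \<nu>p (\<xi> t))) (at t)"
    by (rule lipschitz_ode_exists[OF lip, of t0 x0]) blast
  have avoid: "\<xi> t \<noteq> e" if e: "e = \<nu>m \<or> e = \<nu>p" for t e
  proof
    assume "\<xi> t = e"
    have "drive (clamp \<nu>m \<nu>p e) = 0"
      using e drive_zero assms by auto
    then have "\<xi> t0 = (\<lambda>t. e) t0"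
      by (intro lipschitz_ode_unique[OF lip is_interval_univ, of \<xi> "\<lambda>t. e" t t0])
        (use \<xi>(2) \<open>\<xi> t = e\<close> in auto)
    then show False using e assms \<xi>(1) by auto
  qed
  have "connected (range \<xi>)"
    by (intro connected_continuous_image has_vector_derivative_imp_continuous_on[OF \<xi>(2)]) auto
  note conn = connectedD_interval[OF this]
  have "\<nu>m \<notin> range \<xi>" "\<nu>p \<notin> range \<xi>"
    by (metis avoid rangeE)+
  have bounds: "\<nu>m < \<xi> t \<and> \<xi> t < \<nu>p" for t
  proof (rule ccontr)
    assume "\<not> ?thesis"
    then have "\<nu>m \<in> range \<xi> \<or> \<nu>p \<in> range \<xi>"
      using conn[of "\<xi> t" "\<xi> t0" \<nu>m] conn[of "\<xi> t0" "\<xi> t" \<nu>p] \<xi>(1) assms by force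
    then show False using \<open>\<nu>m \<notin> range \<xi>\<close> \<open>\<nu>p \<notin> range \<xi>\<close> by blast
  qed
  have "(\<xi> has_real_derivative drive (\<xi> t)) (at t)" for t
  proof -
    have "clamp \<nu>m \<nu>p (\<xi> t) = \<xi> t" using bounds[of t] by simp
    then show ?thesis
      using \<xi>(2)[of t] by (simp add: has_real_derivative_iff_has_vector_derivative)
  qed
  then show thesis using that \<xi>(1) bounds by blast
qed

text \<open>\<open>drive\<close> is positive between the roots, so the solution is monotone and
  bounded; its limits are zeros of \<open>drive\<close>, hence endpoints. The limit at minus
  infinity is obtained by reversing time.\<close>

lemma drive_flow_limits:
  assumes \<xi>: "\<And>t. \<nu>m < \<xi> t \<and> \<xi> t < \<nu>p" "\<And>t. (\<xi> has_real_derivative drive (\<xi> t)) (at t)"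
  shows "(\<xi> \<longlongrightarrow> \<nu>p) at_top" "(\<xi> \<longlongrightarrow> \<nu>m) at_bot"
proof -
  have mono: "\<xi> s \<le> \<xi> t" if "s \<le> t" for s t
    by (rule DERIV_nonneg_imp_nondecreasing[OF that])
      (use \<xi> drive_pos less_imp_le in meson)
  have drive_lim: "((\<lambda>t. drive (f t)) \<longlongrightarrow> drive l) at_top"
    if "(f \<longlongrightarrow> l) at_top" "l > 0" for l and f :: "real \<Rightarrow> real"
    using isCont_tendsto_compose[OF DERIV_isCont[OF drive_deriv[OF that(2)]] that(1)] .
  have "\<exists>l. (\<xi> \<longlongrightarrow> l) at_top"
    by (rule tendsto_at_top_of_mono_bounded[of 0 \<xi> \<nu>p]) (use mono \<xi>(1) in \<open>auto simp: less_imp_le\<close>)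
  then obtain l where l: "(\<xi> \<longlongrightarrow> l) at_top" by blast
  have "\<xi> 0 \<le> l"
    by (rule tendsto_lowerbound[OF l])
      (auto intro!: mono eventually_mono[OF eventually_ge_at_top[of 0]])
  moreover have "l \<le> \<nu>p"
    using tendsto_upperbound[OF l] \<xi>(1) by (simp add: less_imp_le)
  moreover have "l > 0" using calculation(1) \<xi>(1)[of 0] nu_roots(1) by linarith
  moreover have "drive l = 0"
    by (rule tendsto_derivative_limit_eq_0[OF \<xi>(2) l drive_lim[OF l \<open>l > 0\<close>]])
  ultimately have "l = \<nu>p"
    using drive_pos[of l] \<xi>(1)[of 0] by fastforce
  then show "(\<xi> \<longlongrightarrow> \<nu>p) at_top" using l by simp
  define \<zeta> where "\<zeta> t = \<xi> (- t)" for t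
  have \<zeta>': "(\<zeta> has_real_derivative - drive (\<zeta> t)) (at t)" for t
    using DERIV_chain2[OF \<xi>(2) DERIV_minus[OF DERIV_ident], of t] by (simp add: \<zeta>_def[abs_def])
  have "\<exists>l. ((\<lambda>t. - \<zeta> t) \<longlongrightarrow> l) at_top"
    by (rule tendsto_at_top_of_mono_bounded[of 0 _ "- \<nu>m"]) (use mono \<xi>(1) in \<open>auto simp: \<zeta>_def less_imp_le\<close>)
  then obtain l' where l': "(\<zeta> \<longlongrightarrow> l') at_top"
    using tendsto_minus_cancel_left by blast
  have "l' \<le> \<zeta> 0"
    by (rule tendsto_upperbound[OF l'])
      (auto simp: \<zeta>_def intro!: mono eventually_mono[OF eventually_ge_at_top[of 0]])
  moreover have "\<nu>m \<le> l'"
    using tendsto_lowerbound[OF l'] \<xi>(1) by (simp add: \<zeta>_def less_imp_le)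
  moreover have "l' > 0" using calculation(2) nu_roots(1) by linarith
  moreover have "- drive l' = 0"
    by (rule tendsto_derivative_limit_eq_0[OF \<zeta>' l']) (intro tendsto_minus drive_lim l' \<open>l' > 0\<close>)
  ultimately have "l' = \<nu>m"
    using drive_pos[of l'] \<xi>(1)[of 0] by (fastforce simp: \<zeta>_def)
  then show "(\<xi> \<longlongrightarrow> \<nu>m) at_bot"
    using l' by (simp add: filterlim_at_bot_mirror \<zeta>_def[abs_def])
qed

definition zero_curve :: "real \<Rightarrow> real \<times> real" where
  "zero_curve x = (x, (\<beta> + 1) / \<beta> * (h x - \<mu>))"

text \<open>The curve is invariant: differentiating its height along \<open>drive\<close> gives the
  Y-equation, because p / \<beta> = m.\<close>

lemma traj_zero_curve:
  assumes \<xi>: "\<And>t. \<nu>m < \<xi> t \<and> \<xi> t < \<nu>p" "\<And>t. (\<xi> has_real_derivative drive (\<xi> t)) (at t)"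
  shows "traj UNIV (\<lambda>t. zero_curve (\<xi> t))"
  unfolding zero_curve_def
proof (rule trajI)
  fix t
  have x: "\<xi> t > 0" using \<xi>(1)[of t] nu_roots(1) by linarith
  show "\<xi> t > 0" by fact
  have gt: "h (\<xi> t) > \<mu>" using h_gt_mu_iff[OF x] \<xi>(1)[of t] by simp
  then show "(\<beta> + 1) / \<beta> * (h (\<xi> t) - \<mu>) > 0" by simp
  have "\<mu> + (\<beta> + 1) / \<beta> * (h (\<xi> t) - \<mu>) - h (\<xi> t) = (h (\<xi> t) - \<mu>) / \<beta>"
    by (simp add: field_simps)
  then show "(\<xi> has_real_derivative
      \<xi> t powr (2 - p) / (p - 1) * (\<mu> + (\<beta> + 1) / \<beta> * (h (\<xi> t) - \<mu>) - h (\<xi> t))) (at t)"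
    using \<xi>(2)[of t] by (simp add: drive_def)
  have "((\<lambda>t. (\<beta> + 1) / \<beta> * (h (\<xi> t) - \<mu>)) has_real_derivative
      (\<beta> + 1) / \<beta> * (p * (p - 1) * \<xi> t powr (p - 2) * (a - \<xi> t) * drive (\<xi> t) - 0)) (at t)"
    by (intro DERIV_cmult DERIV_diff DERIV_const DERIV_chain2[OF h_deriv[OF x] \<xi>(2)])
  also have "p * (p - 1) * \<xi> t powr (p - 2) * (a - \<xi> t) * drive (\<xi> t)
     = (\<xi> t powr (p - 2) * \<xi> t powr (2 - p)) * (p / \<beta>) * (h (\<xi> t) - \<mu>) * (a - \<xi> t)"
    using p_gt_1 by (simp add: drive_def)
  also have "\<xi> t powr (p - 2) * \<xi> t powr (2 - p) = 1"
    using x by (simp flip: powr_add)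
  also have "p / \<beta> = m" by (simp add: divide_eq_eq mult.commute beta_m)
  also have "(\<beta> + 1) / \<beta> * (1 * m * (h (\<xi> t) - \<mu>) * (a - \<xi> t) - 0)
     = m * ((\<beta> + 1) / \<beta> * (h (\<xi> t) - \<mu>)) * (a - \<xi> t)" by simp
  finally show "((\<lambda>t. (\<beta> + 1) / \<beta> * (h (\<xi> t) - \<mu>)) has_real_derivative
      m * ((\<beta> + 1) / \<beta> * (h (\<xi> t) - \<mu>)) * (a - \<xi> t)) (at t)" .
qed

section \<open>The third alternative: the heteroclinic connection and its asymptotics\<close>

lemma zero_level_eq_zero_curve:
  assumes "z \<in> quadrant" "H z = 0"
  shows "z = zero_curve (fst z)"
  using H_nonpos_iff(2)[of "fst z" "snd z"] assms by (simp add: zero_curve_def prod_eq_iff)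

text \<open>The scalar flow started at one orbit point, lifted to the zero curve, agrees with the
  orbit by uniqueness and extends it to all times. With V the \<open>profile\<close>, \<nu> t + ln V
  has derivative \<nu> - \<xi>, so the limits of r^\<nu> V follow from the integrability of this
  gap.\<close>

lemma alternative_III_if:
  assumes sol: "solution N p s \<mu> q {R<..} v" and "R > 0"
    and lev: "orbit_level N p s \<mu> q R v 0"
  shows "alternative_III N p s \<mu> q R v 0"
proof -
  note O = solution_orbit[OF sol \<open>R > 0\<close>]
  define t1 where "t1 = ln R + 1"
  define z1 where "z1 = orbit_point p s q v t1"
  have lev1: "H z1 = 0"
    unfolding z1_def by (rule orbit_levelD[OF lev]) (simp add: O t1_def)
  have quad1: "z1 \<in> quadrant"
    using O(2) by (simp add: traj_def t1_def z1_def)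
  have "\<nu>m < fst z1" "fst z1 < \<nu>p"
    using H_nonpos_bounds[OF quad1] lev1 by auto
  then obtain \<xi> where \<xi>0: "\<xi> t1 = fst z1" and \<xi>: "\<And>t. \<nu>m < \<xi> t \<and> \<xi> t < \<nu>p"
    "\<And>t. (\<xi> has_real_derivative drive (\<xi> t)) (at t)"
    by (rule drive_flow_exists[where ?t0.0 = t1]) blast
  define \<gamma> where "\<gamma> t = zero_curve (\<xi> t)" for t
  have \<gamma>: "traj UNIV \<gamma>"
    unfolding \<gamma>_def[abs_def] by (rule traj_zero_curve[OF \<xi>])
  have \<gamma>1: "\<gamma> t1 = z1"
    using zero_level_eq_zero_curve[OF quad1 lev1] by (simp add: \<gamma>_def \<xi>0)
  have eq: "orbit_point p s q v t = \<gamma> t" if "t > ln R" for t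
    by (rule traj_unique[OF O(2) traj_subset[OF \<gamma>], of t1])
      (use that \<gamma>1 lev1 in \<open>auto simp: t1_def z1_def is_interval_io\<close>)
  have V_eq: "profile \<gamma> r = v r" if "r > R" for r
  proof (rule profile_eqI)
    show "r > 0" using that \<open>R > 0\<close> by simp
    show "v r > 0" using solutionD(1)[OF sol] that by simp
    show "\<gamma> (ln r) = orbit_point p s q v (ln r)"
      using eq[of "ln r"] that \<open>R > 0\<close> by simp
  qed
  note lim = drive_flow_limits[OF \<xi>]
  have curve_lim: "(\<gamma> \<longlongrightarrow> (\<nu>, 0)) net" if "(\<xi> \<longlongrightarrow> \<nu>) net" "\<nu> > 0" "h \<nu> = \<mu>" for \<nu> net
  proof -
    have "((\<lambda>t. (\<beta> + 1) / \<beta> * (h (\<xi> t) - \<mu>)) \<longlongrightarrow> (\<beta> + 1) / \<beta> * (h \<nu> - \<mu>)) net"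
      using that by (intro tendsto_intros) auto
    then show ?thesis
      using tendsto_Pair[OF that(1)] that(3) unfolding \<gamma>_def[abs_def] zero_curve_def by simp
  qed
  have range_\<xi>: "x \<in> range \<xi>" if x: "\<nu>m < x" "x < \<nu>p" for x
  proof -
    have conn: "connected (range \<xi>)"
      using \<xi>(2) by (intro connected_continuous_image has_vector_derivative_imp_continuous_on)
        (auto simp: has_real_derivative_iff_has_vector_derivative)
    obtain t where "\<xi> t < x"
      using order_tendstoD(2)[OF lim(2) x(1)] by (metis eventually_at_bot_linorder order_refl)
    moreover obtain u where "x < \<xi> u"
      using order_tendstoD(1)[OF lim(1) x(2)] by (metis eventually_at_top_linorder order_refl)
    ultimately show ?thesis
      using connectedD_interval[OF conn, of "\<xi> t" "\<xi> u" x] by simp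
  qed
  have range_\<gamma>: "range \<gamma> = {(x, (N + s) / (N - p) * (h x - \<mu>)) | x.
                         nu_minus N p \<mu> < x \<and> x < nu_plus N p \<mu>}" (is "_ = ?S")
  proof (intro equalityI subsetI)
    fix z assume "z \<in> range \<gamma>"
    then obtain t where "z = \<gamma> t" by blast
    then show "z \<in> ?S"
      using \<xi>(1)[of t] by (auto simp: \<gamma>_def zero_curve_def N_s_ratio simp flip: \<nu>m_def \<nu>p_def)
  next
    fix z assume "z \<in> ?S"
    then obtain x where x: "z = (x, (N + s) / (N - p) * (h x - \<mu>))" "\<nu>m < x" "x < \<nu>p"
      unfolding \<nu>m_def \<nu>p_def by blast
    then obtain t where "x = \<xi> t" using range_\<xi> by blast
    then have "z = \<gamma> t" by (simp add: x(1) \<gamma>_def zero_curve_def N_s_ratio)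
    then show "z \<in> range \<gamma>" by simp
  qed
  have P_lims: "(\<gamma> \<longlongrightarrow> P_minus N p \<mu>) at_bot" "(\<gamma> \<longlongrightarrow> P_plus N p \<mu>) at_top"
    using curve_lim[OF lim(2)] curve_lim[OF lim(1)] nu_roots
    by (auto simp: P_minus_def P_plus_def simp flip: \<nu>m_def \<nu>p_def)
  \<comment> \<open>The logarithm of the profile as a function of t; its derivative is -
    \<xi>.\<close>
  define lV where "lV t = (ln (snd (\<gamma> t)) - (p + s) * t) / m" for t
  have lV': "(lV has_real_derivative - \<xi> t) (at t)" for t
  proof -
    have Y: "snd (\<gamma> t) > 0" using trajD(2)[OF \<gamma> UNIV_I] .
    have "(lV has_real_derivative
       (1 / snd (\<gamma> t) * (m * snd (\<gamma> t) * (a - fst (\<gamma> t))) - (p + s)) / m) (at t)"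
      unfolding lV_def[abs_def]
      by (intro DERIV_cdivide DERIV_diff DERIV_chain2[of ln] trajD(4)[OF \<gamma> UNIV_I] DERIV_ln_divide Y DERIV_cmult_Id)
    also have "(1 / snd (\<gamma> t) * (m * snd (\<gamma> t) * (a - fst (\<gamma> t))) - (p + s)) / m = - fst (\<gamma> t)"
      unfolding m_a[symmetric] using Y by (simp add: right_diff_distrib)
    finally show ?thesis by (simp add: \<gamma>_def zero_curve_def)
  qed
  have lV_eq: "r powr \<nu> * profile \<gamma> r = exp (\<nu> * ln r + lV (ln r))" if "r > 0" for r \<nu>
    using that by (simp add: profile_def lV_def powr_def exp_add)
  have drive_deriv_root: "(drive has_real_derivative p * (a - \<nu>) / \<beta>) (at \<nu>)" if "\<nu> > 0" "h \<nu> = \<mu>" for \<nu>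
    using drive_deriv[OF that(1)] that(2) by simp
  have "\<exists>l. ((\<lambda>t. \<nu>p * t + lV t) \<longlongrightarrow> l) at_top"
  proof (rule tendsto_integral_of_gap[OF \<xi>(2) _ lim(1) drive_zero(2) drive_deriv_root])
    show "p * (a - \<nu>p) / \<beta> < 0"
      using nu_roots(3) p_gt_1 by (intro divide_neg_pos mult_pos_neg) auto
    show "((\<lambda>t. \<nu>p * t + lV t) has_real_derivative \<nu>p - \<xi> t) (at t)" for t
      using DERIV_add[OF DERIV_cmult_Id lV', of \<nu>p t] by simp
  qed (use \<xi>(1) nu_roots in auto)
  then obtain l where l: "((\<lambda>t. \<nu>p * t + lV t) \<longlongrightarrow> l) at_top" by blast
  have top: "((\<lambda>r. r powr \<nu>p * profile \<gamma> r) \<longlongrightarrow> exp l) at_top"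
  proof -
    have "((\<lambda>r. exp (\<nu>p * ln r + lV (ln r))) \<longlongrightarrow> exp l) at_top"
      by (intro tendsto_exp filterlim_compose[OF l] ln_at_top)
    moreover have "eventually (\<lambda>r. exp (\<nu>p * ln r + lV (ln r)) = r powr \<nu>p * profile \<gamma> r) at_top"
      using eventually_gt_at_top[of 0] by eventually_elim (simp add: lV_eq)
    ultimately show ?thesis by (rule Lim_transform_eventually)
  qed
  \<comment> \<open>Reflecting both time and space turns the approach to \<open>\<nu>m\<close> at
    minus infinity into an increasing approach to - \<open>\<nu>m\<close> at plus infinity, and
    makes the slope at the zero negative.\<close>
  define \<zeta> where "\<zeta> t = - \<xi> (- t)" for t
  have "\<exists>l. ((\<lambda>t. \<nu>m * (- t) + lV (- t)) \<longlongrightarrow> l) at_top"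
  proof (rule tendsto_integral_of_gap[of \<zeta> "\<lambda>x. drive (- x)" "- \<nu>m" "- (p * (a - \<nu>m) / \<beta>)"])
    show "(\<zeta> has_real_derivative drive (- \<zeta> t)) (at t)" for t
      using DERIV_minus[OF DERIV_chain2[OF \<xi>(2) DERIV_minus[OF DERIV_ident], of t]] by (simp add: \<zeta>_def[abs_def])
    show "\<zeta> t < - \<nu>m" for t using \<xi>(1) by (simp add: \<zeta>_def)
    show "(\<zeta> \<longlongrightarrow> - \<nu>m) at_top"
      unfolding \<zeta>_def[abs_def] using lim(2) by (intro tendsto_minus) (simp add: filterlim_at_bot_mirror)
    show "drive (- (- \<nu>m)) = 0" by (simp add: drive_zero)
    have "(drive has_real_derivative p * (a - \<nu>m) / \<beta>) (at (- (- \<nu>m)))"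
      using drive_deriv_root[of \<nu>m] nu_roots by simp
    from DERIV_chain2[OF this DERIV_minus[OF DERIV_ident]]
    show "((\<lambda>x. drive (- x)) has_real_derivative - (p * (a - \<nu>m) / \<beta>)) (at (- \<nu>m))"
      by simp
    show "- (p * (a - \<nu>m) / \<beta>) < 0"
      using nu_roots(2) p_gt_1 by simp
    show "((\<lambda>t. \<nu>m * (- t) + lV (- t)) has_real_derivative - \<nu>m - \<zeta> t) (at t)" for t
      using DERIV_chain2[OF DERIV_add[OF DERIV_cmult_Id lV'] DERIV_minus[OF DERIV_ident], of \<nu>m t]
      by (simp add: \<zeta>_def)
  qed
  then obtain l' where "((\<lambda>t. \<nu>m * (- t) + lV (- t)) \<longlongrightarrow> l') at_top" by blast
  then have l': "((\<lambda>t. \<nu>m * t + lV t) \<longlongrightarrow> l') at_bot" by (simp add: filterlim_at_bot_mirror)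
  have zero: "((\<lambda>r. r powr \<nu>m * profile \<gamma> r) \<longlongrightarrow> exp l') (at_right 0)"
  proof -
    have "((\<lambda>r. exp (\<nu>m * ln r + lV (ln r))) \<longlongrightarrow> exp l') (at_right 0)"
      by (intro tendsto_exp filterlim_compose[OF l'] ln_at_0)
    moreover have "eventually (\<lambda>r. exp (\<nu>m * ln r + lV (ln r)) = r powr \<nu>m * profile \<gamma> r) (at_right 0)"
      using eventually_at_right_less[of 0] by eventually_elim (simp add: lV_eq)
    ultimately show ?thesis by (rule Lim_transform_eventually)
  qed
  have "orbit p s q 0 (profile \<gamma>) = range \<gamma>"
    using traj_profile(2,4)[OF \<gamma>] by (simp add: orbit_def orbit_times_def)
  moreover have "global_extension N p s \<mu> q R v (profile \<gamma>)"
    using traj_profile(1)[OF \<gamma>] V_eq by (simp add: global_extension_def)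
  ultimately have ext: "\<exists>V. global_extension N p s \<mu> q R v V \<and>
               orbit p s q 0 V = range \<gamma> \<and>
               (\<exists>c>0. ((\<lambda>r. r powr nu_plus N p \<mu> * V r) \<longlongrightarrow> c) at_top) \<and>
               (\<exists>c>0. ((\<lambda>r. r powr nu_minus N p \<mu> * V r) \<longlongrightarrow> c) (at_right 0))"
    using top zero unfolding \<nu>m_def \<nu>p_def by (meson exp_gt_zero)
  show ?thesis
    unfolding alternative_III_def
  proof (intro conjI exI[of _ \<gamma>])
    show "\<forall>t\<in>orbit_times R v. orbit_point p s q v t = \<gamma> t"
      using eq O(1) by simp
  qed (use \<gamma> P_lims range_\<gamma> ext in \<open>simp_all add: complete_trajectory_iff\<close>)
qed

section \<open>The classification\<close>

text \<open>The minimum of \<open>H\<close> is attained only at \<open>Pstar\<close>, so Y =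
  \<open>Ystar\<close> at every time; solving this for v gives the pure power.\<close>

lemma alternative_I_if:
  assumes sol: "solution N p s \<mu> q {R<..} v" and "R > 0"
    and lev: "orbit_level N p s \<mu> q R v (H Pstar)"
  shows "alternative_I N p s \<mu> q R v (H Pstar)"
  unfolding alternative_I_def
proof (intro conjI allI impI)
  fix r assume "r > R"
  note O = solution_orbit[OF sol \<open>R > 0\<close>]
  have r: "r > 0" "ln r > ln R" "v r > 0"
    using \<open>r > R\<close> \<open>R > 0\<close> solutionD(1)[OF sol, of r] by auto
  have "H (orbit_point p s q v (ln r)) = H Pstar"
    by (rule orbit_levelD[OF lev]) (simp add: O r)
  then have "orbit_point p s q v (ln r) = Pstar"
    using O(2) r by (intro H_eq_min) (auto simp: traj_def)
  then have "r powr (p + s) * v r powr m = Ystar"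
    using r by (simp add: orbit_point_eq Pstar_eq)
  then have "v r powr m = Ystar / r powr (p + s)"
    using r by (simp add: field_simps)
  then have "(v r powr m) powr (1 / m) = Ystar powr (1 / m) / r powr ((p + s) / m)"
    using r by (simp add: powr_divide powr_powr less_imp_le)
  moreover have "(p + s) / m = a"
    unfolding m_a[symmetric] by simp
  ultimately show "v r = (mu_bar N p - \<mu>) powr (1 / (q - p + 1)) * r powr - a"
    using r by (simp add: powr_powr Ystar_eq powr_minus_divide flip: m_def)
qed simp

lemma orbit_level_exists:
  assumes sol: "solution N p s \<mu> q {R<..} v" and "R > 0"
  obtains \<kappa> where "orbit_level N p s \<mu> q R v \<kappa>" "H Pstar \<le> \<kappa>" "\<kappa> \<le> 0"
proof -
  note O = solution_orbit[OF sol \<open>R > 0\<close>]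
  define t1 where "t1 = ln R + 1"
  define \<kappa> where "\<kappa> = H (orbit_point p s q v t1)"
  have "H (orbit_point p s q v t) = \<kappa>" if "t > ln R" for t
    unfolding \<kappa>_def using that by (intro traj_H_const[OF O(2)]) (auto simp: t1_def is_interval_io)
  moreover have "t1 \<in> {ln R<..}" by (simp add: t1_def)
  ultimately have "orbit_level N p s \<mu> q R v \<kappa>"
    unfolding orbit_level_def orbit_def O(1) by (force simp: image_image)
  moreover have "H Pstar \<le> \<kappa>"
    unfolding \<kappa>_def using O(2) by (intro H_ge) (simp add: traj_def t1_def)
  moreover have "\<kappa> \<le> 0"
    unfolding \<kappa>_def by (rule O(3)) (simp add: t1_def)
  ultimately show thesis by (rule that)
qed

text \<open>Each alternative is equivalent to its own condition on \<kappa>, and these three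
  conditions split the interval from \<open>H Pstar\<close> to 0, which is nondegenerate because
  \<open>H Pstar\<close> is negative.\<close>

lemma trichotomy:
  assumes sol: "solution N p s \<mu> q {R<..} v" and "R > 0"
    and lev: "orbit_level N p s \<mu> q R v \<kappa>" "H Pstar \<le> \<kappa>" "\<kappa> \<le> 0"
  shows "exactly_one (alternative_I N p s \<mu> q R v \<kappa>)
    (alternative_II N p s \<mu> q R v \<kappa> (period \<kappa>)) (alternative_III N p s \<mu> q R v \<kappa>)"
proof -
  have I: "alternative_I N p s \<mu> q R v \<kappa> \<longleftrightarrow> \<kappa> = H Pstar"
    using alternative_I_if[OF assms(1,2)] lev(1) by (auto simp: alternative_I_def)
  have II: "alternative_II N p s \<mu> q R v \<kappa> (period \<kappa>) \<longleftrightarrow> H Pstar < \<kappa> \<and> \<kappa> < 0"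
    using alternative_II_if(1)[OF assms(1-3)] by (auto simp: alternative_II_def)
  have III: "alternative_III N p s \<mu> q R v \<kappa> \<longleftrightarrow> \<kappa> = 0"
    using alternative_III_if[OF assms(1,2)] lev(1) by (auto simp: alternative_III_def)
  show ?thesis
    unfolding I II III exactly_one_def using lev(2,3) H_Pstar_neg by linarith
qed

text \<open>Supplies solutions of a prescribed level: the profile is restricted to r > 1 because the
  starting radius has to be positive.\<close>

lemma traj_profile_level:
  assumes \<gamma>: "traj UNIV \<gamma>"
  shows "solution N p s \<mu> q {1<..} (profile \<gamma>)" "orbit_level N p s \<mu> q 1 (profile \<gamma>) (H (\<gamma> 0))"
proof -
  show sol: "solution N p s \<mu> q {1<..} (profile \<gamma>)"
    by (rule solution_subset[OF traj_profile(1)[OF \<gamma>]]) auto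
  have "H ` orbit p s q 1 (profile \<gamma>) = (\<lambda>t. H (\<gamma> 0)) ` {ln (1::real)<..}"
    unfolding orbit_def solution_orbit(1)[OF sol zero_less_one] image_image traj_profile(2)[OF \<gamma>]
    by (rule image_cong[OF refl]) (rule traj_H_const[OF \<gamma>], auto)
  also have "\<dots> = {H (\<gamma> 0)}"
    by (rule image_constant[of 1]) simp
  finally show "orbit_level N p s \<mu> q 1 (profile \<gamma>) (H (\<gamma> 0))"
    unfolding orbit_level_def .
qed

section \<open>Realisation of the three alternatives and the family of closed orbits\<close>

lemma alternative_I_exists:
  "\<exists>R>0. \<exists>v \<kappa>. solution N p s \<mu> q {R<..} v \<and> orbit_level N p s \<mu> q R v \<kappa> \<and> alternative_I N p s \<mu> q R v \<kappa>"
proof -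
  have "traj UNIV (\<lambda>t. (a, Ystar))"
    by (rule trajI) (use mu_less in \<open>auto simp: h_a Ystar_eq\<close>)
  then have "traj UNIV (\<lambda>t. Pstar)" by (simp add: Pstar_eq)
  from traj_profile_level[OF this] show ?thesis
    using alternative_I_if[OF _ zero_less_one] zero_less_one by blast
qed

lemma alternative_II_exists:
  assumes "H Pstar < \<kappa>" "\<kappa> < 0"
  shows "\<exists>v. solution N p s \<mu> q {1<..} v \<and> orbit_level N p s \<mu> q 1 v \<kappa>"
proof -
  obtain z where "z \<in> quadrant" "H z = \<kappa>"
    using level_set_nonempty[OF assms] by (auto simp: level_set_def)
  then obtain \<gamma> where "traj UNIV \<gamma>" "\<gamma> 0 = z"
    using traj_exists[of z 0] assms by auto
  then show ?thesis
    using traj_profile_level[of \<gamma>] \<open>H z = \<kappa>\<close> by auto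
qed

lemma alternative_III_exists:
  "\<exists>R>0. \<exists>v \<kappa>. solution N p s \<mu> q {R<..} v \<and> orbit_level N p s \<mu> q R v \<kappa> \<and> alternative_III N p s \<mu> q R v \<kappa>"
proof -
  have "\<nu>m < a" "a < \<nu>p" using nu_roots by auto
  then obtain \<xi> where \<xi>: "\<And>t. \<nu>m < \<xi> t \<and> \<xi> t < \<nu>p"
    "\<And>t. (\<xi> has_real_derivative drive (\<xi> t)) (at t)"
    by (rule drive_flow_exists[where ?t0.0 = 0]) blast
  have traj: "traj UNIV (\<lambda>t. zero_curve (\<xi> t))"
    by (rule traj_zero_curve[OF \<xi>])
  then have "H (zero_curve (\<xi> 0)) = 0"
    using trajD(1,2)[OF traj, of 0] H_nonpos_iff(2)[of "fst (zero_curve (\<xi> 0))" "snd (zero_curve (\<xi> 0))"]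
    by (simp add: zero_curve_def)
  then show ?thesis
    using traj_profile_level[OF traj] alternative_III_if[OF _ zero_less_one] zero_less_one by metis
qed

text \<open>The orbit of a solution of the second type is its whole level set, and every level in
  the open interval is the level of some solution.\<close>

lemma type_II_orbits_eq: "type_II_orbits N p s \<mu> q period = level_set ` {H Pstar<..<0}"
proof (intro equalityI subsetI)
  fix S assume "S \<in> type_II_orbits N p s \<mu> q period"
  then obtain R v \<kappa> where S: "S = orbit p s q R v" "R > 0" "solution N p s \<mu> q {R<..} v"
    "orbit_level N p s \<mu> q R v \<kappa>" "alternative_II N p s \<mu> q R v \<kappa> (period \<kappa>)"
    unfolding type_II_orbits_def by blast
  then have \<kappa>: "H Pstar < \<kappa>" "\<kappa> < 0" by (auto simp: alternative_II_def)
  then show "S \<in> level_set ` {H Pstar<..<0}"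
    using alternative_II_if(2)[OF S(3,2,4) \<kappa>] S(1) by auto
next
  fix S assume "S \<in> level_set ` {H Pstar<..<0}"
  then obtain \<kappa> where \<kappa>: "S = level_set \<kappa>" "H Pstar < \<kappa>" "\<kappa> < 0" by auto
  then obtain v where v: "solution N p s \<mu> q {1<..} v" "orbit_level N p s \<mu> q 1 v \<kappa>"
    using alternative_II_exists by blast
  note II = alternative_II_if[OF v(1) zero_less_one v(2) \<kappa>(2,3)]
  show "S \<in> type_II_orbits N p s \<mu> q period"
    unfolding type_II_orbits_def using v II \<kappa>(1) zero_less_one by blast
qed

lemma H_image_level_set:
  assumes "\<kappa> \<in> {H Pstar<..<0}"
  shows "H ` level_set \<kappa> = {\<kappa>}"
proof -
  have "H ` level_set \<kappa> = (\<lambda>z. \<kappa>) ` level_set \<kappa>"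
    by (rule image_cong) (simp_all add: level_set_def)
  then show ?thesis
    using level_set_nonempty[of \<kappa>] assms by (simp add: image_constant_conv)
qed

text \<open>Injectivity holds because \<open>H\<close> recovers \<kappa> from the nonempty level
  set.\<close>

lemma bij_betw_level_set:
  "bij_betw level_set {H Pstar<..<0} (type_II_orbits N p s \<mu> q period)"
  unfolding bij_betw_def type_II_orbits_eq
proof (intro conjI inj_onI refl)
  fix \<kappa> \<kappa>' assume "\<kappa> \<in> {H Pstar<..<0}" "\<kappa>' \<in> {H Pstar<..<0}" "level_set \<kappa> = level_set \<kappa>'"
  then show "\<kappa> = \<kappa>'" using H_image_level_set by (metis singleton_inject)
qed

end

theorem theorem1p5:
  fixes N p s \<mu> q :: real
  assumes "N > p" and "p > 1" and "s > - p"
    and "0 < \<mu>" and "\<mu> < mu_bar N p"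
    and "q = crit_exponent N p s - 1"
  shows "gamma_star p s q = (N - p) / p
    \<and> Y_star N p s \<mu> q = mu_bar N p - \<mu> \<and> Y_star N p s \<mu> q > 0
    \<and> (\<exists>T :: real \<Rightarrow> real.
        (\<forall>R0>0. \<forall>v. solution N p s \<mu> q {R0<..} v \<longrightarrow>
          (\<exists>\<kappa>. orbit_level N p s \<mu> q R0 v \<kappa>
             \<and> Hfun N p s \<mu> (P_star N p s \<mu> q) \<le> \<kappa> \<and> \<kappa> \<le> 0
             \<and> exactly_one (alternative_I N p s \<mu> q R0 v \<kappa>)
                           (alternative_II N p s \<mu> q R0 v \<kappa> (T \<kappa>))
                           (alternative_III N p s \<mu> q R0 v \<kappa>)))
      \<and> (\<exists>R0>0. \<exists>v \<kappa>. solution N p s \<mu> q {R0<..} v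
             \<and> orbit_level N p s \<mu> q R0 v \<kappa> \<and> alternative_I N p s \<mu> q R0 v \<kappa>)
      \<and> (\<exists>R0>0. \<exists>v \<kappa>. solution N p s \<mu> q {R0<..} v
             \<and> orbit_level N p s \<mu> q R0 v \<kappa> \<and> alternative_II N p s \<mu> q R0 v \<kappa> (T \<kappa>))
      \<and> (\<exists>R0>0. \<exists>v \<kappa>. solution N p s \<mu> q {R0<..} v
             \<and> orbit_level N p s \<mu> q R0 v \<kappa> \<and> alternative_III N p s \<mu> q R0 v \<kappa>)
      \<and> (\<exists>\<Gamma>. bij_betw \<Gamma> {Hfun N p s \<mu> (P_star N p s \<mu> q)<..<0} (type_II_orbits N p s \<mu> q T)
             \<and> (\<forall>\<kappa>\<in>{Hfun N p s \<mu> (P_star N p s \<mu> q)<..<0}. Hfun N p s \<mu> ` \<Gamma> \<kappa> = {\<kappa>})))"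
proof -
  interpret critical N p s \<mu> q
    by unfold_locales (use assms in auto)
  have II_exists: "\<exists>R0>0. \<exists>v \<kappa>. solution N p s \<mu> q {R0<..} v
      \<and> orbit_level N p s \<mu> q R0 v \<kappa> \<and> alternative_II N p s \<mu> q R0 v \<kappa> (period \<kappa>)"
  proof -
    obtain \<kappa> where "H Pstar < \<kappa>" "\<kappa> < 0"
      using dense[OF H_Pstar_neg] by blast
    then show ?thesis
      using alternative_II_exists alternative_II_if(1) zero_less_one by meson
  qed
  show ?thesis
  proof (intro conjI exI[of _ period] allI impI)
    fix R0 :: real and v assume "R0 > 0" "solution N p s \<mu> q {R0<..} v"
    then show "\<exists>\<kappa>. orbit_level N p s \<mu> q R0 v \<kappa> \<and> H Pstar \<le> \<kappa> \<and> \<kappa> \<le> 0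
       \<and> exactly_one (alternative_I N p s \<mu> q R0 v \<kappa>)
            (alternative_II N p s \<mu> q R0 v \<kappa> (period \<kappa>)) (alternative_III N p s \<mu> q R0 v \<kappa>)"
      using orbit_level_exists trichotomy by metis
  next
    show "\<exists>\<Gamma>. bij_betw \<Gamma> {H Pstar<..<0} (type_II_orbits N p s \<mu> q period)
             \<and> (\<forall>\<kappa>\<in>{H Pstar<..<0}. H ` \<Gamma> \<kappa> = {\<kappa>})"
      using bij_betw_level_set H_image_level_set by blast
  qed (rule a_eq Ystar_eq Ystar_pos alternative_I_exists alternative_III_exists II_exists)+
qed

end
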